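(* Let $m,p,n$ be positive integers with $p\mid m$ and $m$ even, $G=G(m,p,n)$ and $W=\mu(G(m,p,n))$. The algebras $\underline S_W$ and $S_G$ are defined on the same underlying vector space $S/I$. As an algebra, $\underline S_W$ is the cocycle twist $(S_G)_{\mathcal F}$ of $S_G$. The isomorphism $\phi\colon\mathbb CW\to(\mathbb CG)_{\mathcal F}$ intertwines the action $\underline\rhd$ of $\mathbb CW$ on $\underline S_W$ and the Giaquinto–Zhang twist $\rhd_{\mathcal F}$ of the action $\rhd$ of $\mathbb CG$ on $S_G$, i.e. $u\mathbin{\underline\rhd}f=\phi(u)\rhd_{\mathcal F}f$ for all $u\in\mathbb CW$ and $f\in S/I$.
   Context: $G(m,p,n)$ (resp. $\mu(G(m,p,n))$) is the group of $n\times n$ monomial complex matrices whose non-zero entries are $m$-th roots of unity and whose product of non-zero entries (resp. determinant) is an $\frac mp$-th root of unity. Both act on $V$ with basis $x_1,\dots,x_n$, hence $G$ acts by automorphisms on the symmetric algebra $S(V)$, and $W$ acts by automorphisms on $S_{-1}(V)$, the algebra generated by $x_1,\dots,x_n$ with $x_ix_j=-x_jx_i$ for $i\ne j$. The graded vector space $S=\bigoplus_{k\in\mathbb Z_{\ge0}^n}\mathbb Cx_1^{k_1}\cdots x_n^{k_n}$ spanned by standard monomials is the underlying space of both $S(V)$ and $S_{-1}(V)$. $S_G=S(V)/I_G$, where $I_G$ is the ideal of $S(V)$ generated by homogeneous $G$-invariants of positive degree. $\underline S_W=S_{-1}(V)/I_W$, where $I_W$ is the two-sided ideal of $S_{-1}(V)$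 generated by homogeneous $W$-invariants of positive degree. $I$ denotes the common underlying subspace of $S$ of the two ideals $I_G$ and $I_W$; it is stable under the group $T$ below. $T=\langle t_1,\dots,t_n\rangle\cong(C_2)^n$, where $t_i$ is the diagonal matrix with $(i,i)$ entry $-1$ and other diagonal entries $1$. $T$ acts on $S(V)$ by algebra automorphisms with $t_i\rhd x_j=(-1)^{\delta_{ij}}x_j$, hence on $S_G$, and on $\mathbb CG$ by $t_i\rhd g=t_igt_i$. Let $\mathcal F=\mathcal F^{-1}=\prod_{1\le j<i\le n}\frac12(1\otimes1+t_i\otimes1+1\otimes t_j-t_i\otimes t_j)\in\mathbb CT\otimes\mathbb CT$, a $2$-cocycle. For a $\mathbb CT$-module algebra $(A,m)$, its cocycle twist $A_{\mathcal F}$ is the space $A$ with product $m\circ(\mathcal F^{-1}\rhd)$. For an $A$-module $M$ with compatible $T$-action (i.e. $h\rhd(a\rhd v)=(h\rhd a)\rhd(h\rhd v)$ for $h\in T$), the Giaquinto–Zhang twist is the action $\rhd_{\mathcal F}=\rhd\circ(\mathcal F^{-1}\rhd)$ of $A_{\mathcal F}$ on $M$. $\phi\colon\mathbb CW\to(\mathbb CG)_{\mathcal F}$ is the known algebra isomorphism determined by $\phi(\sigma_i)=\bar s_i$ ($1\le i\le n-1$) and $\phi(t)=t$ for diagonal $t\in G$ (these are also the diagonal matrices in $W$), where $\sigma_i$ sends $x_i\mapsto x_{i+1}$, $x_{i+1}\mapsto-x_i$, and $\bar s_i$ sends $x_i\mapsto-x_{i+1}$, $x_{i+1}\mapsto-x_i$,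 both fixing the other $x_k$. *)

theory Defs
  imports
    "Jordan_Normal_Form.Determinant"
    "HOL-Algebra.QuotRing"
    "HOL-Algebra.Generated_Groups"
    "HOL-Library.Poly_Mapping"
begin

text \<open>
  Complex algebras are records of the library type \<open>(complex, 'a) module\<close>
  (a ring together with a scalar multiplication). The basis \<open>x\<^sub>1, \<dots>, x\<^sub>n\<close> is indexed from
  \<open>0\<close>, i.e. by \<open>{..<n}\<close>. A matrix \<open>g\<close> acts on \<open>V\<close> from the left,
  \<open>g x\<^sub>j = (\<Sum>i<n. g\<^sub>i\<^sub>j x\<^sub>i)\<close>.
\<close>

definition scale :: "complex \<Rightarrow> ('k \<Rightarrow>\<^sub>0 complex) \<Rightarrow> ('k \<Rightarrow>\<^sub>0 complex)" where
  "scale c f = Poly_Mapping.map ((*) c) f"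

definition same_algebra :: "(complex, 'a) module \<Rightarrow> (complex, 'a) module \<Rightarrow> bool" where
  "same_algebra A B \<longleftrightarrow>
     carrier A = carrier B \<and> \<one>\<^bsub>A\<^esub> = \<one>\<^bsub>B\<^esub> \<and> \<zero>\<^bsub>A\<^esub> = \<zero>\<^bsub>B\<^esub> \<and>
     (\<forall>x\<in>carrier A. \<forall>y\<in>carrier A. x \<oplus>\<^bsub>A\<^esub> y = x \<oplus>\<^bsub>B\<^esub> y \<and> x \<otimes>\<^bsub>A\<^esub> y = x \<otimes>\<^bsub>B\<^esub> y) \<and>
     (\<forall>c. \<forall>x\<in>carrier A. c \<odot>\<^bsub>A\<^esub> x = c \<odot>\<^bsub>B\<^esub> x)"

definition algebra_iso :: "(complex, 'a) module \<Rightarrow> (complex, 'b) module \<Rightarrow> ('a \<Rightarrow> 'b) set" where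
  "algebra_iso A B =
     {f \<in> ring_iso A B. \<forall>c. \<forall>x\<in>carrier A. f (c \<odot>\<^bsub>A\<^esub> x) = c \<odot>\<^bsub>B\<^esub> f x}"

definition quotient_algebra :: "(complex, 'a) module \<Rightarrow> 'a set \<Rightarrow> (complex, 'a set) module" where
  "quotient_algebra A I =
     ring.extend (A Quot I) (module.fields (\<lambda>c X. \<Union>x\<in>X. I +>\<^bsub>A\<^esub> (c \<odot>\<^bsub>A\<^esub> x)))"


section \<open>The groups\<close>

definition GL :: "nat \<Rightarrow> complex mat monoid" where
  "GL n = units_of (ring_mat TYPE(complex) n ())"

definition monomial_mat :: "nat \<Rightarrow> complex mat \<Rightarrow> bool" where
  "monomial_mat n A \<longleftrightarrow> A \<in> carrier_mat n n \<and>
     (\<forall>i<n. \<exists>!j. j < n \<and> A $$ (i,j) \<noteq> 0) \<and>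
     (\<forall>j<n. \<exists>!i. i < n \<and> A $$ (i,j) \<noteq> 0)"

definition nonzero_positions :: "nat \<Rightarrow> complex mat \<Rightarrow> (nat \<times> nat) set" where
  "nonzero_positions n A = {(i,j). i < n \<and> j < n \<and> A $$ (i,j) \<noteq> 0}"

definition G_group :: "nat \<Rightarrow> nat \<Rightarrow> nat \<Rightarrow> complex mat monoid" where
  "G_group m p n = (GL n)\<lparr>carrier :=
     {A. monomial_mat n A \<and> (\<forall>ij\<in>nonzero_positions n A. (A $$ ij) ^ m = 1) \<and>
         (\<Prod>ij\<in>nonzero_positions n A. A $$ ij) ^ (m div p) = 1}\<rparr>"

definition W_group :: "nat \<Rightarrow> nat \<Rightarrow> nat \<Rightarrow> complex mat monoid" where
  "W_group m p n = (GL n)\<lparr>carrier :=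
     {A. monomial_mat n A \<and> (\<forall>ij\<in>nonzero_positions n A. (A $$ ij) ^ m = 1) \<and>
         det A ^ (m div p) = 1}\<rparr>"

definition t_mat :: "nat \<Rightarrow> nat \<Rightarrow> complex mat" where
  "t_mat n i = mat n n (\<lambda>(a,b). if a \<noteq> b then 0 else if a = i then -1 else 1)"

definition T_group :: "nat \<Rightarrow> complex mat monoid" where
  "T_group n = (GL n)\<lparr>carrier := generate (GL n) (t_mat n ` {..<n})\<rparr>"

text \<open>Below, \<open>\<sigma>\<^sub>i\<close> and the matrix with bar \<open>s\<^sub>i\<close>; column \<open>b\<close> holds the image of \<open>x\<^sub>b\<close>.\<close>

definition sigma_mat :: "nat \<Rightarrow> nat \<Rightarrow> complex mat" where
  "sigma_mat n i = mat n n (\<lambda>(a,b).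
     if b = i then (if a = Suc i then 1 else 0)
     else if b = Suc i then (if a = i then -1 else 0)
     else if a = b then 1 else 0)"

definition sbar_mat :: "nat \<Rightarrow> nat \<Rightarrow> complex mat" where
  "sbar_mat n i = mat n n (\<lambda>(a,b).
     if b = i then (if a = Suc i then -1 else 0)
     else if b = Suc i then (if a = i then -1 else 0)
     else if a = b then 1 else 0)"


section \<open>Group algebras\<close>

definition group_algebra :: "('g, 'r) monoid_scheme \<Rightarrow> (complex, 'g \<Rightarrow>\<^sub>0 complex) module" where
  "group_algebra G =
     \<lparr>carrier = {a. Poly_Mapping.keys a \<subseteq> carrier G},
      mult = (\<lambda>a b. \<Sum>g\<in>Poly_Mapping.keys a. \<Sum>h\<in>Poly_Mapping.keys b.
        Poly_Mapping.single (g \<otimes>\<^bsub>G\<^esub> h) (Poly_Mapping.lookup a g * Poly_Mapping.lookup b h)),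
      one = Poly_Mapping.single \<one>\<^bsub>G\<^esub> 1,
      zero = 0,
      add = (+),
      module.smult = scale\<rparr>"

abbreviation grp :: "'g \<Rightarrow> ('g \<Rightarrow>\<^sub>0 complex)" where
  "grp g \<equiv> Poly_Mapping.single g 1"

definition conj_action :: "nat \<Rightarrow> complex mat \<Rightarrow> (complex mat \<Rightarrow>\<^sub>0 complex) \<Rightarrow> (complex mat \<Rightarrow>\<^sub>0 complex)"
  where
  "conj_action n t a = (\<Sum>g\<in>Poly_Mapping.keys a.
     Poly_Mapping.single (t \<otimes>\<^bsub>GL n\<^esub> g \<otimes>\<^bsub>GL n\<^esub> inv\<^bsub>GL n\<^esub> t) (Poly_Mapping.lookup a g))"


section \<open>The algebras on the space of polynomials\<close>

text \<open>A monomial is its exponent vector, a finitely supported function \<open>nat \<Rightarrow>\<^sub>0 nat\<close>.\<close>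

type_synonym monomial = "nat \<Rightarrow>\<^sub>0 nat"
type_synonym polynomial = "monomial \<Rightarrow>\<^sub>0 complex"

definition S_space :: "nat \<Rightarrow> polynomial set" where
  "S_space n = {f. \<forall>k\<in>Poly_Mapping.keys f. Poly_Mapping.keys k \<subseteq> {..<n}}"

definition var :: "nat \<Rightarrow> polynomial" where
  "var i = Poly_Mapping.single (Poly_Mapping.single i 1) 1"

definition Sym :: "nat \<Rightarrow> (complex, polynomial) module" where
  "Sym n = \<lparr>carrier = S_space n, mult = (*), one = 1, zero = 0, add = (+), module.smult = scale\<rparr>"

text \<open>
  In \<open>S\<^sub>-\<^sub>1(V)\<close>, sorting the product of the standard monomials \<open>x\<^sup>k\<close> and \<open>x\<^sup>l\<close> moves each
  factor \<open>x\<^sub>j\<close> of \<open>x\<^sup>l\<close> past every factor \<open>x\<^sub>i\<close> of \<open>x\<^sup>k\<close> with \<open>i > j\<close>, each time changing the sign.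
\<close>

definition skew_sign :: "monomial \<Rightarrow> monomial \<Rightarrow> complex" where
  "skew_sign k l = (-1) ^ (\<Sum>i\<in>Poly_Mapping.keys k. \<Sum>j\<in>{j \<in> Poly_Mapping.keys l. j < i}.
     Poly_Mapping.lookup k i * Poly_Mapping.lookup l j)"

definition skew_mult :: "polynomial \<Rightarrow> polynomial \<Rightarrow> polynomial" where
  "skew_mult f h = (\<Sum>k\<in>Poly_Mapping.keys f. \<Sum>l\<in>Poly_Mapping.keys h.
     Poly_Mapping.single (k + l)
       (skew_sign k l * Poly_Mapping.lookup f k * Poly_Mapping.lookup h l))"

definition Skew :: "nat \<Rightarrow> (complex, polynomial) module" where
  "Skew n = (Sym n)\<lparr>mult := skew_mult\<rparr>"

lemma skew_mult_single:
  "skew_mult (Poly_Mapping.single k a) (Poly_Mapping.single l b) =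
     Poly_Mapping.single (k + l) (skew_sign k l * a * b)"
  by (simp add: skew_mult_def)

lemma skew_mult_var:
  assumes "i \<noteq> j"
  shows "skew_mult (var i) (var j) = - skew_mult (var j) (var i)"
proof -
  have "skew_sign (Poly_Mapping.single i 1) (Poly_Mapping.single j 1) = (if j < i then -1 else 1)"
    for i j :: nat
  proof -
    have "{j'. j' = j \<and> j' < i} = (if j < i then {j} else {})"
      by auto
    then show ?thesis
      by (simp add: skew_sign_def)
  qed
  then show ?thesis
    using assms
    by (simp add: var_def skew_mult_single add.commute single_uminus)
qed

text \<open>
  The linear action of a matrix \<open>g\<close> on \<open>A = S(V)\<close> or \<open>A = S\<^sub>-\<^sub>1(V)\<close> extending its action on \<open>V\<close>
  multiplicatively: the standard monomial \<open>x\<^sub>1\<^sup>k\<^sup>1 \<dots> x\<^sub>n\<^sup>k\<^sup>n\<close> is sent to the ordered product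
  \<open>(g x\<^sub>1)\<^sup>k\<^sup>1 \<dots> (g x\<^sub>n)\<^sup>k\<^sup>n\<close> taken in \<open>A\<close>.
\<close>

definition lin_image :: "nat \<Rightarrow> complex mat \<Rightarrow> nat \<Rightarrow> polynomial" where
  "lin_image n g j = (\<Sum>i<n. scale (g $$ (i,j)) (var i))"

definition mat_action ::
  "(complex, polynomial) module \<Rightarrow> nat \<Rightarrow> complex mat \<Rightarrow> polynomial \<Rightarrow> polynomial" where
  "mat_action A n g f = (\<Sum>k\<in>Poly_Mapping.keys f. scale (Poly_Mapping.lookup f k)
     (foldr (\<otimes>\<^bsub>A\<^esub>) (map (\<lambda>j. lin_image n g j [^]\<^bsub>A\<^esub> Poly_Mapping.lookup k j) [0..<n]) \<one>\<^bsub>A\<^esub>))"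

definition homogeneous :: "nat \<Rightarrow> polynomial \<Rightarrow> bool" where
  "homogeneous d f \<longleftrightarrow>
     (\<forall>k\<in>Poly_Mapping.keys f. (\<Sum>i\<in>Poly_Mapping.keys k. Poly_Mapping.lookup k i) = d)"

definition pos_invariants ::
  "(complex, polynomial) module \<Rightarrow> nat \<Rightarrow> complex mat monoid \<Rightarrow> polynomial set" where
  "pos_invariants A n H = {f \<in> carrier A. (\<exists>d>0. homogeneous d f) \<and>
     (\<forall>g\<in>carrier H. mat_action A n g f = f)}"

definition coinvariant_ideal ::
  "(complex, polynomial) module \<Rightarrow> nat \<Rightarrow> complex mat monoid \<Rightarrow> polynomial set" where
  "coinvariant_ideal A n H = Idl\<^bsub>A\<^esub> (pos_invariants A n H)"

definition I_G :: "nat \<Rightarrow> nat \<Rightarrow> nat \<Rightarrow> polynomial set" where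
  "I_G m p n = coinvariant_ideal (Sym n) n (G_group m p n)"

definition I_W :: "nat \<Rightarrow> nat \<Rightarrow> nat \<Rightarrow> polynomial set" where
  "I_W m p n = coinvariant_ideal (Skew n) n (W_group m p n)"

definition S_G :: "nat \<Rightarrow> nat \<Rightarrow> nat \<Rightarrow> (complex, polynomial set) module" where
  "S_G m p n = quotient_algebra (Sym n) (I_G m p n)"

definition S_W :: "nat \<Rightarrow> nat \<Rightarrow> nat \<Rightarrow> (complex, polynomial set) module" where
  "S_W m p n = quotient_algebra (Skew n) (I_W m p n)"

text \<open>
  The induced action on a quotient \<open>A/I\<close> by a stable ideal: elements of \<open>A/I\<close> are cosets,
  and a matrix maps a coset to its image.
\<close>

definition coset_action ::
  "(complex, polynomial) module \<Rightarrow> nat \<Rightarrow> complex mat \<Rightarrow> polynomial set \<Rightarrow> polynomial set" where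
  "coset_action A n g X = mat_action A n g ` X"

definition linear_action ::
  "(complex, 'v) module \<Rightarrow> ('g \<Rightarrow> 'v \<Rightarrow> 'v) \<Rightarrow> ('g \<Rightarrow>\<^sub>0 complex) \<Rightarrow> 'v \<Rightarrow> 'v" where
  "linear_action M act a v =
     (\<Oplus>\<^bsub>M\<^esub>g\<in>Poly_Mapping.keys a. Poly_Mapping.lookup a g \<odot>\<^bsub>M\<^esub> act g v)"

definition G_action :: "nat \<Rightarrow> nat \<Rightarrow> nat \<Rightarrow>
    (complex mat \<Rightarrow>\<^sub>0 complex) \<Rightarrow> polynomial set \<Rightarrow> polynomial set" where
  "G_action m p n = linear_action (S_G m p n) (coset_action (Sym n) n)"

definition W_action :: "nat \<Rightarrow> nat \<Rightarrow> nat \<Rightarrow>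
    (complex mat \<Rightarrow>\<^sub>0 complex) \<Rightarrow> polynomial set \<Rightarrow> polynomial set" where
  "W_action m p n = linear_action (S_W m p n) (coset_action (Skew n) n)"


section \<open>Cocycle twists\<close>

text \<open>
  \<open>\<complex>T \<otimes> \<complex>T\<close> is the group algebra of \<open>T \<times> T\<close>, the pure tensor \<open>s \<otimes> t\<close> of group elements being
  the pair \<open>(s,t)\<close>. An element \<open>R = \<Sum> R\<^sub>s\<^sub>t s \<otimes> t\<close> applied to \<open>a \<otimes> v\<close> and followed by a bilinear
  map \<open>\<mu>\<close> into \<open>M\<close> is \<open>\<Sum> R\<^sub>s\<^sub>t \<mu>(s \<rhd> a, t \<rhd> v)\<close>.
\<close>

abbreviation TT_algebra :: "nat \<Rightarrow> (complex, complex mat \<times> complex mat \<Rightarrow>\<^sub>0 complex) module" where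
  "TT_algebra n \<equiv> group_algebra (T_group n \<times>\<times> T_group n)"

definition cocycle :: "nat \<Rightarrow> (complex mat \<times> complex mat \<Rightarrow>\<^sub>0 complex)" where
  "cocycle n = finprod (TT_algebra n)
     (\<lambda>(i,j). scale (1/2) (grp (1\<^sub>m n, 1\<^sub>m n) + grp (t_mat n i, 1\<^sub>m n) + grp (1\<^sub>m n, t_mat n j)
                         - grp (t_mat n i, t_mat n j)))
     {(i,j). j < i \<and> i < n}"

definition tensor_apply ::
  "(complex, 'w) module \<Rightarrow> ('t \<times> 't \<Rightarrow>\<^sub>0 complex) \<Rightarrow> ('t \<Rightarrow> 'a \<Rightarrow> 'a) \<Rightarrow> ('t \<Rightarrow> 'v \<Rightarrow> 'v) \<Rightarrow>
     ('a \<Rightarrow> 'v \<Rightarrow> 'w) \<Rightarrow> 'a \<Rightarrow> 'v \<Rightarrow> 'w" where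
  "tensor_apply M R actA actV \<mu> a v = (\<Oplus>\<^bsub>M\<^esub>st\<in>Poly_Mapping.keys R.
     Poly_Mapping.lookup R st \<odot>\<^bsub>M\<^esub> \<mu> (actA (fst st) a) (actV (snd st) v))"

definition cocycle_twist ::
  "nat \<Rightarrow> (complex mat \<Rightarrow> 'a \<Rightarrow> 'a) \<Rightarrow> (complex, 'a) module \<Rightarrow> (complex, 'a) module" where
  "cocycle_twist n act A =
     A\<lparr>mult := tensor_apply A (inv\<^bsub>TT_algebra n\<^esub> (cocycle n)) act act (\<otimes>\<^bsub>A\<^esub>)\<rparr>"

definition GZ_twist ::
  "nat \<Rightarrow> (complex mat \<Rightarrow> 'a \<Rightarrow> 'a) \<Rightarrow> (complex, 'v) module \<Rightarrow> (complex mat \<Rightarrow> 'v \<Rightarrow> 'v) \<Rightarrow>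
     ('a \<Rightarrow> 'v \<Rightarrow> 'v) \<Rightarrow> 'a \<Rightarrow> 'v \<Rightarrow> 'v" where
  "GZ_twist n actA M actM rho =
     tensor_apply M (inv\<^bsub>TT_algebra n\<^esub> (cocycle n)) actA actM rho"

definition CG_twisted :: "nat \<Rightarrow> nat \<Rightarrow> nat \<Rightarrow> (complex, complex mat \<Rightarrow>\<^sub>0 complex) module" where
  "CG_twisted m p n = cocycle_twist n (conj_action n) (group_algebra (G_group m p n))"

definition S_G_twisted :: "nat \<Rightarrow> nat \<Rightarrow> nat \<Rightarrow> (complex, polynomial set) module" where
  "S_G_twisted m p n = cocycle_twist n (coset_action (Sym n) n) (S_G m p n)"

definition G_action_twisted :: "nat \<Rightarrow> nat \<Rightarrow> nat \<Rightarrow>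
    (complex mat \<Rightarrow>\<^sub>0 complex) \<Rightarrow> polynomial set \<Rightarrow> polynomial set" where
  "G_action_twisted m p n =
     GZ_twist n (conj_action n) (S_G m p n) (coset_action (Sym n) n) (G_action m p n)"

definition is_phi :: "nat \<Rightarrow> nat \<Rightarrow> nat \<Rightarrow>
    ((complex mat \<Rightarrow>\<^sub>0 complex) \<Rightarrow> (complex mat \<Rightarrow>\<^sub>0 complex)) \<Rightarrow> bool" where
  "is_phi m p n \<phi> \<longleftrightarrow>
     \<phi> \<in> algebra_iso (group_algebra (W_group m p n)) (CG_twisted m p n) \<and>
     (\<forall>i. Suc i < n \<longrightarrow> \<phi> (grp (sigma_mat n i)) = grp (sbar_mat n i)) \<and>
     (\<forall>t\<in>carrier (G_group m p n). diagonal_mat t \<longrightarrow> \<phi> (grp t) = grp t)"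

end

theory Submission
  imports Defs
begin

text \<open>
  Write \<open>\<epsilon>(k,l)\<close> for the sign by which the product of the standard monomials \<open>x\<^sup>k\<close> and \<open>x\<^sup>l\<close> in
  \<open>S\<^sub>-\<^sub>1(V)\<close> differs from \<open>x\<^sup>k\<^sup>+\<^sup>l\<close>; it is a bicharacter with \<open>\<epsilon>\<^sup>2 = 1\<close>. A standard monomial
  is an eigenvector of all of \<open>T\<close>, so it determines a character of \<open>T\<close>, and the value of the cocycle at
  the pair of characters belonging to \<open>x\<^sup>k\<close> and \<open>x\<^sup>l\<close> is exactly \<open>\<epsilon>(k,l)\<close> (lemma \<open>TT_eval_twist\<close>).
  This computation is what relates the two algebras.

  The algebra. The product of \<open>S\<^sub>-\<^sub>1(V)\<close> is the twist of the product of \<open>S(V)\<close>, and since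
  \<open>\<epsilon>\<^sup>2 = 1\<close> the converse holds as well (lemma \<open>tmult_twisted\<close>). Consequently a \<open>T\<close>-stable subspace is
  an ideal for one product if and only if it is an ideal for the other one, and a \<open>T\<close>-stable set
  generates the same ideal in both algebras.

  The ideals. If \<open>f\<close> is invariant under the diagonal matrices of \<open>G\<close>, which are also those of \<open>W\<close>,
  then all exponents of a monomial of \<open>f\<close> have the same parity, because \<open>m\<close> is even. On such an \<open>f\<close>
  the elements of \<open>G\<close> (acting on \<open>S(V)\<close>) and those of \<open>W\<close> (acting on \<open>S\<^sub>-\<^sub>1(V)\<close>) merely permute the
  variables: the signs that arise from sorting the variables in \<open>S\<^sub>-\<^sub>1(V)\<close> form a power of the sign of
  the permutation, and this is precisely the difference between a condition on the determinant and a
  condition on the product of the entries. So \<open>G\<close> and \<open>W\<close> have literally the same invariants. They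
  form a \<open>T\<close>-stable set because \<open>T\<close> normalises \<open>G\<close>, hence \<open>I_G = I_W\<close> (theorem \<open>I_G_eq_I_W\<close>), and the
  description of the product passes to the quotient.

  The actions. If \<open>g\<close> is monomial with underlying permutation \<open>w\<close>, then on standard monomials the
  Giaquinto-Zhang twist is \<open>g \<rhd>\<^sub>F x\<^sup>k = \<epsilon>(k + wk, k) g \<rhd> x\<^sup>k\<close> (lemma \<open>twisted_action_single\<close>). Since
  \<open>\<epsilon>\<close> is a bicharacter, this is an action of the twisted group algebra on polynomials (lemma
  \<open>twisted_action_mult\<close>). Sorting signs also satisfy a cocycle identity, so monomial matrices act on
  \<open>S\<^sub>-\<^sub>1(V)\<close> as well (lemma \<open>Skew_action_mult\<close>). Both sides of the intertwining identity are therefore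
  multiplicative and linear in \<open>u\<close>, and it suffices to compare them on generators of \<open>W\<close>: the diagonal
  matrices, where both sides multiply each monomial by the same scalar, and the \<open>\<sigma>\<^sub>i\<close>, where the two
  signs are compared by a parity count (lemma \<open>sigma_action\<close>).
\<close>

section \<open>Linear and bilinear extension\<close>

lemma lookup_scale [simp]:
  "Poly_Mapping.lookup (scale c f) k = c * Poly_Mapping.lookup f k"
  by (simp add: scale_def Poly_Mapping.map.rep_eq when_def)

interpretation pm: vector_space "scale :: complex \<Rightarrow> ('k \<Rightarrow>\<^sub>0 complex) \<Rightarrow> _"
  by unfold_locales (auto intro!: poly_mapping_eqI simp: lookup_add algebra_simps)

lemma scale_single [simp]: "scale c (Poly_Mapping.single k d) = Poly_Mapping.single k (c * d)"
  by (simp add: scale_def)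

lemma keys_scale_subset: "Poly_Mapping.keys (scale c f) \<subseteq> Poly_Mapping.keys f"
  by (auto simp: in_keys_iff)

lemma keys_sum_subset: "Poly_Mapping.keys (sum f A) \<subseteq> (\<Union>x\<in>A. Poly_Mapping.keys (f x))"
  by (induction A rule: infinite_finite_induct) (use keys_add in fastforce)+

lemma poly_mapping_linear_induct [consumes 1, case_names zero single add]:
  fixes a :: "'k \<Rightarrow>\<^sub>0 'v::comm_monoid_add"
  assumes "Poly_Mapping.keys a \<subseteq> K"
    and zero: "P 0"
    and single: "\<And>k c. k \<in> K \<Longrightarrow> P (Poly_Mapping.single k c)"
    and add: "\<And>a b. Poly_Mapping.keys a \<subseteq> K \<Longrightarrow> Poly_Mapping.keys b \<subseteq> K \<Longrightarrow> P a \<Longrightarrow> P b \<Longrightarrow> P (a + b)"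
  shows "P a"
proof -
  have a: "a = (\<Sum>k\<in>Poly_Mapping.keys a. Poly_Mapping.single k (Poly_Mapping.lookup a k))"
    by (rule poly_mapping_eqI) (auto simp: lookup_sum lookup_single when_def in_keys_iff)
  have "Poly_Mapping.keys (\<Sum>k\<in>A. Poly_Mapping.single k (f k)) \<subseteq> K \<and>
      P (\<Sum>k\<in>A. Poly_Mapping.single k (f k))" if "finite A" "A \<subseteq> K" for A f
    using that
  proof (induction A rule: finite_induct)
    case (insert x A)
    have x: "Poly_Mapping.keys (Poly_Mapping.single x (f x)) \<subseteq> K"
      using insert by simp
    have A: "Poly_Mapping.keys (\<Sum>k\<in>A. Poly_Mapping.single k (f k)) \<subseteq> K"
      "P (\<Sum>k\<in>A. Poly_Mapping.single k (f k))"
      using insert by auto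
    have "Poly_Mapping.keys (Poly_Mapping.single x (f x) + (\<Sum>k\<in>A. Poly_Mapping.single k (f k))) \<subseteq> K"
      using keys_add[of "Poly_Mapping.single x (f x)"] x A(1) by blast
    moreover have "P (Poly_Mapping.single x (f x) + (\<Sum>k\<in>A. Poly_Mapping.single k (f k)))"
      using add[OF x A(1) single A(2)] insert.prems by simp
    ultimately show ?case
      using insert.hyps by simp
  qed (simp add: zero)
  from this[OF finite_keys assms(1)] show ?thesis
    using a by metis
qed

text \<open>
  Actions of group algebras, the action of a matrix on polynomials and the twists are all linear
  extensions of maps on a basis, so that identities between them can be checked on basis elements by \<open>poly_mapping_linear_induct\<close>.
\<close>

definition lext :: "('k \<Rightarrow> ('b \<Rightarrow>\<^sub>0 complex)) \<Rightarrow> ('k \<Rightarrow>\<^sub>0 complex) \<Rightarrow> ('b \<Rightarrow>\<^sub>0 complex)" where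
  "lext F a = (\<Sum>k\<in>Poly_Mapping.keys a. scale (Poly_Mapping.lookup a k) (F k))"

lemma lext_single [simp]: "lext F (Poly_Mapping.single k c) = scale c (F k)"
  by (simp add: lext_def)

lemma lext_zero [simp]: "lext F 0 = 0"
  by (simp add: lext_def)

lemma lext_add: "lext F (a + b) = lext F a + lext F b"
  unfolding lext_def by (rule setsum_keys_plus_distrib) (auto simp: pm.scale_left_distrib)

lemma lext_scale: "lext F (scale c a) = scale c (lext F a)"
proof (cases "c = 0")
  case False
  then have "Poly_Mapping.keys (scale c a) = Poly_Mapping.keys a"
    by (auto simp: in_keys_iff)
  then show ?thesis
    by (simp add: lext_def pm.scale_sum_right)
qed simp

lemma lext_sum: "lext F (sum f A) = (\<Sum>x\<in>A. lext F (f x))"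
  by (induction A rule: infinite_finite_induct) (auto simp: lext_add)

lemma lext_cong:
  "(\<And>k. k \<in> Poly_Mapping.keys a \<Longrightarrow> F k = G k) \<Longrightarrow> lext F a = lext G a"
  by (simp add: lext_def)

lemma lext_lext: "lext F (lext G a) = lext (\<lambda>k. lext F (G k)) a"
  by (simp add: lext_def[of G] lext_def[of _ a] lext_sum lext_scale)

lemma lext_fun_add: "lext (\<lambda>k. F k + G k) a = lext F a + lext G a"
  by (simp add: lext_def pm.scale_right_distrib sum.distrib)

lemma lext_fun_scale: "lext (\<lambda>k. scale c (F k)) a = scale c (lext F a)"
  by (simp add: lext_def pm.scale_sum_right mult.commute)

lemma lext_id: "lext (\<lambda>k. Poly_Mapping.single k 1) a = a"
  by (rule poly_mapping_eqI)
    (auto simp: lext_def lookup_sum lookup_single when_def in_keys_iff if_distrib cong: if_cong)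

lemma keys_lext: "Poly_Mapping.keys (lext F a) \<subseteq> (\<Union>k\<in>Poly_Mapping.keys a. Poly_Mapping.keys (F k))"
  unfolding lext_def using keys_sum_subset keys_scale_subset by fastforce

lemma keys_lext_subset:
  "(\<And>k. k \<in> Poly_Mapping.keys a \<Longrightarrow> Poly_Mapping.keys (F k) \<subseteq> K) \<Longrightarrow> Poly_Mapping.keys (lext F a) \<subseteq> K"
  using keys_lext[of F a] by blast

lemma lext_swap: "lext (\<lambda>k. lext (\<lambda>l. F k l) b) a = lext (\<lambda>l. lext (\<lambda>k. F k l) a) b"
  unfolding lext_def pm.scale_sum_right by (subst sum.swap) (simp add: mult.commute)

definition bil :: "('k \<Rightarrow> 'l \<Rightarrow> ('b \<Rightarrow>\<^sub>0 complex)) \<Rightarrow> ('k \<Rightarrow>\<^sub>0 complex) \<Rightarrow> ('l \<Rightarrow>\<^sub>0 complex) \<Rightarrow> ('b \<Rightarrow>\<^sub>0 complex)"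
  where "bil \<mu> a b = lext (\<lambda>k. lext (\<mu> k) b) a"

lemma bil_simps [simp]:
  "bil \<mu> (Poly_Mapping.single k c) (Poly_Mapping.single l d) = scale (c * d) (\<mu> k l)"
  "bil \<mu> 0 b = 0" "bil \<mu> a 0 = 0"
  by (simp_all add: bil_def) (simp add: lext_def)

lemma bil_add_left: "bil \<mu> (a + a') b = bil \<mu> a b + bil \<mu> a' b"
  by (simp add: bil_def lext_add)

lemma bil_add_right: "bil \<mu> a (b + b') = bil \<mu> a b + bil \<mu> a b'"
  by (simp add: bil_def lext_add lext_fun_add)

lemma bil_scale_left: "bil \<mu> (scale c a) b = scale c (bil \<mu> a b)"
  by (simp add: bil_def lext_scale)

lemma bil_scale_right: "bil \<mu> a (scale c b) = scale c (bil \<mu> a b)"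
  by (simp add: bil_def lext_scale lext_fun_scale)

text \<open>
  Associativity of a bilinear product is a trilinear identity, so basis elements suffice. The basis is
  restricted to \<open>K\<close> because products of group elements are only associative inside the carrier.
\<close>

lemma bil_assoc:
  assumes a: "Poly_Mapping.keys a \<subseteq> K" "Poly_Mapping.keys b \<subseteq> K" "Poly_Mapping.keys c \<subseteq> K"
    and assoc: "\<And>x y z. x \<in> K \<Longrightarrow> y \<in> K \<Longrightarrow> z \<in> K \<Longrightarrow>
      bil \<mu> (\<mu> x y) (Poly_Mapping.single z 1) = bil \<mu> (Poly_Mapping.single x 1) (\<mu> y z)"
  shows "bil \<mu> (bil \<mu> a b) c = bil \<mu> a (bil \<mu> b c)"
  using a(1)
proof (induction rule: poly_mapping_linear_induct)
  case (single x r)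
  show ?case using a(2)
  proof (induction rule: poly_mapping_linear_induct)
    case (single y s)
    show ?case using a(3)
    proof (induction rule: poly_mapping_linear_induct)
      case (single z t)
      have "scale (r * s * t) (bil \<mu> (\<mu> x y) (Poly_Mapping.single z 1)) =
          scale (r * s * t) (bil \<mu> (Poly_Mapping.single x 1) (\<mu> y z))"
        using assoc \<open>x \<in> K\<close> \<open>y \<in> K\<close> \<open>z \<in> K\<close> by simp
      moreover have "Poly_Mapping.single z t = scale t (Poly_Mapping.single z 1)"
        "Poly_Mapping.single x r = scale r (Poly_Mapping.single x 1)" by simp_all
      ultimately show ?case
        by (simp only: bil_scale_left bil_scale_right bil_simps pm.scale_scale) (simp add: ac_simps)
    qed (auto simp: bil_add_right)
  qed (auto simp: bil_add_right bil_add_left)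
qed (auto simp: bil_add_left)

lemma keys_bil_subset:
  "(\<And>k l. k \<in> Poly_Mapping.keys a \<Longrightarrow> l \<in> Poly_Mapping.keys b \<Longrightarrow> Poly_Mapping.keys (\<mu> k l) \<subseteq> K) \<Longrightarrow>
    Poly_Mapping.keys (bil \<mu> a b) \<subseteq> K"
  unfolding bil_def by (intro keys_lext_subset)

section \<open>Group algebras\<close>

lemma group_algebra_simps [simp]:
  "carrier (group_algebra G) = {a. Poly_Mapping.keys a \<subseteq> carrier G}"
  "\<one>\<^bsub>group_algebra G\<^esub> = grp \<one>\<^bsub>G\<^esub>"
  "\<zero>\<^bsub>group_algebra G\<^esub> = 0"
  "a \<oplus>\<^bsub>group_algebra G\<^esub> b = a + b"
  "c \<odot>\<^bsub>group_algebra G\<^esub> a = scale c a"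
  "a \<otimes>\<^bsub>group_algebra G\<^esub> b = bil (\<lambda>g h. grp (g \<otimes>\<^bsub>G\<^esub> h)) a b"
  by (simp_all add: group_algebra_def bil_def lext_def pm.scale_sum_right)

lemma comm_monoid_group_algebra:
  assumes "comm_monoid G"
  shows "comm_monoid (group_algebra G)"
proof -
  interpret G: comm_monoid G by fact
  have closed: "Poly_Mapping.keys (bil (\<lambda>g h. grp (g \<otimes>\<^bsub>G\<^esub> h)) x y) \<subseteq> carrier G"
    if "Poly_Mapping.keys x \<subseteq> carrier G" "Poly_Mapping.keys y \<subseteq> carrier G" for x y
    using that by (intro keys_bil_subset) auto
  have comm: "bil (\<lambda>g h. grp (g \<otimes>\<^bsub>G\<^esub> h)) x y = bil (\<lambda>g h. grp (g \<otimes>\<^bsub>G\<^esub> h)) y x"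
    if "Poly_Mapping.keys x \<subseteq> carrier G" "Poly_Mapping.keys y \<subseteq> carrier G" for x y
    unfolding bil_def by (subst lext_swap) (intro lext_cong, use that in \<open>auto simp: G.m_comm subset_iff\<close>)
  have one: "bil (\<lambda>g h. grp (g \<otimes>\<^bsub>G\<^esub> h)) (grp \<one>\<^bsub>G\<^esub>) x = x" if "Poly_Mapping.keys x \<subseteq> carrier G" for x
  proof -
    have "lext (\<lambda>h. grp (\<one>\<^bsub>G\<^esub> \<otimes>\<^bsub>G\<^esub> h)) x = lext grp x"
      using that by (intro lext_cong) auto
    then show ?thesis
      by (simp add: bil_def lext_id)
  qed
  show ?thesis
  proof (rule comm_monoidI)
    fix x y z
    assume "x \<in> carrier (group_algebra G)" "y \<in> carrier (group_algebra G)" "z \<in> carrier (group_algebra G)"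
    then show "(x \<otimes>\<^bsub>group_algebra G\<^esub> y) \<otimes>\<^bsub>group_algebra G\<^esub> z = x \<otimes>\<^bsub>group_algebra G\<^esub> (y \<otimes>\<^bsub>group_algebra G\<^esub> z)"
      by (auto intro!: bil_assoc[where K = "carrier G"] simp: G.m_assoc)
  qed (use closed comm one in auto)
qed

lemma abelian_monoid_group_algebra: "abelian_monoid (group_algebra G)"
  by (rule abelian_monoidI) (use keys_add in \<open>fastforce simp: add_ac\<close>)+

lemma finsum_group_algebra:
  assumes "\<And>x. x \<in> A \<Longrightarrow> Poly_Mapping.keys (f x) \<subseteq> carrier G"
  shows "finsum (group_algebra G) f A = sum f A"
proof -
  interpret abelian_monoid "group_algebra G" by (rule abelian_monoid_group_algebra)
  show ?thesis
    using assms by (induction A rule: infinite_finite_induct) (auto simp: Pi_iff)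
qed

section \<open>Polynomials with a product twisted by a bicharacter\<close>

text \<open>
  Both \<open>S(V)\<close> and \<open>S\<^sub>-\<^sub>1(V)\<close> are of this form, with \<open>\<beta>\<close> constantly \<open>1\<close> and with \<open>\<beta>\<close> the sign of sorting;
  most facts about them are proved once, for an arbitrary bicharacter \<open>\<beta>\<close>.
\<close>

definition twisted_poly :: "(monomial \<Rightarrow> monomial \<Rightarrow> complex) \<Rightarrow> nat \<Rightarrow> (complex, polynomial) module" where
  "twisted_poly \<beta> n = \<lparr>carrier = S_space n, mult = bil (\<lambda>k l. Poly_Mapping.single (k + l) (\<beta> k l)),
     one = 1, zero = 0, add = (+), module.smult = scale\<rparr>"

lemma twisted_poly_simps [simp]:
  "carrier (twisted_poly \<beta> n) = S_space n"
  "\<one>\<^bsub>twisted_poly \<beta> n\<^esub> = 1"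
  "\<zero>\<^bsub>twisted_poly \<beta> n\<^esub> = 0"
  "f \<oplus>\<^bsub>twisted_poly \<beta> n\<^esub> h = f + h"
  "c \<odot>\<^bsub>twisted_poly \<beta> n\<^esub> f = scale c f"
  "f \<otimes>\<^bsub>twisted_poly \<beta> n\<^esub> h = bil (\<lambda>k l. Poly_Mapping.single (k + l) (\<beta> k l)) f h"
  by (simp_all add: twisted_poly_def)

lemma twisted_poly_mult: "(\<otimes>\<^bsub>twisted_poly \<beta> n\<^esub>) = bil (\<lambda>k l. Poly_Mapping.single (k + l) (\<beta> k l))"
  by (simp add: twisted_poly_def)

lemma times_eq_bil: "f * h = bil (\<lambda>k l. Poly_Mapping.single (k + l) 1) f (h :: polynomial)"
  using subset_UNIV[of "Poly_Mapping.keys f"]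
proof (induction f rule: poly_mapping_linear_induct)
  case (single k c)
  show ?case
    using subset_UNIV[of "Poly_Mapping.keys h"]
    by (induction h rule: poly_mapping_linear_induct)
      (auto simp: mult_single bil_add_right distrib_left)
qed (auto simp: bil_add_left distrib_right)

lemma Sym_eq_twisted_poly: "Sym n = twisted_poly (\<lambda>_ _. 1) n"
  unfolding Sym_def twisted_poly_def using times_eq_bil by (auto intro!: ext)

lemma Skew_eq_twisted_poly: "Skew n = twisted_poly skew_sign n"
  unfolding Skew_def Sym_def twisted_poly_def
  by (auto intro!: ext simp: skew_mult_def bil_def lext_def pm.scale_sum_right ac_simps)

definition monomials :: "nat \<Rightarrow> monomial set" where
  "monomials n = {k. Poly_Mapping.keys k \<subseteq> {..<n}}"

lemma S_space_iff: "f \<in> S_space n \<longleftrightarrow> Poly_Mapping.keys f \<subseteq> monomials n"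
  by (auto simp: S_space_def monomials_def)

lemma zero_in_monomials [simp]: "0 \<in> monomials n"
  by (simp add: monomials_def)

lemma add_in_monomials: "k \<in> monomials n \<Longrightarrow> l \<in> monomials n \<Longrightarrow> k + l \<in> monomials n"
  using keys_add[of k l] by (auto simp: monomials_def)

lemma S_space_zero [simp]: "0 \<in> S_space n"
  by (simp add: S_space_iff)

lemma S_space_single [simp]: "Poly_Mapping.single k c \<in> S_space n \<longleftrightarrow> c = 0 \<or> k \<in> monomials n"
  by (simp add: S_space_iff)

lemma S_space_one [simp]: "1 \<in> S_space n"
  by (simp add: S_space_iff)

lemma S_space_add: "f \<in> S_space n \<Longrightarrow> h \<in> S_space n \<Longrightarrow> f + h \<in> S_space n"
  using keys_add[of f h] by (auto simp: S_space_iff)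

lemma S_space_scale: "f \<in> S_space n \<Longrightarrow> scale c f \<in> S_space n"
  using keys_scale_subset[of c f] by (auto simp: S_space_iff)

lemma S_space_sum: "(\<And>x. x \<in> A \<Longrightarrow> f x \<in> S_space n) \<Longrightarrow> sum f A \<in> S_space n"
  by (induction A rule: infinite_finite_induct) (auto intro: S_space_add)

lemma S_space_lext: "(\<And>k. k \<in> Poly_Mapping.keys a \<Longrightarrow> F k \<in> S_space n) \<Longrightarrow> lext F a \<in> S_space n"
  unfolding S_space_iff by (rule keys_lext_subset)

lemma S_space_linear_induct [consumes 1, case_names zero single add]:
  assumes "f \<in> S_space n" "P 0"
    "\<And>k c. k \<in> monomials n \<Longrightarrow> P (Poly_Mapping.single k c)"
    "\<And>f h. f \<in> S_space n \<Longrightarrow> h \<in> S_space n \<Longrightarrow> P f \<Longrightarrow> P h \<Longrightarrow> P (f + h)"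
  shows "P f"
  using assms unfolding S_space_iff by (rule poly_mapping_linear_induct)

text \<open>
  The last condition says that powers of a single variable are multiplied as in \<open>S(V)\<close>; it holds for
  the sorting sign because a variable never has to be moved past itself.
\<close>

locale bicharacter =
  fixes \<beta> :: "monomial \<Rightarrow> monomial \<Rightarrow> complex"
  assumes add_left: "\<beta> (k + k') l = \<beta> k l * \<beta> k' l"
    and add_right: "\<beta> k (l + l') = \<beta> k l * \<beta> k l'"
    and nonzero: "\<beta> k l \<noteq> 0"
    and alternating: "\<beta> (Poly_Mapping.single i a) (Poly_Mapping.single i b) = 1"
begin

lemma zero_left: "\<beta> 0 l = 1"
  using add_left[of 0 0 l] nonzero[of 0 l] by simp

lemma zero_right: "\<beta> l 0 = 1"
  using add_right[of l 0 0] nonzero[of l 0] by simp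

lemma sum_right: "\<beta> k (sum f A) = (\<Prod>x\<in>A. \<beta> k (f x))"
  by (induction A rule: infinite_finite_induct) (auto simp: add_right zero_right)

abbreviation tmult :: "polynomial \<Rightarrow> polynomial \<Rightarrow> polynomial" where
  "tmult \<equiv> bil (\<lambda>k l. Poly_Mapping.single (k + l) (\<beta> k l))"

lemma tmult_closed: "f \<in> S_space n \<Longrightarrow> h \<in> S_space n \<Longrightarrow> tmult f h \<in> S_space n"
  unfolding S_space_iff by (rule keys_bil_subset) (auto intro!: add_in_monomials)

lemma tmult_single_zero_left: "tmult (Poly_Mapping.single 0 c) f = scale c f"
  by (simp add: bil_def lext_id zero_left)

lemma tmult_one_left: "tmult 1 f = f"
  using tmult_single_zero_left[of 1 f] by simp

lemma tmult_one_right: "tmult f 1 = f"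
  by (simp add: bil_def lext_id zero_right flip: single_one)

lemma tmult_assoc: "tmult (tmult f g) h = tmult f (tmult g h)"
  by (rule bil_assoc[where K = UNIV]) (auto simp: add_left add_right ac_simps)

lemma twisted_poly_ring: "ring (twisted_poly \<beta> n)"
proof (rule ringI)
  show "abelian_group (twisted_poly \<beta> n)"
  proof (rule abelian_groupI)
    fix f assume "f \<in> carrier (twisted_poly \<beta> n)"
    then show "\<exists>h\<in>carrier (twisted_poly \<beta> n). h \<oplus>\<^bsub>twisted_poly \<beta> n\<^esub> f = \<zero>\<^bsub>twisted_poly \<beta> n\<^esub>"
      by (intro bexI[of _ "scale (-1) f"]) (simp, simp del: pm.scale_minus_left add: S_space_scale)
  qed (auto simp: S_space_add add_ac)
  show "Group.monoid (twisted_poly \<beta> n)"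
    by (rule monoidI) (auto simp: tmult_closed tmult_one_left tmult_one_right tmult_assoc)
qed (auto simp: bil_add_left bil_add_right)

lemma single_power:
  "Poly_Mapping.single (Poly_Mapping.single i 1) c [^]\<^bsub>twisted_poly \<beta> n\<^esub> (r::nat) =
     Poly_Mapping.single (Poly_Mapping.single i r) (c ^ r)"
proof (induction r)
  case (Suc r)
  have "Poly_Mapping.single i r + Poly_Mapping.single i (Suc 0) = Poly_Mapping.single i (Suc r)"
    by (simp flip: single_add)
  then show ?case
    using Suc by (simp add: nat_pow_def alternating mult.commute)
qed (simp add: nat_pow_def)

text \<open>
  Multiplying monomials from left to right collects one factor \<open>\<beta> (\<kappa> i) (\<kappa> j)\<close> for each pair \<open>i < j\<close>.
  This gives the coefficient with which a monomial matrix maps one standard monomial to another.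
\<close>

lemma foldr_tmult_monomials:
  assumes "a \<le> n"
  shows "foldr tmult (map (\<lambda>j. Poly_Mapping.single (\<kappa> j) (d j)) [a..<n]) 1 =
    Poly_Mapping.single (\<Sum>j=a..<n. \<kappa> j) ((\<Prod>j=a..<n. d j) * (\<Prod>i=a..<n. \<Prod>j\<in>{i<..<n}. \<beta> (\<kappa> i) (\<kappa> j)))"
  using assms
proof (induction a rule: inc_induct)
  case (step a)
  have "{a<..<n} = {Suc a..<n}"
    using step by auto
  moreover have "[a..<n] = a # [Suc a..<n]"
    using step by (simp add: upt_conv_Cons)
  ultimately show ?case
    using step by (simp add: sum.atLeast_Suc_lessThan prod.atLeast_Suc_lessThan sum_right zero_right ac_simps)
qed simp

end

interpretation trivial: bicharacter "\<lambda>_ _. 1"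
  by unfold_locales auto

lemma skew_sign_eq:
  assumes "finite A" "Poly_Mapping.keys k \<subseteq> A" "Poly_Mapping.keys l \<subseteq> A"
  shows "skew_sign k l = (-1) ^ (\<Sum>i\<in>A. \<Sum>j\<in>{j \<in> A. j < i}. Poly_Mapping.lookup k i * Poly_Mapping.lookup l j)"
proof -
  have "(\<Sum>j\<in>{j \<in> Poly_Mapping.keys l. j < i}. Poly_Mapping.lookup k i * Poly_Mapping.lookup l j) =
      (\<Sum>j\<in>{j \<in> A. j < i}. Poly_Mapping.lookup k i * Poly_Mapping.lookup l j)" for i
    using assms by (intro sum.mono_neutral_left) (auto simp: in_keys_iff)
  moreover have "(\<Sum>i\<in>Poly_Mapping.keys k. \<Sum>j\<in>{j \<in> A. j < i}. Poly_Mapping.lookup k i * Poly_Mapping.lookup l j) =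
      (\<Sum>i\<in>A. \<Sum>j\<in>{j \<in> A. j < i}. Poly_Mapping.lookup k i * Poly_Mapping.lookup l j)"
    using assms by (intro sum.mono_neutral_left) (auto simp: in_keys_iff)
  ultimately show ?thesis
    by (simp only: skew_sign_def)
qed

lemma skew_sign_single:
  "skew_sign (Poly_Mapping.single i a) (Poly_Mapping.single j b) = (if j < i then (-1) ^ (a * b) else 1)"
proof -
  have "{j' \<in> Poly_Mapping.keys (Poly_Mapping.single j b). j' < i'} = (if j < i' \<and> b \<noteq> 0 then {j} else {})" for i'
    by (auto split: if_splits)
  then show ?thesis
    by (simp add: skew_sign_def)
qed

interpretation skew: bicharacter skew_sign
proof
  fix k k' l :: monomial
  define A where "A = Poly_Mapping.keys k \<union> Poly_Mapping.keys k' \<union> Poly_Mapping.keys l"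
  have A: "finite A" "Poly_Mapping.keys k \<subseteq> A" "Poly_Mapping.keys k' \<subseteq> A" "Poly_Mapping.keys l \<subseteq> A"
    "Poly_Mapping.keys (k + k') \<subseteq> A"
    using keys_add[of k k'] by (auto simp: A_def)
  show "skew_sign (k + k') l = skew_sign k l * skew_sign k' l"
    using A by (simp add: skew_sign_eq[of A] lookup_add distrib_right sum.distrib power_add)
  show "skew_sign l (k + k') = skew_sign l k * skew_sign l k'"
    using A by (simp add: skew_sign_eq[of A] lookup_add distrib_left sum.distrib power_add)
  show "skew_sign k l \<noteq> 0"
    by (simp add: skew_sign_def)
qed (simp add: skew_sign_single)

section \<open>Inversions of permutations\<close>

lemma perm_lt: "w permutes {..<n} \<Longrightarrow> j < n \<Longrightarrow> w j < (n::nat)"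
  using permutes_in_image[of w "{..<n}" j] by simp

lemma perm_eq_iff: "w permutes S \<Longrightarrow> w x = w y \<longleftrightarrow> x = y"
  by (rule inj_eq[OF permutes_inj])

text \<open>
  For \<open>\<kappa>\<close> constantly \<open>1\<close> this is the number of inversions of \<open>w\<close>. In general it counts the interchanges
  that sort \<open>x\<^bsub>w(0)\<^esub>\<^bsup>\<kappa>(0)\<^esup> x\<^bsub>w(1)\<^esub>\<^bsup>\<kappa>(1)\<^esup> \<dots>\<close> into a standard monomial, hence the exponent of \<open>-1\<close> in the
  action of a monomial matrix on \<open>S\<^sub>-\<^sub>1(V)\<close>.
\<close>

definition inversion_sum :: "nat \<Rightarrow> (nat \<Rightarrow> nat) \<Rightarrow> (nat \<Rightarrow> nat) \<Rightarrow> nat" where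
  "inversion_sum n w \<kappa> = (\<Sum>x<n. \<Sum>y<n. if x < y \<and> w y < w x then \<kappa> x * \<kappa> y else 0)"

lemma even_double_sum:
  fixes F :: "nat \<Rightarrow> nat \<Rightarrow> nat"
  assumes "\<And>x. x < n \<Longrightarrow> even (F x x)"
    and "\<And>x y. x < y \<Longrightarrow> y < n \<Longrightarrow> even (F x y + F y x)"
  shows "even (\<Sum>x<n. \<Sum>y<n. F x y)"
  using assms
proof (induction n)
  case (Suc n)
  have "even (\<Sum>x<n. F x n + F n x)"
    using Suc.prems(2) by (intro dvd_sum) auto
  moreover have "(\<Sum>x<Suc n. \<Sum>y<Suc n. F x y) =
      (\<Sum>x<n. \<Sum>y<n. F x y) + (\<Sum>x<n. F x n + F n x) + F n n"
    by (simp add: sum.distrib)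
  moreover have "even (\<Sum>x<n. \<Sum>y<n. F x y)"
  proof (rule Suc.IH)
    fix x y assume "x < y" "y < n"
    then show "even (F x y + F y x)"
      using Suc.prems(2)[of x y] by simp
  qed (simp add: Suc.prems(1))
  moreover have "even (F n n)"
    using Suc.prems(1) by simp
  ultimately show ?case
    by (simp only: even_add simp_thms)
qed simp

text \<open>
  Modulo \<open>2\<close> the weighted inversion count is a cocycle: a pair is inverted by \<open>w \<circ> v\<close> if and only if
  exactly one of the two steps inverts it. Each unordered pair of indices thus contributes an even
  amount to the sum of the three counts.
\<close>

lemma even_inversion_sum_comp:
  assumes v: "v permutes {..<n}" and w: "w permutes {..<n}"
  shows "even (inversion_sum n (w \<circ> v) \<kappa> + inversion_sum n v \<kappa> + inversion_sum n w (\<kappa> \<circ> Hilbert_Choice.inv v))"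
proof -
  have inj: "v x = v y \<longleftrightarrow> x = y" "w x = w y \<longleftrightarrow> x = y" for x y
    by (rule inj_eq[OF permutes_inj[OF v]], rule inj_eq[OF permutes_inj[OF w]])
  have "inversion_sum n w (\<kappa> \<circ> Hilbert_Choice.inv v) =
      (\<Sum>x<n. \<Sum>y<n. if v x < v y \<and> w (v y) < w (v x) then \<kappa> x * \<kappa> y else 0)"
    unfolding inversion_sum_def
    by (subst sum.permute[OF v], subst sum.permute[OF v]) (simp add: permutes_inverses[OF v] cong: if_cong)
  then have "inversion_sum n (w \<circ> v) \<kappa> + inversion_sum n v \<kappa> + inversion_sum n w (\<kappa> \<circ> Hilbert_Choice.inv v) =
    (\<Sum>x<n. \<Sum>y<n. (if x < y \<and> w (v y) < w (v x) then \<kappa> x * \<kappa> y else 0) +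
      (if x < y \<and> v y < v x then \<kappa> x * \<kappa> y else 0) +
      (if v x < v y \<and> w (v y) < w (v x) then \<kappa> x * \<kappa> y else 0))" (is "_ = (\<Sum>x<n. \<Sum>y<n. ?F x y)")
    by (simp add: inversion_sum_def sum.distrib)
  moreover have "even (\<Sum>x<n. \<Sum>y<n. ?F x y)"
  proof (rule even_double_sum)
    fix x y :: nat
    assume "x < y"
    then consider "v x < v y" "w (v x) < w (v y)" | "v x < v y" "w (v y) < w (v x)"
      | "v y < v x" "w (v x) < w (v y)" | "v y < v x" "w (v y) < w (v x)"
      using inj by (metis less_irrefl linorder_neqE_nat)
    then show "even (?F x y + ?F y x)"
      using \<open>x < y\<close> by cases (auto simp: mult.commute)
  qed auto
  ultimately show ?thesis
    by simp
qed

lemma inversion_sum_id [simp]: "inversion_sum n id \<kappa> = 0"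
  by (auto simp: inversion_sum_def)

lemma inversion_adjacent:
  "x < y \<and> transpose i (Suc i) y < transpose i (Suc i) x \<longleftrightarrow> x = i \<and> y = Suc i"
  by (auto simp: transpose_def)

lemma inversion_sum_adjacent:
  assumes "Suc i < n"
  shows "inversion_sum n (transpose i (Suc i)) \<kappa> = \<kappa> i * \<kappa> (Suc i)"
proof -
  have "inversion_sum n (transpose i (Suc i)) \<kappa> =
      (\<Sum>x<n. if x = i then \<Sum>y<n. if y = Suc i then \<kappa> x * \<kappa> y else 0 else 0)"
    unfolding inversion_sum_def inversion_adjacent by (intro sum.cong refl) auto
  also have "\<dots> = \<kappa> i * \<kappa> (Suc i)"
    using assms by simp
  finally show ?thesis .
qed

lemma adjacent_permutes: "Suc i < n \<Longrightarrow> transpose i (Suc i) permutes {..<n}"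
  by (rule permutes_swap_id) auto

lemma increasing_permutation_is_id:
  assumes w: "w permutes {..<n}" and inc: "\<And>i. Suc i < n \<Longrightarrow> w i < w (Suc i)"
  shows "w = id"
proof -
  have lb: "i \<le> w i" if "i < n" for i
    using that by (induction i) (use inc in \<open>fastforce\<close>)+
  have ub: "w (n - Suc k) \<le> n - Suc k" if "k < n" for k
    using that
  proof (induction k)
    case 0
    then have "w (n - 1) \<in> {..<n}"
      using permutes_in_image[OF w, of "n - 1"] by simp
    then show ?case by simp
  next
    case (Suc k)
    then have "Suc (n - Suc (Suc k)) = n - Suc k" by simp
    then have "w (n - Suc (Suc k)) < w (n - Suc k)"
      using inc[of "n - Suc (Suc k)"] Suc.prems by simp
    then show ?case using Suc by simp
  qed
  show ?thesis
  proof
    fix x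
    show "w x = id x"
    proof (cases "x < n")
      case True
      then have "w x \<le> x"
        using ub[of "n - Suc x"] by simp
      then show ?thesis using lb[OF True] by simp
    qed (use permutes_not_in[OF w] in simp)
  qed
qed

text \<open>
  Unless \<open>w\<close> is the identity it has a descent at some \<open>i\<close>. Composing \<open>w\<close> with the transposition of \<open>i\<close>
  and \<open>i + 1\<close> removes this descent and increases \<open>\<Sum>j. j * w j\<close> by \<open>w i - w (i + 1)\<close>; as this sum is
  bounded, the process ends at the identity.
\<close>

lemma adjacent_induct [consumes 1, case_names id step]:
  assumes "w permutes {..<n}" and id: "P id"
    and step: "\<And>v i. v permutes {..<n} \<Longrightarrow> Suc i < n \<Longrightarrow> P v \<Longrightarrow> P (v \<circ> transpose i (Suc i))"
  shows "P w"
  using assms(1)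
proof (induction "n * (n * n) - (\<Sum>j<n. j * w j)" arbitrary: w rule: less_induct)
  case less
  show ?case
  proof (cases "\<forall>i. Suc i < n \<longrightarrow> w i < w (Suc i)")
    case True
    then have "w = id"
      using increasing_permutation_is_id[OF less.prems] by blast
    then show ?thesis using id by simp
  next
    case False
    then obtain i where i: "Suc i < n" "\<not> w i < w (Suc i)" by blast
    define t where "t = transpose i (Suc i)"
    have "w i \<noteq> w (Suc i)"
      by (simp add: perm_eq_iff[OF less.prems])
    then have desc: "w (Suc i) < w i"
      using i by simp
    have wt: "w \<circ> t permutes {..<n}"
      unfolding t_def by (rule permutes_compose[OF adjacent_permutes[OF i(1)] less.prems])
    have split: "(\<Sum>j<n. f j) = (\<Sum>j\<in>{..<n} - {i, Suc i}. f j) + f i + f (Suc i)" for f :: "nat \<Rightarrow> nat"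
    proof -
      have "{..<n} = insert i (insert (Suc i) ({..<n} - {i, Suc i}))"
        using i by auto
      then have "(\<Sum>j<n. f j) = sum f (insert i (insert (Suc i) ({..<n} - {i, Suc i})))"
        by (rule arg_cong)
      then show ?thesis
        by (simp del: insert_Diff_single)
    qed
    have bound: "(\<Sum>j<n. j * v j) \<le> n * (n * n)" if "v permutes {..<n}" for v
    proof -
      have "j * v j \<le> n * n" if "j < n" for j
        using that permutes_in_image[OF \<open>v permutes {..<n}\<close>, of j] by (intro mult_le_mono) auto
      then show ?thesis
        using sum_bounded_above[of "{..<n}" "\<lambda>j. j * v j" "n * n"] by simp
    qed
    have "(\<Sum>j<n. j * (w \<circ> t) j) =
        (\<Sum>j\<in>{..<n} - {i, Suc i}. j * w j) + i * w (Suc i) + Suc i * w i"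
      unfolding split by (intro arg_cong2[where f = "(+)"] sum.cong) (auto simp: t_def transpose_def)
    moreover have "(\<Sum>j<n. j * w j) = (\<Sum>j\<in>{..<n} - {i, Suc i}. j * w j) + i * w i + Suc i * w (Suc i)"
      by (rule split)
    ultimately have "(\<Sum>j<n. j * w j) < (\<Sum>j<n. j * (w \<circ> t) j)"
      using desc by simp
    then have "P (w \<circ> t)"
      using bound[OF wt] by (intro less.hyps wt) linarith
    with wt i(1) have "P ((w \<circ> t) \<circ> transpose i (Suc i))"
      by (rule step)
    then show ?thesis
      by (simp add: t_def comp_assoc)
  qed
qed

lemma permutes_lessThan_permutation: "w permutes {..<n::nat} \<Longrightarrow> permutation w"
  using permutation_permutes by blast

lemma minus_one_power_even_sum:
  fixes a b :: nat
  assumes "even (a + b)"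
  shows "(-1 :: 'a::ring_1) ^ a = (-1) ^ b"
  using assms by (cases "even a") auto

text \<open>
  Both sides change sign when \<open>w\<close> is composed with an adjacent transposition, the right-hand side
  because of the cocycle property of the inversion count.
\<close>

lemma sign_eq_inversion_parity:
  assumes "w permutes {..<n}"
  shows "of_int (sign w) = (-1 :: 'a::ring_1) ^ inversion_sum n w (\<lambda>_. 1)"
  using assms
proof (induction rule: adjacent_induct)
  case (step v i)
  have "even (inversion_sum n (v \<circ> transpose i (Suc i)) (\<lambda>_. 1) + (1 + inversion_sum n v (\<lambda>_. 1)))"
    using even_inversion_sum_comp[OF adjacent_permutes[OF step.hyps(2)] step.hyps(1), of "\<lambda>_. 1"]
      inversion_sum_adjacent[OF step.hyps(2), of "\<lambda>_. 1"] by (simp add: comp_def ac_simps)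
  then have "(-1 :: 'a) ^ inversion_sum n (v \<circ> transpose i (Suc i)) (\<lambda>_. 1) =
      (-1) ^ (1 + inversion_sum n v (\<lambda>_. 1))"
    by (rule minus_one_power_even_sum)
  moreover have "sign (v \<circ> transpose i (Suc i)) = - sign v"
    by (subst sign_compose)
      (simp_all add: permutes_lessThan_permutation[OF step.hyps(1)] permutation_swap_id sign_swap_id)
  ultimately show ?case
    using step.IH by (simp only: power_add) simp
qed (simp only: inversion_sum_id sign_id, simp)

section \<open>Monomial matrices\<close>

text \<open>
  The matrix sending \<open>x\<^sub>j\<close> to \<open>c j\<close> times \<open>x\<^bsub>w j\<^esub>\<close>. Every element of \<open>G\<close>, \<open>W\<close> and \<open>T\<close> is written in this way.
\<close>

definition mono_mat :: "nat \<Rightarrow> (nat \<Rightarrow> nat) \<Rightarrow> (nat \<Rightarrow> complex) \<Rightarrow> complex mat" where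
  "mono_mat n w c = mat n n (\<lambda>(i,j). if i = w j then c j else 0)"

lemma mono_mat_carrier [simp]: "mono_mat n w c \<in> carrier_mat n n"
  by (simp add: mono_mat_def)

lemma mono_mat_dim [simp]: "dim_row (mono_mat n w c) = n" "dim_col (mono_mat n w c) = n"
  by (simp_all add: mono_mat_def)

lemma mono_mat_index [simp]:
  "i < n \<Longrightarrow> j < n \<Longrightarrow> mono_mat n w c $$ (i,j) = (if i = w j then c j else 0)"
  by (simp add: mono_mat_def)

lemma mono_mat_cong: "(\<And>j. j < n \<Longrightarrow> c j = d j) \<Longrightarrow> mono_mat n w c = mono_mat n w d"
  by (intro eq_matI) (auto simp: mono_mat_def)

lemma monomial_mat_mono_mat:
  assumes w: "w permutes {..<n}" and c: "\<And>j. j < n \<Longrightarrow> c j \<noteq> 0"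
  shows "monomial_mat n (mono_mat n w c)"
  unfolding monomial_mat_def
proof (intro conjI allI impI)
  fix i assume "i < n"
  then have "Hilbert_Choice.inv w i < n" "w (Hilbert_Choice.inv w i) = i"
    using perm_lt[OF permutes_inv[OF w]] permutes_inverses[OF w] by auto
  then show "\<exists>!j. j < n \<and> mono_mat n w c $$ (i,j) \<noteq> 0"
    using \<open>i < n\<close> c by (intro ex1I[of _ "Hilbert_Choice.inv w i"]) (auto simp: permutes_inverses[OF w] split: if_splits)
next
  fix j assume "j < n"
  then show "\<exists>!i. i < n \<and> mono_mat n w c $$ (i,j) \<noteq> 0"
    using perm_lt[OF w] c by (intro ex1I[of _ "w j"]) (auto split: if_splits)
qed simp

lemma monomial_matE:
  assumes "monomial_mat n A"
  obtains w c where "w permutes {..<n}" "\<And>j. j < n \<Longrightarrow> c j \<noteq> 0" "A = mono_mat n w c"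
proof -
  have A: "A \<in> carrier_mat n n" and row: "\<And>i. i < n \<Longrightarrow> \<exists>!j. j < n \<and> A $$ (i,j) \<noteq> 0"
    and col: "\<And>j. j < n \<Longrightarrow> \<exists>!i. i < n \<and> A $$ (i,j) \<noteq> 0"
    using assms by (auto simp: monomial_mat_def)
  define w where "w j = (if j < n then THE i. i < n \<and> A $$ (i,j) \<noteq> 0 else j)" for j
  have w: "w j < n \<and> A $$ (w j, j) \<noteq> 0" if "j < n" for j
    using theI'[OF col[OF that]] that by (simp add: w_def)
  have w_unique: "i = w j" if "i < n" "j < n" "A $$ (i,j) \<noteq> 0" for i j
    using col[OF \<open>j < n\<close>] w[OF \<open>j < n\<close>] that by blast
  have "inj_on w {..<n}"
    by (rule inj_onI) (metis lessThan_iff row w)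
  then have "bij_betw w {..<n} {..<n}"
    using w by (intro bij_betw_imageI endo_inj_surj) auto
  then have "w permutes {..<n}"
    by (rule bij_imp_permutes) (simp add: w_def)
  moreover have "A = mono_mat n w (\<lambda>j. A $$ (w j, j))"
    using A w_unique by (intro eq_matI) auto
  ultimately show ?thesis
    using w that[of w "\<lambda>j. A $$ (w j, j)"] by blast
qed

lemma mono_mat_mult:
  assumes v: "v permutes {..<n}"
  shows "mono_mat n w c * mono_mat n v d = mono_mat n (w \<circ> v) (\<lambda>j. c (v j) * d j)"
proof (rule eq_matI)
  fix i j assume "i < dim_row (mono_mat n (w \<circ> v) (\<lambda>j. c (v j) * d j))"
    "j < dim_col (mono_mat n (w \<circ> v) (\<lambda>j. c (v j) * d j))"
  then have ij: "i < n" "j < n"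
    by (simp_all add: mono_mat_def)
  have "(mono_mat n w c * mono_mat n v d) $$ (i,j) =
      (\<Sum>l<n. mono_mat n w c $$ (i,l) * mono_mat n v d $$ (l,j))"
    using ij by (simp add: scalar_prod_def mono_mat_def atLeast0LessThan)
  also have "\<dots> = (\<Sum>l<n. if l = v j then (if i = w l then c l else 0) * d j else 0)"
    using ij by (intro sum.cong) auto
  also have "\<dots> = (if i = w (v j) then c (v j) * d j else 0)"
    using ij perm_lt[OF v] by simp
  finally show "(mono_mat n w c * mono_mat n v d) $$ (i,j) = mono_mat n (w \<circ> v) (\<lambda>j. c (v j) * d j) $$ (i,j)"
    using ij by simp
qed (simp_all add: mono_mat_def)

lemma one_mat_eq_mono_mat: "1\<^sub>m n = mono_mat n id (\<lambda>_. 1)"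
  by (intro eq_matI) (auto simp: mono_mat_def)

lemma nonzero_positions_mono_mat:
  assumes "w permutes {..<n}" "\<And>j. j < n \<Longrightarrow> c j \<noteq> 0"
  shows "nonzero_positions n (mono_mat n w c) = (\<lambda>j. (w j, j)) ` {..<n}"
  using assms perm_lt[OF assms(1)] by (auto simp: nonzero_positions_def split: if_splits)

lemma det_mono_mat:
  assumes w: "w permutes {..<n}"
  shows "det (mono_mat n w c) = of_int (sign w) * (\<Prod>j<n. c j)"
proof -
  have "det (mono_mat n w c) = (\<Sum>p | p permutes {..<n}. of_int (sign p) * (\<Prod>j<n. mono_mat n w c $$ (p j, j)))"
    by (subst det_col[OF mono_mat_carrier]) (simp add: atLeast0LessThan)
  also have "\<dots> = (\<Sum>p | p permutes {..<n}. if p = w then of_int (sign w) * (\<Prod>j<n. c j) else 0)"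
  proof (intro sum.cong refl)
    fix p assume "p \<in> {p. p permutes {..<n}}"
    then have p: "p permutes {..<n}" by simp
    show "of_int (sign p) * (\<Prod>j<n. mono_mat n w c $$ (p j, j)) =
        (if p = w then of_int (sign w) * (\<Prod>j<n. c j) else 0)"
    proof (cases "p = w")
      case False
      then obtain j where "j < n" "p j \<noteq> w j"
        using permutes_not_in[OF p] permutes_not_in[OF w] by (metis ext lessThan_iff)
      then have "(\<Prod>j<n. mono_mat n w c $$ (p j, j)) = 0"
        using perm_lt[OF p] by (intro prod_zero) auto
      then show ?thesis using False by simp
    qed (use perm_lt[OF w] in \<open>auto intro!: prod.cong\<close>)
  qed
  also have "\<dots> = of_int (sign w) * (\<Prod>j<n. c j)"
    using w by (simp add: finite_permutations)
  finally show ?thesis .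
qed

section \<open>Monomial matrices acting on monomials\<close>

text \<open>
  The exponent vector of the monomial obtained by replacing each variable \<open>x\<^sub>j\<close> by \<open>x\<^bsub>w j\<^esub>\<close>.
\<close>

abbreviation permute_mon :: "(nat \<Rightarrow> nat) \<Rightarrow> monomial \<Rightarrow> monomial" where
  "permute_mon w \<equiv> Poly_Mapping.map_key (Hilbert_Choice.inv w)"

lemma inj_inv_permutes: "w permutes S \<Longrightarrow> inj (Hilbert_Choice.inv w)"
  by (rule permutes_inj[OF permutes_inv])

lemma lookup_permute_mon:
  "w permutes S \<Longrightarrow> Poly_Mapping.lookup (permute_mon w k) i = Poly_Mapping.lookup k (Hilbert_Choice.inv w i)"
  by (simp add: map_key.rep_eq[OF inj_inv_permutes])

lemma permute_mon_in_monomials: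
  assumes "w permutes {..<n}" "k \<in> monomials n"
  shows "permute_mon w k \<in> monomials n"
proof -
  have "Poly_Mapping.keys (permute_mon w k) \<subseteq> {..<n}"
  proof
    fix i assume "i \<in> Poly_Mapping.keys (permute_mon w k)"
    then have "Hilbert_Choice.inv w i \<in> {..<n}"
      using assms by (auto simp: in_keys_iff lookup_permute_mon[OF assms(1)] monomials_def subset_iff)
    then show "i \<in> {..<n}"
      using permutes_in_image[OF permutes_inv[OF assms(1)]] by blast
  qed
  then show ?thesis
    by (simp add: monomials_def)
qed

lemma permute_mon_comp:
  assumes "v permutes S" "w permutes S"
  shows "permute_mon (w \<circ> v) k = permute_mon w (permute_mon v k)"
proof (rule poly_mapping_eqI)
  fix i
  show "Poly_Mapping.lookup (permute_mon (w \<circ> v) k) i = Poly_Mapping.lookup (permute_mon w (permute_mon v k)) i"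
    by (subst lookup_permute_mon[OF permutes_compose[OF assms]])
      (simp only: lookup_permute_mon[OF assms(1)] lookup_permute_mon[OF assms(2)]
        o_inv_distrib[OF permutes_bij permutes_bij, OF assms(2,1)] comp_apply)
qed

lemma map_key_id_fun [simp]: "Poly_Mapping.map_key id k = k"
  using map_key_id[of k] by (simp only: id_def)

lemma sum_single_permute_mon:
  assumes w: "w permutes {..<n}" and k: "k \<in> monomials n"
  shows "(\<Sum>j<n. Poly_Mapping.single (w j) (Poly_Mapping.lookup k j)) = permute_mon w k"
proof (rule poly_mapping_eqI)
  fix i
  have *: "w j = i \<longleftrightarrow> j = Hilbert_Choice.inv w i" for j
    using permutes_inverses[OF w] by metis
  have "Poly_Mapping.lookup (\<Sum>j<n. Poly_Mapping.single (w j) (Poly_Mapping.lookup k j)) i =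
      (\<Sum>j<n. if j = Hilbert_Choice.inv w i then Poly_Mapping.lookup k j else 0)"
    by (simp add: lookup_sum lookup_single when_def *)
  also have "\<dots> = Poly_Mapping.lookup k (Hilbert_Choice.inv w i)"
    using k by (auto simp: monomials_def in_keys_iff subset_iff)
  finally show "Poly_Mapping.lookup (\<Sum>j<n. Poly_Mapping.single (w j) (Poly_Mapping.lookup k j)) i =
      Poly_Mapping.lookup (permute_mon w k) i"
    by (simp add: lookup_permute_mon[OF w])
qed

text \<open>
  The value of the monomial \<open>x\<^sup>k\<close> at the point \<open>c\<close>, which is the scalar by which the diagonal matrix
  with entries \<open>c\<close> acts on \<open>x\<^sup>k\<close>.
\<close>

definition mon_val :: "nat \<Rightarrow> (nat \<Rightarrow> complex) \<Rightarrow> monomial \<Rightarrow> complex" where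
  "mon_val n c k = (\<Prod>j<n. c j ^ Poly_Mapping.lookup k j)"

lemma mon_val_permute:
  assumes "v permutes {..<n}"
  shows "mon_val n c (permute_mon v k) = mon_val n (\<lambda>j. c (v j)) k"
  unfolding mon_val_def
  by (subst prod.permute[OF assms]) (simp add: lookup_permute_mon[OF assms] permutes_inverses[OF assms])

lemma mon_val_mult: "mon_val n (\<lambda>j. c j * d j) k = mon_val n c k * mon_val n d k"
  by (simp add: mon_val_def power_mult_distrib prod.distrib)

lemma mon_val_add: "mon_val n c (k + l) = mon_val n c k * mon_val n c l"
  by (simp add: mon_val_def lookup_add power_add prod.distrib)

lemma mon_val_cong: "(\<And>j. j < n \<Longrightarrow> c j = d j) \<Longrightarrow> mon_val n c k = mon_val n d k"
  by (simp add: mon_val_def)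

lemma mon_val_one [simp]: "mon_val n (\<lambda>_. 1) k = 1"
  by (simp add: mon_val_def)

lemma mat_action_eq_lext:
  "mat_action A n g = lext (\<lambda>k. foldr (\<otimes>\<^bsub>A\<^esub>)
     (map (\<lambda>j. lin_image n g j [^]\<^bsub>A\<^esub> Poly_Mapping.lookup k j) [0..<n]) \<one>\<^bsub>A\<^esub>)"
  by (simp add: mat_action_def lext_def fun_eq_iff)

lemma mat_action_zero [simp]: "mat_action A n g 0 = 0"
  by (simp add: mat_action_eq_lext)

lemma mat_action_add: "mat_action A n g (f + h) = mat_action A n g f + mat_action A n g h"
  by (simp add: mat_action_eq_lext lext_add)

lemma mat_action_scale: "mat_action A n g (scale c f) = scale c (mat_action A n g f)"
  by (simp add: mat_action_eq_lext lext_scale)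

lemma mat_action_lext: "mat_action A n g (lext F a) = lext (\<lambda>k. mat_action A n g (F k)) a"
  by (simp add: mat_action_eq_lext lext_lext)

lemma lin_image_mono_mat:
  assumes "w permutes {..<n}" "j < n"
  shows "lin_image n (mono_mat n w c) j = Poly_Mapping.single (Poly_Mapping.single (w j) 1) (c j)"
proof -
  have "lin_image n (mono_mat n w c) j = (\<Sum>i<n. if i = w j then scale (c j) (var i) else 0)"
    unfolding lin_image_def using assms by (intro sum.cong) auto
  then show ?thesis
    using perm_lt[OF assms] by (simp add: var_def)
qed

definition (in bicharacter) action_coeff ::
  "nat \<Rightarrow> (nat \<Rightarrow> nat) \<Rightarrow> (nat \<Rightarrow> complex) \<Rightarrow> monomial \<Rightarrow> complex" where
  "action_coeff n w c k = mon_val n c k * (\<Prod>i<n. \<Prod>j\<in>{i<..<n}.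
     \<beta> (Poly_Mapping.single (w i) (Poly_Mapping.lookup k i)) (Poly_Mapping.single (w j) (Poly_Mapping.lookup k j)))"

lemma (in bicharacter) mat_action_single:
  assumes "w permutes {..<n}" "k \<in> monomials n"
  shows "mat_action (twisted_poly \<beta> n) n (mono_mat n w c) (Poly_Mapping.single k a) =
    Poly_Mapping.single (permute_mon w k) (a * action_coeff n w c k)"
proof -
  have "map (\<lambda>j. lin_image n (mono_mat n w c) j [^]\<^bsub>twisted_poly \<beta> n\<^esub> Poly_Mapping.lookup k j) [0..<n] =
      map (\<lambda>j. Poly_Mapping.single (Poly_Mapping.single (w j) (Poly_Mapping.lookup k j))
        (c j ^ Poly_Mapping.lookup k j)) [0..<n]"
    using assms by (intro map_cong refl) (simp only: lin_image_mono_mat single_power set_upt atLeastLessThan_iff)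
  then show ?thesis
    using sum_single_permute_mon[OF assms]
    by (simp only: mat_action_eq_lext lext_single twisted_poly_simps(2) twisted_poly_mult
        foldr_tmult_monomials[OF le0] atLeast0LessThan action_coeff_def mon_val_def scale_single)
qed

lemma Sym_action_single:
  assumes "w permutes {..<n}" "k \<in> monomials n"
  shows "mat_action (Sym n) n (mono_mat n w c) (Poly_Mapping.single k a) =
    Poly_Mapping.single (permute_mon w k) (a * mon_val n c k)"
  unfolding Sym_eq_twisted_poly trivial.mat_action_single[OF assms] by (simp add: trivial.action_coeff_def)

text \<open>
  The pairs \<open>i < j\<close> with \<open>w j < w i\<close> are those whose images have to be interchanged.
\<close>

lemma Skew_action_single:
  assumes "w permutes {..<n}" "k \<in> monomials n"
  shows "mat_action (Skew n) n (mono_mat n w c) (Poly_Mapping.single k a) =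
    Poly_Mapping.single (permute_mon w k)
      (a * (mon_val n c k * (-1) ^ inversion_sum n w (Poly_Mapping.lookup k)))"
proof -
  have "(\<Prod>j\<in>{i<..<n}. skew_sign (Poly_Mapping.single (w i) (Poly_Mapping.lookup k i))
      (Poly_Mapping.single (w j) (Poly_Mapping.lookup k j))) =
    (\<Prod>j<n. (-1) ^ (if i < j \<and> w j < w i then Poly_Mapping.lookup k i * Poly_Mapping.lookup k j else 0))" for i
    unfolding skew_sign_single by (rule prod.mono_neutral_cong_left) auto
  then show ?thesis
    unfolding Skew_eq_twisted_poly skew.mat_action_single[OF assms]
    by (simp add: skew.action_coeff_def inversion_sum_def power_sum)
qed

lemma Sym_action_closed:
  assumes "w permutes {..<n}" "f \<in> S_space n"
  shows "mat_action (Sym n) n (mono_mat n w c) f \<in> S_space n"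
  using assms(2) by (induction rule: S_space_linear_induct)
    (auto simp: Sym_action_single[OF assms(1)] mat_action_add S_space_add permute_mon_in_monomials[OF assms(1)])

lemma Skew_action_closed:
  assumes "w permutes {..<n}" "f \<in> S_space n"
  shows "mat_action (Skew n) n (mono_mat n w c) f \<in> S_space n"
  using assms(2) by (induction rule: S_space_linear_induct)
    (auto simp: Skew_action_single[OF assms(1)] mat_action_add S_space_add permute_mon_in_monomials[OF assms(1)])

lemma Sym_action_mult:
  assumes v: "v permutes {..<n}" and w: "w permutes {..<n}" and f: "f \<in> S_space n"
  shows "mat_action (Sym n) n (mono_mat n w c * mono_mat n v d) f =
    mat_action (Sym n) n (mono_mat n w c) (mat_action (Sym n) n (mono_mat n v d) f)"
proof -
  define u where "u = w \<circ> v"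
  have u: "u permutes {..<n}" "permute_mon u k = permute_mon w (permute_mon v k)" for k
    unfolding u_def by (rule permutes_compose[OF v w], rule permute_mon_comp[OF v w])
  show ?thesis
    unfolding mono_mat_mult[OF v] u_def[symmetric] using f
    by (induction rule: S_space_linear_induct)
      (simp_all add: Sym_action_single v w u permute_mon_in_monomials[OF v] mon_val_mult
        mon_val_permute[OF v] mat_action_add ac_simps)
qed

text \<open>
  Monomial matrices act on \<open>S\<^sub>-\<^sub>1(V)\<close> because the sorting signs form a cocycle.
\<close>

lemma Skew_action_mult:
  assumes v: "v permutes {..<n}" and w: "w permutes {..<n}" and f: "f \<in> S_space n"
  shows "mat_action (Skew n) n (mono_mat n w c * mono_mat n v d) f =
    mat_action (Skew n) n (mono_mat n w c) (mat_action (Skew n) n (mono_mat n v d) f)"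
proof -
  define u where "u = w \<circ> v"
  have u: "u permutes {..<n}" "permute_mon u k = permute_mon w (permute_mon v k)" for k
    unfolding u_def by (rule permutes_compose[OF v w], rule permute_mon_comp[OF v w])
  have inversions: "(-1 :: complex) ^ inversion_sum n u (Poly_Mapping.lookup k) =
      (-1) ^ inversion_sum n v (Poly_Mapping.lookup k) *
      (-1) ^ inversion_sum n w (Poly_Mapping.lookup (permute_mon v k))" for k
  proof -
    have "Poly_Mapping.lookup (permute_mon v k) = Poly_Mapping.lookup k \<circ> Hilbert_Choice.inv v"
      using lookup_permute_mon[OF v] by auto
    then have "even (inversion_sum n u (Poly_Mapping.lookup k) +
        (inversion_sum n v (Poly_Mapping.lookup k) + inversion_sum n w (Poly_Mapping.lookup (permute_mon v k))))"
      using even_inversion_sum_comp[OF v w, of "Poly_Mapping.lookup k"] by (simp only: add.assoc u_def)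
    then show ?thesis
      unfolding power_add[symmetric] by (rule minus_one_power_even_sum)
  qed
  show ?thesis
    unfolding mono_mat_mult[OF v] u_def[symmetric] using f
    by (induction rule: S_space_linear_induct)
      (simp_all add: Skew_action_single v w u permute_mon_in_monomials[OF v] inversions mon_val_mult
        mon_val_permute[OF v] mat_action_add ac_simps)
qed

lemma diagonal_action_single:
  assumes "k \<in> monomials n"
  shows "mat_action (Sym n) n (mono_mat n id c) (Poly_Mapping.single k a) = Poly_Mapping.single k (a * mon_val n c k)"
    and "mat_action (Skew n) n (mono_mat n id c) (Poly_Mapping.single k a) = Poly_Mapping.single k (a * mon_val n c k)"
  by (simp_all add: Sym_action_single Skew_action_single permutes_id assms del: id_apply)

lemma diagonal_action:
  assumes "f \<in> S_space n"
  shows "mat_action (Sym n) n (mono_mat n id c) f = lext (\<lambda>k. Poly_Mapping.single k (mon_val n c k)) f"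
    and "mat_action (Skew n) n (mono_mat n id c) f = lext (\<lambda>k. Poly_Mapping.single k (mon_val n c k)) f"
  using assms by (induction rule: S_space_linear_induct)
    (simp_all add: diagonal_action_single mat_action_add lext_add)

lemma lookup_diagonal: "Poly_Mapping.lookup (lext (\<lambda>k. Poly_Mapping.single k (\<chi> k)) f) k = Poly_Mapping.lookup f k * \<chi> k"
  by (auto simp: lext_def lookup_sum lookup_single when_def in_keys_iff if_distrib cong: if_cong)

section \<open>The group of diagonal sign matrices\<close>

lemma GL_mult [simp]: "x \<otimes>\<^bsub>GL n\<^esub> y = x * y"
  by (simp add: GL_def units_of_mult ring_mat_def)

lemma GL_one [simp]: "\<one>\<^bsub>GL n\<^esub> = 1\<^sub>m n"
  by (simp add: GL_def units_of_one ring_mat_def)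

lemma group_GL: "group (GL n)"
  unfolding GL_def using ring_mat by (intro monoid.units_group) (rule ring.is_monoid)

lemma mono_mat_in_GL:
  assumes w: "w permutes {..<n}" and c: "\<And>j. j < n \<Longrightarrow> c j \<noteq> 0"
  shows "mono_mat n w c \<in> carrier (GL n)"
proof -
  define d where "d i = 1 / c (Hilbert_Choice.inv w i)" for i
  have "mono_mat n w c * mono_mat n (Hilbert_Choice.inv w) d = 1\<^sub>m n"
    unfolding mono_mat_mult[OF permutes_inv[OF w]] one_mat_eq_mono_mat permutes_inv_o[OF w]
    using c perm_lt[OF permutes_inv[OF w]] by (intro mono_mat_cong) (simp add: d_def)
  moreover have "mono_mat n (Hilbert_Choice.inv w) d * mono_mat n w c = 1\<^sub>m n"
    unfolding mono_mat_mult[OF w] one_mat_eq_mono_mat permutes_inv_o[OF w]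
    using c by (intro mono_mat_cong) (simp add: d_def permutes_inverses[OF w])
  ultimately show ?thesis
    by (auto simp: GL_def units_of_carrier Units_def ring_mat_def intro!: bexI[of _ "mono_mat n (Hilbert_Choice.inv w) d"])
qed

definition signs :: "(nat \<Rightarrow> complex) \<Rightarrow> bool" where
  "signs e \<longleftrightarrow> (\<forall>j. e j = 1 \<or> e j = -1)"

lemma signs_square: "signs e \<Longrightarrow> e j * e j = 1"
  unfolding signs_def by (metis mult_1 mult_minus1_right minus_minus)

lemma signs_nonzero: "signs e \<Longrightarrow> e j \<noteq> 0"
  unfolding signs_def by (metis zero_neq_one zero_neq_neg_one)

lemma signs_mult: "signs d \<Longrightarrow> signs e \<Longrightarrow> signs (\<lambda>j. d j * e j)"
  unfolding signs_def by (metis mult_1 mult_minus1_right mult_minus1 minus_minus)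

lemma diag_mult: "mono_mat n id c * mono_mat n id d = mono_mat n id (\<lambda>j. c j * d j)"
  using mono_mat_mult[OF permutes_id, where w = id] by (simp only: id_o id_apply)

lemma sign_mat_square: "signs e \<Longrightarrow> mono_mat n id e * mono_mat n id e = 1\<^sub>m n"
  by (simp only: diag_mult signs_square one_mat_eq_mono_mat)

lemma sign_mat_inv:
  assumes "signs e"
  shows "inv\<^bsub>GL n\<^esub> (mono_mat n id e) = mono_mat n id e"
proof -
  have "mono_mat n id e \<in> carrier (GL n)"
    using signs_nonzero[OF assms] by (intro mono_mat_in_GL permutes_id)
  then show ?thesis
    by (intro group.inv_equality[OF group_GL]) (simp_all only: GL_mult GL_one sign_mat_square[OF assms])
qed

lemma t_mat_eq: "t_mat n i = mono_mat n id (\<lambda>j. if j = i then -1 else 1)"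
  by (intro eq_matI) (auto simp: t_mat_def)

lemma T_group_simps [simp]:
  "x \<otimes>\<^bsub>T_group n\<^esub> y = x * y" "\<one>\<^bsub>T_group n\<^esub> = 1\<^sub>m n"
  by (simp_all add: T_group_def)

text \<open>
  The matrices \<open>t\<^sub>i\<close> generate only diagonal matrices with entries \<open>1\<close> and \<open>-1\<close>, and these are
  closed under products and are their own inverses.
\<close>

lemma T_groupE:
  assumes "t \<in> carrier (T_group n)"
  obtains e where "signs e" "t = mono_mat n id e"
proof -
  have "t \<in> generate (GL n) (t_mat n ` {..<n})"
    using assms by (simp add: T_group_def)
  then have "\<exists>e. signs e \<and> t = mono_mat n id e"
  proof (induction rule: generate.induct)
    case one
    then show ?case
      by (intro exI[of _ "\<lambda>_. 1"]) (simp add: signs_def one_mat_eq_mono_mat id_def)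
  next
    case (incl h)
    then obtain i where "h = t_mat n i" by auto
    then show ?case
      by (intro exI[of _ "\<lambda>j. if j = i then -1 else 1"]) (auto simp: signs_def t_mat_eq)
  next
    case (inv h)
    then obtain i where h: "h = mono_mat n id (\<lambda>j. if j = i then -1 else 1)" using t_mat_eq by auto
    have s: "signs (\<lambda>j. if j = i then -1 else 1)" by (auto simp: signs_def)
    show ?case
      unfolding h sign_mat_inv[OF s] using s by blast
  next
    case (eng h1 h2)
    then show ?case
      using signs_mult diag_mult by (metis GL_mult)
  qed
  then show ?thesis
    using that by blast
qed

lemma T_group_closed:
  assumes "s \<in> carrier (T_group n)" "t \<in> carrier (T_group n)"
  shows "s * t \<in> carrier (T_group n)"
  using generate.eng[of s "GL n" _ t] assms by (simp add: T_group_def)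

lemma t_mat_in_T_group: "i < n \<Longrightarrow> t_mat n i \<in> carrier (T_group n)"
  unfolding T_group_def by (simp add: generate.incl)

lemma one_in_T_group: "1\<^sub>m n \<in> carrier (T_group n)"
  using generate.one[of "GL n"] by (simp add: T_group_def)

lemma T_group_carrier_mat: "t \<in> carrier (T_group n) \<Longrightarrow> t \<in> carrier_mat n n"
  by (elim T_groupE) simp

lemma T_group_comm:
  assumes "s \<in> carrier (T_group n)" "t \<in> carrier (T_group n)"
  shows "s * t = t * s"
proof -
  obtain d e where "s = mono_mat n id d" "t = mono_mat n id e"
    using assms by (metis T_groupE)
  then show ?thesis
    by (simp only: diag_mult mult.commute)
qed

lemma comm_monoid_TT: "comm_monoid (T_group n \<times>\<times> T_group n)"
proof (rule comm_monoidI)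
qed (auto simp: DirProd_def one_in_T_group T_group_closed T_group_comm
      intro: T_group_carrier_mat assoc_mult_mat[OF T_group_carrier_mat T_group_carrier_mat T_group_carrier_mat]
      intro!: left_mult_one_mat[OF T_group_carrier_mat])

section \<open>Evaluating the cocycle at characters\<close>

definition diag_val :: "nat \<Rightarrow> complex mat \<Rightarrow> monomial \<Rightarrow> complex" where
  "diag_val n t k = mon_val n (\<lambda>j. t $$ (j,j)) k"

lemma diag_val_mono_mat: "diag_val n (mono_mat n id e) k = mon_val n e k"
  unfolding diag_val_def by (rule mon_val_cong) simp

lemma diag_val_one: "diag_val n (1\<^sub>m n) k = 1"
  by (simp only: one_mat_eq_mono_mat diag_val_mono_mat mon_val_one)

lemma diag_val_mult:
  assumes "s \<in> carrier (T_group n)" "t \<in> carrier (T_group n)"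
  shows "diag_val n (s * t) k = diag_val n s k * diag_val n t k"
proof -
  obtain d e where "s = mono_mat n id d" "t = mono_mat n id e"
    using assms by (metis T_groupE)
  then show ?thesis
    by (simp only: diag_mult diag_val_mono_mat mon_val_mult)
qed

lemma diag_val_t_mat:
  assumes "i < n"
  shows "diag_val n (t_mat n i) k = (-1) ^ Poly_Mapping.lookup k i"
proof -
  have "diag_val n (t_mat n i) k = (\<Prod>j<n. if j = i then (-1) ^ Poly_Mapping.lookup k i else 1)"
    unfolding t_mat_eq diag_val_mono_mat mon_val_def by (intro prod.cong) auto
  then show ?thesis
    using assms by simp
qed

text \<open>
  The homomorphism from \<open>\<complex>T \<otimes> \<complex>T\<close> to \<open>\<complex>\<close> given by the two characters of \<open>T\<close> through which \<open>T\<close> acts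
  on \<open>x\<^sup>k\<close> and on \<open>x\<^sup>l\<close>. It determines the effect of an element of \<open>\<complex>T \<otimes> \<complex>T\<close> on \<open>x\<^sup>k \<otimes> x\<^sup>l\<close>.
\<close>

definition TT_eval :: "nat \<Rightarrow> monomial \<Rightarrow> monomial \<Rightarrow> (complex mat \<times> complex mat \<Rightarrow>\<^sub>0 complex) \<Rightarrow> complex" where
  "TT_eval n k l R = (\<Sum>st\<in>Poly_Mapping.keys R.
     Poly_Mapping.lookup R st * (diag_val n (fst st) k * diag_val n (snd st) l))"

lemma TT_eval_add: "TT_eval n k l (R + R') = TT_eval n k l R + TT_eval n k l R'"
  unfolding TT_eval_def by (rule setsum_keys_plus_distrib) (auto simp: distrib_right)

lemma TT_eval_simps [simp]:
  "TT_eval n k l 0 = 0"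
  "TT_eval n k l (Poly_Mapping.single st c) = c * (diag_val n (fst st) k * diag_val n (snd st) l)"
  by (simp_all add: TT_eval_def)

abbreviation TT_keys :: "nat \<Rightarrow> (complex mat \<times> complex mat \<Rightarrow>\<^sub>0 complex) \<Rightarrow> bool" where
  "TT_keys n R \<equiv> Poly_Mapping.keys R \<subseteq> carrier (T_group n) \<times> carrier (T_group n)"

lemma TT_eval_mult:
  assumes "TT_keys n R" "TT_keys n R'"
  shows "TT_eval n k l (R \<otimes>\<^bsub>TT_algebra n\<^esub> R') = TT_eval n k l R * TT_eval n k l R'"
  using assms(1)
proof (induction rule: poly_mapping_linear_induct)
  case (single st c)
  show ?case using assms(2)
  proof (induction rule: poly_mapping_linear_induct)
    case (single uv d)
    then show ?case
      using \<open>st \<in> _\<close> by (auto simp: DirProd_def diag_val_mult)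
  qed (simp_all add: bil_add_right TT_eval_add distrib_left)
qed (simp_all add: bil_add_left TT_eval_add distrib_right)

definition cocycle_factor :: "nat \<Rightarrow> nat \<Rightarrow> nat \<Rightarrow> (complex mat \<times> complex mat \<Rightarrow>\<^sub>0 complex)" where
  "cocycle_factor n i j = scale (1/2) (grp (1\<^sub>m n, 1\<^sub>m n) + grp (t_mat n i, 1\<^sub>m n) + grp (1\<^sub>m n, t_mat n j)
     - grp (t_mat n i, t_mat n j))"

lemma cocycle_factor_eq:
  "cocycle_factor n i j = Poly_Mapping.single (1\<^sub>m n, 1\<^sub>m n) (1/2) + Poly_Mapping.single (t_mat n i, 1\<^sub>m n) (1/2)
     + Poly_Mapping.single (1\<^sub>m n, t_mat n j) (1/2) + Poly_Mapping.single (t_mat n i, t_mat n j) (-1/2)"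
  by (rule poly_mapping_eqI)
    (simp add: cocycle_factor_def lookup_add lookup_minus lookup_single when_def algebra_simps)

lemma cocycle_factor_keys:
  assumes "i < n" "j < n"
  shows "TT_keys n (cocycle_factor n i j)"
proof -
  have *: "(1\<^sub>m n, 1\<^sub>m n) \<in> carrier (T_group n) \<times> carrier (T_group n)"
    "(t_mat n i, 1\<^sub>m n) \<in> carrier (T_group n) \<times> carrier (T_group n)"
    "(1\<^sub>m n, t_mat n j) \<in> carrier (T_group n) \<times> carrier (T_group n)"
    "(t_mat n i, t_mat n j) \<in> carrier (T_group n) \<times> carrier (T_group n)"
    using assms by (auto simp: one_in_T_group t_mat_in_T_group)
  show ?thesis
    unfolding cocycle_factor_eq
    by (intro order.trans[OF keys_add] Un_least) (use * in auto)
qed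

lemma t_mat_square: "t_mat n i * t_mat n i = 1\<^sub>m n"
  unfolding t_mat_eq by (rule sign_mat_square) (auto simp: signs_def)

text \<open>
  With the commuting involutions \<open>a = t\<^sub>i \<otimes> 1\<close> and \<open>b = 1 \<otimes> t\<^sub>j\<close> this is the identity
  \<open>(1 + a + b - ab)\<^sup>2 = 4\<close>. It makes the cocycle its own inverse.
\<close>

lemma cocycle_factor_square:
  "cocycle_factor n i j \<otimes>\<^bsub>TT_algebra n\<^esub> cocycle_factor n i j = \<one>\<^bsub>TT_algebra n\<^esub>"
proof -
  have carr: "t_mat n i \<in> carrier_mat n n" "t_mat n j \<in> carrier_mat n n"
    by (simp_all add: t_mat_def)
  note [simp] = left_mult_one_mat[OF carr(1)] left_mult_one_mat[OF carr(2)]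
    right_mult_one_mat[OF carr(1)] right_mult_one_mat[OF carr(2)]
  show ?thesis
    by (simp add: cocycle_factor_eq bil_add_left bil_add_right DirProd_def t_mat_square)
      (rule poly_mapping_eqI, simp add: lookup_add lookup_single when_def algebra_simps)
qed

text \<open>
  If \<open>a\<close> and \<open>b\<close> are \<open>1\<close> or \<open>-1\<close>, then \<open>(1 + a + b - ab) / 2\<close> is \<open>-1\<close> if both are \<open>-1\<close>, and \<open>1\<close> otherwise.
\<close>

lemma TT_eval_cocycle_factor:
  assumes "i < n" "j < n"
  shows "TT_eval n k l (cocycle_factor n i j) = (-1) ^ (Poly_Mapping.lookup k i * Poly_Mapping.lookup l j)"
  using assms
  by (cases "even (Poly_Mapping.lookup k i)"; cases "even (Poly_Mapping.lookup l j)")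
    (simp_all add: cocycle_factor_eq TT_eval_add diag_val_one diag_val_t_mat)

abbreviation twist :: "nat \<Rightarrow> (complex mat \<times> complex mat \<Rightarrow>\<^sub>0 complex)" where
  "twist n \<equiv> inv\<^bsub>TT_algebra n\<^esub> (cocycle n)"

text \<open>
  The cocycle is a product of commuting involutions, so it equals its inverse, and evaluation at a pair
  of characters is multiplicative. The exponents \<open>k\<^sub>i l\<^sub>j\<close> with \<open>j < i\<close> coming from the factors add up to
  the exponent in the definition of the sorting sign.
\<close>

lemma twist_keys: "TT_keys n (twist n)"
  and TT_eval_twist: "k \<in> monomials n \<Longrightarrow> l \<in> monomials n \<Longrightarrow> TT_eval n k l (twist n) = skew_sign k l"
proof -
  interpret comm_monoid "TT_algebra n"
    by (rule comm_monoid_group_algebra[OF comm_monoid_TT])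
  define P where "P = {(i,j). j < i \<and> i < n}"
  define F where "F = (\<lambda>(i,j). cocycle_factor n i j)"
  have P_Sigma: "P = Sigma {..<n} (\<lambda>i. {j \<in> {..<n}. j < i})"
    by (auto simp: P_def)
  have finP: "finite P"
    unfolding P_Sigma by auto
  have cocycle: "cocycle n = finprod (TT_algebra n) F P"
    by (simp add: cocycle_def P_def F_def cocycle_factor_def)
  have F_carrier: "F \<in> P \<rightarrow> carrier (TT_algebra n)"
  proof
    fix x assume "x \<in> P"
    then obtain i j where "x = (i,j)" "i < n" "j < n"
      by (auto simp: P_def)
    then show "F x \<in> carrier (TT_algebra n)"
      using cocycle_factor_keys[of i n j] by (simp add: F_def DirProd_def)
  qed
  then have closed: "cocycle n \<in> carrier (TT_algebra n)"
    unfolding cocycle by (rule finprod_closed)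
  have "cocycle n \<otimes>\<^bsub>TT_algebra n\<^esub> cocycle n = finprod (TT_algebra n) (\<lambda>x. F x \<otimes>\<^bsub>TT_algebra n\<^esub> F x) P"
    unfolding cocycle using finprod_multf[OF F_carrier F_carrier] by (rule sym)
  also have "\<dots> = \<one>\<^bsub>TT_algebra n\<^esub>"
    by (rule finprod_one_eqI) (clarsimp simp only: F_def split_paired_all prod.case cocycle_factor_square)
  finally have eq: "twist n = cocycle n"
    using inv_unique'[OF closed closed] by (metis (no_types))
  show "TT_keys n (twist n)"
    unfolding eq using closed by (simp add: DirProd_def)
  show "TT_eval n k l (twist n) = skew_sign k l" if k: "k \<in> monomials n" and l: "l \<in> monomials n"
  proof -
    have "TT_eval n k l (finprod (TT_algebra n) F A) = (\<Prod>x\<in>A. TT_eval n k l (F x))"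
      if "finite A" "A \<subseteq> P" for A
      using that
    proof (induction A rule: finite_induct)
      case empty
      show ?case
        unfolding finprod_empty prod.empty by (simp add: DirProd_def diag_val_one)
    next
      case (insert x A)
      have FA: "F x \<in> carrier (TT_algebra n)" "F \<in> A \<rightarrow> carrier (TT_algebra n)"
        using F_carrier insert.prems by auto
      have "finprod (TT_algebra n) F (insert x A) = F x \<otimes>\<^bsub>TT_algebra n\<^esub> finprod (TT_algebra n) F A"
        using insert.hyps FA by (intro finprod_insert) auto
      moreover have "TT_keys n (F x)" "TT_keys n (finprod (TT_algebra n) F A)"
        using FA finprod_closed[OF FA(2)] by (simp_all add: DirProd_def)
      ultimately show ?case
        using insert TT_eval_mult by (simp del: group_algebra_simps(6))
    qed
    then have "TT_eval n k l (cocycle n) = (\<Prod>x\<in>P. TT_eval n k l (F x))"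
      unfolding cocycle using finP by simp
    also have "\<dots> = (\<Prod>(i,j)\<in>P. (-1) ^ (Poly_Mapping.lookup k i * Poly_Mapping.lookup l j))"
      by (intro prod.cong) (auto simp: F_def P_def TT_eval_cocycle_factor)
    also have "\<dots> = (\<Prod>i<n. \<Prod>j\<in>{j \<in> {..<n}. j < i}. (-1) ^ (Poly_Mapping.lookup k i * Poly_Mapping.lookup l j))"
      unfolding P_Sigma by (subst prod.Sigma) auto
    also have "\<dots> = skew_sign k l"
      using k l by (subst skew_sign_eq[of "{..<n}"]) (auto simp: monomials_def power_sum)
    finally show ?thesis
      by (simp only: eq)
  qed
qed

lemma twist_keysD:
  assumes "st \<in> Poly_Mapping.keys (twist n)"
  shows "fst st \<in> carrier (T_group n)" "snd st \<in> carrier (T_group n)"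
  using subsetD[OF twist_keys assms] by (simp_all add: mem_Times_iff)

lemma lext_single_target:
  "lext (\<lambda>x. Poly_Mapping.single \<kappa> (\<phi> x)) R =
    Poly_Mapping.single \<kappa> (\<Sum>x\<in>Poly_Mapping.keys R. Poly_Mapping.lookup R x * \<phi> x)"
  by (rule poly_mapping_eqI) (simp add: lext_def lookup_sum lookup_single when_def)

text \<open>
  The form in which the evaluation of the cocycle is used: a sum over the terms of the cocycle whose
  summands depend on \<open>(s,t)\<close> only through the two characters collapses to a sign.
\<close>

lemma lext_twist:
  assumes "k \<in> monomials n" "l \<in> monomials n"
  shows "lext (\<lambda>st. Poly_Mapping.single \<kappa> (diag_val n (fst st) k * diag_val n (snd st) l * c)) (twist n) =
    Poly_Mapping.single \<kappa> (skew_sign k l * c)"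
  unfolding lext_single_target TT_eval_twist[OF assms, symmetric] TT_eval_def
  by (simp add: sum_distrib_right mult.assoc)

section \<open>Twisting by the sign group turns one product into the other\<close>

lemma T_action_single:
  assumes "t \<in> carrier (T_group n)" "k \<in> monomials n"
  shows "mat_action (Sym n) n t (Poly_Mapping.single k a) = Poly_Mapping.single k (a * diag_val n t k)"
  using assms by (elim T_groupE) (simp only: diagonal_action_single diag_val_mono_mat)

lemma T_action_closed:
  assumes "t \<in> carrier (T_group n)" "f \<in> S_space n"
  shows "mat_action (Sym n) n t f \<in> S_space n"
  using assms by (elim T_groupE) (simp only: Sym_action_closed permutes_id)

lemma T_action_keys:
  assumes "t \<in> carrier (T_group n)" "f \<in> S_space n"
  shows "Poly_Mapping.keys (mat_action (Sym n) n t f) \<subseteq> Poly_Mapping.keys f"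
proof -
  obtain e where "t = mono_mat n id e"
    using assms(1) by (elim T_groupE)
  then show ?thesis
    using assms(2) by (auto simp only: diagonal_action) (use keys_lext in \<open>fastforce split: if_splits\<close>)
qed

lemma T_action_one:
  "f \<in> S_space n \<Longrightarrow> mat_action (Sym n) n (1\<^sub>m n) f = f"
  by (induction rule: S_space_linear_induct)
    (simp_all add: T_action_single one_in_T_group diag_val_one mat_action_add)

lemma (in bicharacter) T_action_tmult:
  assumes t: "t \<in> carrier (T_group n)" and f: "f \<in> S_space n" and h: "h \<in> S_space n"
  shows "mat_action (Sym n) n t (tmult f h) = tmult (mat_action (Sym n) n t f) (mat_action (Sym n) n t h)"
  using f
proof (induction rule: S_space_linear_induct)
  case (single k a)
  show ?case using h
  proof (induction rule: S_space_linear_induct)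
    case (single l b)
    have "diag_val n t (k + l) = diag_val n t k * diag_val n t l"
      by (simp add: diag_val_def mon_val_add)
    then show ?case
      using single \<open>k \<in> monomials n\<close> by (simp add: T_action_single[OF t] add_in_monomials ac_simps)
  qed (simp_all add: bil_add_right mat_action_add)
qed (simp_all add: bil_add_left mat_action_add)

text \<open>
  Two products that differ by the sorting sign. Since this sign is an involution, the pair formed by
  \<open>S(V)\<close> and \<open>S\<^sub>-\<^sub>1(V)\<close> is an instance in both orders.
\<close>

locale twisted_pair = A: bicharacter \<alpha> + B: bicharacter \<beta> for \<alpha> \<beta> +
  assumes twisted: "\<beta> k l = skew_sign k l * \<alpha> k l"
begin

text \<open>
  On two monomials the right-hand side is the product for \<open>\<alpha>\<close> times the value of the cocycle at their
  characters.
\<close>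

lemma tmult_twisted:
  assumes f: "f \<in> S_space n" and h: "h \<in> S_space n"
  shows "B.tmult f h = lext (\<lambda>st. A.tmult (mat_action (Sym n) n (fst st) f) (mat_action (Sym n) n (snd st) h)) (twist n)"
  using f
proof (induction rule: S_space_linear_induct)
  case (single k a)
  show ?case using h
  proof (induction rule: S_space_linear_induct)
    case (single l b)
    have "lext (\<lambda>st. A.tmult (mat_action (Sym n) n (fst st) (Poly_Mapping.single k a))
        (mat_action (Sym n) n (snd st) (Poly_Mapping.single l b))) (twist n) =
      lext (\<lambda>st. Poly_Mapping.single (k + l) (diag_val n (fst st) k * diag_val n (snd st) l * (\<alpha> k l * a * b))) (twist n)"
    proof (rule lext_cong)
      fix st assume "st \<in> Poly_Mapping.keys (twist n)"
      then have "fst st \<in> carrier (T_group n)" "snd st \<in> carrier (T_group n)"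
        by (rule twist_keysD)+
      then show "A.tmult (mat_action (Sym n) n (fst st) (Poly_Mapping.single k a))
          (mat_action (Sym n) n (snd st) (Poly_Mapping.single l b)) =
        Poly_Mapping.single (k + l) (diag_val n (fst st) k * diag_val n (snd st) l * (\<alpha> k l * a * b))"
        using single \<open>k \<in> monomials n\<close> by (simp add: T_action_single ac_simps)
    qed
    also have "\<dots> = Poly_Mapping.single (k + l) (skew_sign k l * (\<alpha> k l * a * b))"
      by (rule lext_twist) fact+
    also have "\<dots> = B.tmult (Poly_Mapping.single k a) (Poly_Mapping.single l b)"
      by (simp add: twisted ac_simps)
    finally show ?case
      by (rule sym)
  qed (simp_all add: bil_add_right mat_action_add lext_fun_add, simp add: lext_def)
qed (simp_all add: bil_add_left mat_action_add lext_fun_add, simp add: lext_def)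

end

interpretation sym_to_skew: twisted_pair "\<lambda>_ _. 1" skew_sign
  by unfold_locales simp

lemma skew_sign_square: "skew_sign k l * skew_sign k l = 1"
  unfolding skew_sign_def power_mult_distrib[symmetric] by simp

interpretation skew_to_sym: twisted_pair skew_sign "\<lambda>_ _. 1"
  by unfold_locales (simp add: skew_sign_square)

section \<open>Ideals of the twisted polynomial algebras\<close>

lemma (in bicharacter) ideal_iff:
  "ideal J (twisted_poly \<beta> n) \<longleftrightarrow> J \<subseteq> S_space n \<and> 0 \<in> J \<and> (\<forall>f\<in>J. \<forall>g\<in>J. f + g \<in> J) \<and>
     (\<forall>f\<in>J. \<forall>h\<in>S_space n. tmult h f \<in> J \<and> tmult f h \<in> J)" (is "?lhs \<longleftrightarrow> ?rhs")
proof
  assume ?lhs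
  then interpret ideal J "twisted_poly \<beta> n" .
  show ?rhs
    using a_subset additive_subgroup.zero_closed[OF is_additive_subgroup]
      additive_subgroup.a_closed[OF is_additive_subgroup] I_l_closed I_r_closed by auto
next
  assume R: ?rhs
  interpret ring "twisted_poly \<beta> n" by (rule twisted_poly_ring)
  show ?lhs
  proof (rule idealI)
    show "subgroup J (add_monoid (twisted_poly \<beta> n))"
    proof
      fix f assume "f \<in> J"
      then have f: "f \<in> S_space n" using R by auto
      have "scale (-1) f \<oplus>\<^bsub>twisted_poly \<beta> n\<^esub> f = \<zero>\<^bsub>twisted_poly \<beta> n\<^esub>"
        by (rule poly_mapping_eqI) (simp add: lookup_add)
      then have "\<ominus>\<^bsub>twisted_poly \<beta> n\<^esub> f = scale (-1) f"
        by (rule minus_equality) (use f S_space_scale in \<open>simp_all only: twisted_poly_simps\<close>)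
      also have "\<dots> = tmult (Poly_Mapping.single 0 (-1)) f"
        by (rule tmult_single_zero_left[symmetric])
      also have "\<dots> \<in> J"
        using R \<open>f \<in> J\<close> by simp
      finally show "inv\<^bsub>add_monoid (twisted_poly \<beta> n)\<^esub> f \<in> J"
        by (simp add: a_inv_def)
    qed (use R in auto)
  qed (use R twisted_poly_ring in auto)
qed

lemma (in bicharacter) ideal_scale:
  assumes "ideal J (twisted_poly \<beta> n)" "f \<in> J"
  shows "scale c f \<in> J"
proof -
  have "tmult (Poly_Mapping.single 0 c) f \<in> J"
    using assms by (simp add: ideal_iff)
  then show ?thesis
    by (simp only: tmult_single_zero_left)
qed

lemma (in bicharacter) ideal_sum:
  assumes "ideal J (twisted_poly \<beta> n)" "\<And>x. x \<in> A \<Longrightarrow> F x \<in> J"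
  shows "sum F A \<in> J"
  using assms unfolding ideal_iff by (induction A rule: infinite_finite_induct) auto

lemma (in bicharacter) ideal_lext:
  assumes "ideal J (twisted_poly \<beta> n)" "\<And>x. x \<in> Poly_Mapping.keys a \<Longrightarrow> F x \<in> J"
  shows "lext F a \<in> J"
  unfolding lext_def using assms by (intro ideal_sum ideal_scale)

definition T_stable :: "nat \<Rightarrow> polynomial set \<Rightarrow> bool" where
  "T_stable n J \<longleftrightarrow> (\<forall>t\<in>carrier (T_group n). \<forall>f\<in>J. mat_action (Sym n) n t f \<in> J)"

text \<open>
  A product for \<open>\<beta>\<close> with an element of \<open>J\<close> is a combination of products for \<open>\<alpha>\<close> with elements of
  the \<open>T\<close>-orbit of that element.
\<close>

lemma (in twisted_pair) T_stable_ideal_twisted: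
  assumes J: "ideal J (twisted_poly \<alpha> n)" and stable: "T_stable n J"
  shows "ideal J (twisted_poly \<beta> n)"
proof -
  have J_S: "J \<subseteq> S_space n"
    using J by (simp add: A.ideal_iff)
  have mult: "A.tmult h f \<in> J" "A.tmult f h \<in> J" if "f \<in> J" "h \<in> S_space n" for f h
    using J that by (auto simp: A.ideal_iff)
  have "B.tmult h f \<in> J \<and> B.tmult f h \<in> J" if f: "f \<in> J" and h: "h \<in> S_space n" for f h
  proof -
    have "f \<in> S_space n"
      using f J_S by auto
    then show ?thesis
      unfolding tmult_twisted[OF h \<open>f \<in> S_space n\<close>] tmult_twisted[OF \<open>f \<in> S_space n\<close> h]
      using stable f h
      by (intro conjI; intro A.ideal_lext[OF J])
        (auto intro: mult T_action_closed twist_keysD simp: T_stable_def simp del: split_paired_All)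
  qed
  then show ?thesis
    using J unfolding A.ideal_iff B.ideal_iff by blast
qed

text \<open>
  Elements of \<open>T\<close> act by algebra automorphisms, so the elements that \<open>t\<close> maps into the ideal
  form an ideal themselves.
\<close>

lemma (in bicharacter) T_stable_genideal:
  assumes P: "P \<subseteq> S_space n" and stable: "T_stable n P"
  shows "T_stable n (Idl\<^bsub>twisted_poly \<beta> n\<^esub> P)"
proof -
  let ?R = "twisted_poly \<beta> n"
  interpret ring ?R by (rule twisted_poly_ring)
  have ideal: "ideal (Idl\<^bsub>?R\<^esub> P) ?R"
    using P by (intro genideal_ideal) simp
  have "mat_action (Sym n) n t f \<in> Idl\<^bsub>?R\<^esub> P" if t: "t \<in> carrier (T_group n)" and f: "f \<in> Idl\<^bsub>?R\<^esub> P" for t f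
  proof -
    define J where "J = {f \<in> S_space n. mat_action (Sym n) n t f \<in> Idl\<^bsub>?R\<^esub> P}"
    have "ideal J ?R"
      using ideal T_action_closed[OF t]
      by (auto simp: ideal_iff J_def S_space_add tmult_closed mat_action_add T_action_tmult[OF t])
    moreover have "P \<subseteq> J"
      using P stable t genideal_self'[of _] genideal_self[of P] by (auto simp: J_def T_stable_def)
    ultimately have "Idl\<^bsub>?R\<^esub> P \<subseteq> J"
      by (rule genideal_minimal)
    then show ?thesis
      using f by (auto simp: J_def)
  qed
  then show ?thesis
    by (simp add: T_stable_def)
qed

lemma (in twisted_pair) genideal_subset_twisted:
  assumes P: "P \<subseteq> S_space n" and stable: "T_stable n P"
  shows "Idl\<^bsub>twisted_poly \<beta> n\<^esub> P \<subseteq> Idl\<^bsub>twisted_poly \<alpha> n\<^esub> P"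
proof -
  interpret RA: ring "twisted_poly \<alpha> n" by (rule A.twisted_poly_ring)
  interpret RB: ring "twisted_poly \<beta> n" by (rule B.twisted_poly_ring)
  have "ideal (Idl\<^bsub>twisted_poly \<alpha> n\<^esub> P) (twisted_poly \<beta> n)"
    using P by (intro T_stable_ideal_twisted A.T_stable_genideal stable RA.genideal_ideal) simp_all
  then show ?thesis
    using P by (intro RB.genideal_minimal RA.genideal_self) simp_all
qed

lemma genideal_Skew_eq_Sym:
  assumes "P \<subseteq> S_space n" "T_stable n P"
  shows "Idl\<^bsub>Skew n\<^esub> P = Idl\<^bsub>Sym n\<^esub> P"
  unfolding Skew_eq_twisted_poly Sym_eq_twisted_poly
  using assms by (intro equalityI sym_to_skew.genideal_subset_twisted skew_to_sym.genideal_subset_twisted)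

section \<open>The groups and their normalisation by sign matrices\<close>

text \<open>
  The conditions on the entries \<open>c\<close> of a monomial matrix. Membership in \<open>G\<close> is the case \<open>z = 1\<close>, and
  membership in \<open>W\<close> is the case where \<open>z\<close> is the sign of the permutation, with \<open>q = m div p\<close> in both.
\<close>

definition admissible :: "nat \<Rightarrow> nat \<Rightarrow> nat \<Rightarrow> complex \<Rightarrow> (nat \<Rightarrow> complex) \<Rightarrow> bool" where
  "admissible m q n z c \<longleftrightarrow> (\<forall>j<n. c j ^ m = 1) \<and> (z * (\<Prod>j<n. c j)) ^ q = 1"

lemma admissible_nonzero: "admissible m q n z c \<Longrightarrow> m > 0 \<Longrightarrow> j < n \<Longrightarrow> c j \<noteq> 0"
  by (auto simp: admissible_def power_0_left)

lemma mono_mat_entries: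
  assumes w: "w permutes {..<n}" and c: "\<And>j. j < n \<Longrightarrow> c j \<noteq> 0"
  shows "(\<forall>ij\<in>nonzero_positions n (mono_mat n w c). (mono_mat n w c $$ ij) ^ m = 1) \<longleftrightarrow> (\<forall>j<n. c j ^ m = 1)"
    and "(\<Prod>ij\<in>nonzero_positions n (mono_mat n w c). mono_mat n w c $$ ij) = (\<Prod>j<n. c j)"
proof -
  have inj: "inj_on (\<lambda>j. (w j, j)) {..<n}"
    by (auto simp: inj_on_def)
  show "(\<Prod>ij\<in>nonzero_positions n (mono_mat n w c). mono_mat n w c $$ ij) = (\<Prod>j<n. c j)"
    using perm_lt[OF w] by (simp add: nonzero_positions_mono_mat[OF assms] prod.reindex[OF inj])
  show "(\<forall>ij\<in>nonzero_positions n (mono_mat n w c). (mono_mat n w c $$ ij) ^ m = 1) \<longleftrightarrow> (\<forall>j<n. c j ^ m = 1)"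
    using perm_lt[OF w] by (auto simp: nonzero_positions_mono_mat[OF assms])
qed

context
  fixes m p n :: nat
  assumes m: "m > 0"
begin

lemma mono_mat_in_G:
  assumes "w permutes {..<n}" "admissible m (m div p) n 1 c"
  shows "mono_mat n w c \<in> carrier (G_group m p n)"
  using assms mono_mat_entries[OF assms(1) admissible_nonzero[OF assms(2) m]]
    monomial_mat_mono_mat[OF assms(1) admissible_nonzero[OF assms(2) m]]
  by (simp add: G_group_def admissible_def)

lemma mono_mat_in_W:
  assumes "w permutes {..<n}" "admissible m (m div p) n (of_int (sign w)) c"
  shows "mono_mat n w c \<in> carrier (W_group m p n)"
  using assms mono_mat_entries[OF assms(1) admissible_nonzero[OF assms(2) m]]
    monomial_mat_mono_mat[OF assms(1) admissible_nonzero[OF assms(2) m]]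
  by (simp add: W_group_def admissible_def det_mono_mat)

lemma G_groupE:
  assumes "g \<in> carrier (G_group m p n)"
  obtains w c where "w permutes {..<n}" "admissible m (m div p) n 1 c" "g = mono_mat n w c"
proof -
  have "monomial_mat n g"
    using assms by (simp add: G_group_def)
  then obtain w c where wc: "w permutes {..<n}" "\<And>j. j < n \<Longrightarrow> c j \<noteq> 0" "g = mono_mat n w c"
    using monomial_matE by blast
  then have "admissible m (m div p) n 1 c"
    using assms mono_mat_entries[OF wc(1,2)] by (simp add: G_group_def admissible_def)
  then show ?thesis
    using wc that by blast
qed

lemma W_groupE:
  assumes "g \<in> carrier (W_group m p n)"
  obtains w c where "w permutes {..<n}" "admissible m (m div p) n (of_int (sign w)) c" "g = mono_mat n w c"
proof -
  have "monomial_mat n g"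
    using assms by (simp add: W_group_def)
  then obtain w c where wc: "w permutes {..<n}" "\<And>j. j < n \<Longrightarrow> c j \<noteq> 0" "g = mono_mat n w c"
    using monomial_matE by blast
  then have "admissible m (m div p) n (of_int (sign w)) c"
    using assms mono_mat_entries[OF wc(1,2)] by (simp add: W_group_def admissible_def det_mono_mat)
  then show ?thesis
    using wc that by blast
qed

end

lemma sign_conj_mono_mat:
  assumes "w permutes {..<n}"
  shows "mono_mat n id e * mono_mat n w c * mono_mat n id e = mono_mat n w (\<lambda>j. e (w j) * c j * e j)"
  using mono_mat_mult[OF assms, where w = id and c = e and d = c]
    mono_mat_mult[OF permutes_id, where w = w and c = "\<lambda>j. e (w j) * c j" and d = e]
  by (simp only: id_o o_id id_apply)

lemma admissible_sign_conj:
  assumes w: "w permutes {..<n}" and e: "signs e" and c: "admissible m q n z c" and m: "even m"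
  shows "admissible m q n z (\<lambda>j. e (w j) * c j * e j)"
proof -
  have "e j ^ m = 1" for j
    using e m unfolding signs_def by (cases "e j = 1") auto
  moreover have "(\<Prod>j<n. e (w j)) * (\<Prod>j<n. e j) = 1"
  proof -
    have "(\<Prod>j<n. e (w j)) = (\<Prod>j<n. e j)"
      using prod.permute[OF w, of e] by (simp add: comp_def)
    then show ?thesis
      using signs_square[OF e] by (simp flip: prod.distrib)
  qed
  then have "(\<Prod>j<n. e (w j) * c j * e j) = (\<Prod>j<n. c j)"
    by (simp add: prod.distrib ac_simps)
  ultimately show ?thesis
    using c by (simp add: admissible_def power_mult_distrib)
qed

text \<open>
  Conjugation by a sign matrix \<open>e\<close> multiplies the entry in column \<open>j\<close> by \<open>e (w j)\<close> and \<open>e j\<close>. These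
  signs cancel in the product of all entries, and they are \<open>m\<close>-th roots of unity because \<open>m\<close> is even.
\<close>

lemma T_conj_in_G:
  assumes m: "m > 0" "even m" and t: "t \<in> carrier (T_group n)" and g: "g \<in> carrier (G_group m p n)"
  shows "t * g * t \<in> carrier (G_group m p n)"
proof -
  obtain e where e: "signs e" "t = mono_mat n id e"
    using t by (rule T_groupE)
  obtain w c where wc: "w permutes {..<n}" "admissible m (m div p) n 1 c" "g = mono_mat n w c"
    using m(1) g by (rule G_groupE)
  show ?thesis
    unfolding e(2) wc(3) sign_conj_mono_mat[OF wc(1)]
    by (intro mono_mat_in_G m(1) wc(1) admissible_sign_conj wc(2) e(1) m(2))
qed

section \<open>The invariants of the two groups coincide\<close>

text \<open>
  Invariance of \<open>x\<^sup>k\<close> under the diagonal matrices of \<open>G\<close>.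
\<close>

definition balanced :: "nat \<Rightarrow> nat \<Rightarrow> nat \<Rightarrow> monomial \<Rightarrow> bool" where
  "balanced m q n k \<longleftrightarrow> (\<forall>c. admissible m q n 1 c \<longrightarrow> mon_val n c k = 1)"

definition permute_poly :: "(nat \<Rightarrow> nat) \<Rightarrow> polynomial \<Rightarrow> polynomial" where
  "permute_poly w = lext (\<lambda>k. grp (permute_mon w k))"

text \<open>
  For \<open>a \<noteq> b\<close> the diagonal matrix with entries \<open>-1\<close> at \<open>a\<close> and \<open>b\<close> lies in \<open>G\<close> and multiplies \<open>x\<^sup>k\<close> by
  \<open>(-1)\<close> to the power \<open>k\<^sub>a + k\<^sub>b\<close>.
\<close>

lemma balanced_same_parity:
  assumes k: "balanced m q n k" and m: "even m" and ab: "a < n" "b < n"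
  shows "even (Poly_Mapping.lookup k a + Poly_Mapping.lookup k b)"
proof (cases "a = b")
  case False
  define c :: "nat \<Rightarrow> complex" where "c j = (if j = a then -1 else 1) * (if j = b then -1 else 1)" for j
  have "(\<Prod>j<n. c j) = 1"
    using ab by (simp add: c_def prod.distrib)
  then have "admissible m q n 1 c"
    using m by (auto simp: admissible_def c_def)
  then have "mon_val n c k = 1"
    using k by (simp add: balanced_def)
  moreover have "mon_val n c k = (-1) ^ (Poly_Mapping.lookup k a + Poly_Mapping.lookup k b)"
  proof -
    have "mon_val n c k = (\<Prod>j<n. (if j = a then (-1) ^ Poly_Mapping.lookup k a else 1) *
        (if j = b then (-1) ^ Poly_Mapping.lookup k b else 1))"
      unfolding mon_val_def c_def power_mult_distrib by (intro prod.cong) auto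
    then show ?thesis
      using ab by (simp add: prod.distrib power_add)
  qed
  ultimately show ?thesis
    by (cases "even (Poly_Mapping.lookup k a + Poly_Mapping.lookup k b)") auto
qed simp

text \<open>
  All exponents have the parity of \<open>k\<^sub>0\<close>, so every inversion of \<open>w\<close> contributes the same sign, \<open>-1\<close> to
  the power \<open>k\<^sub>0\<close>.
\<close>

lemma balanced_inversion_sign:
  assumes k: "balanced m q n k" and m: "even m" and n: "n > 0" and w: "w permutes {..<n}"
  shows "(-1 :: complex) ^ inversion_sum n w (Poly_Mapping.lookup k) = of_int (sign w) ^ Poly_Mapping.lookup k 0"
proof -
  have "even (inversion_sum n w (Poly_Mapping.lookup k) + inversion_sum n w (\<lambda>_. 1) * Poly_Mapping.lookup k 0)"
  proof -
    have "inversion_sum n w (Poly_Mapping.lookup k) + inversion_sum n w (\<lambda>_. 1) * Poly_Mapping.lookup k 0 =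
      (\<Sum>x<n. \<Sum>y<n. (if x < y \<and> w y < w x then Poly_Mapping.lookup k x * Poly_Mapping.lookup k y else 0) +
        (if x < y \<and> w y < w x then 1 * 1 else 0) * Poly_Mapping.lookup k 0)"
      by (simp only: inversion_sum_def sum_distrib_right sum.distrib)
    moreover have "even \<dots>"
    proof (intro dvd_sum)
      fix x y assume "x \<in> {..<n}" "y \<in> {..<n}"
      then have "even (Poly_Mapping.lookup k x + Poly_Mapping.lookup k 0)"
        "even (Poly_Mapping.lookup k y + Poly_Mapping.lookup k 0)"
        by (intro balanced_same_parity[OF k m _ n]; simp)+
      then show "even ((if x < y \<and> w y < w x then Poly_Mapping.lookup k x * Poly_Mapping.lookup k y else 0) +
        (if x < y \<and> w y < w x then 1 * 1 else 0) * Poly_Mapping.lookup k 0)"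
        by (cases "even (Poly_Mapping.lookup k x)"; cases "even (Poly_Mapping.lookup k y)")
          (simp_all add: even_add even_mult_iff)
    qed
    ultimately show ?thesis
      by (simp only:)
  qed
  then have "(-1 :: complex) ^ inversion_sum n w (Poly_Mapping.lookup k) =
      (-1) ^ (inversion_sum n w (\<lambda>_. 1) * Poly_Mapping.lookup k 0)"
    by (rule minus_one_power_even_sum)
  then show ?thesis
    unfolding sign_eq_inversion_parity[OF w] by (simp only: power_mult)
qed

lemma sign_squared: "of_int (sign w) * of_int (sign w) = (1 :: complex)"
  by (simp add: sign_def)

lemma sign_even_power: "even m \<Longrightarrow> of_int (sign w) ^ m = (1 :: complex)"
  by (simp add: sign_def)

text \<open>
  Multiplying the first entry of \<open>c\<close> by the sign of \<open>w\<close> yields the entries of a diagonal matrix of \<open>G\<close>,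
  which fixes \<open>x\<^sup>k\<close>. The factor thus introduced is the sign produced by sorting.
\<close>

lemma balanced_Skew_coefficient:
  assumes k: "balanced m q n k" and m: "even m" and n: "n > 0" and w: "w permutes {..<n}"
    and c: "admissible m q n (of_int (sign w)) c"
  shows "mon_val n c k * (-1) ^ inversion_sum n w (Poly_Mapping.lookup k) = 1"
proof -
  \<comment> \<open>Column \<open>0\<close> exists because \<open>n > 0\<close>.\<close>
  define s where "s j = (if j = 0 then of_int (sign w) else 1 :: complex)" for j :: nat
  have prod_s: "(\<Prod>j<n. s j) = of_int (sign w)"
    using n by (simp add: s_def)
  have "s j ^ m = 1" for j
    using m by (simp add: s_def sign_even_power)
  then have "admissible m q n 1 (\<lambda>j. s j * c j)"
    using c prod_s by (simp add: admissible_def power_mult_distrib prod.distrib)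
  then have "mon_val n s k * mon_val n c k = 1"
    using k by (simp add: balanced_def flip: mon_val_mult)
  moreover have "mon_val n s k = of_int (sign w) ^ Poly_Mapping.lookup k 0"
  proof -
    have "mon_val n s k = (\<Prod>j<n. if j = 0 then of_int (sign w) ^ Poly_Mapping.lookup k 0 else 1)"
      unfolding mon_val_def s_def by (intro prod.cong) auto
    then show ?thesis
      using n by simp
  qed
  ultimately show ?thesis
    unfolding balanced_inversion_sign[OF k m n w] by (simp add: mult.commute)
qed

lemma diagonal_invariant_imp_balanced:
  assumes f: "f \<in> S_space n"
    and inv: "\<And>c. admissible m q n 1 c \<Longrightarrow> lext (\<lambda>k. Poly_Mapping.single k (mon_val n c k)) f = f"
    and k: "k \<in> Poly_Mapping.keys f"
  shows "balanced m q n k"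
  unfolding balanced_def
proof (intro allI impI)
  fix c assume "admissible m q n 1 c"
  then have "Poly_Mapping.lookup f k * mon_val n c k = Poly_Mapping.lookup f k"
    using inv lookup_diagonal[of "mon_val n c" f k] by simp
  then show "mon_val n c k = 1"
    using k by (simp add: in_keys_iff)
qed

lemma balanced_action:
  assumes f: "f \<in> S_space n" and bal: "\<And>k. k \<in> Poly_Mapping.keys f \<Longrightarrow> balanced m q n k"
    and w: "w permutes {..<n}"
  shows "admissible m q n 1 c \<Longrightarrow> mat_action (Sym n) n (mono_mat n w c) f = permute_poly w f"
    and "even m \<Longrightarrow> n > 0 \<Longrightarrow> admissible m q n (of_int (sign w)) c \<Longrightarrow>
      mat_action (Skew n) n (mono_mat n w c) f = permute_poly w f"
proof -
  have f_lext: "f = lext grp f"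
    by (rule lext_id[symmetric])
  have mon: "k \<in> monomials n" if "k \<in> Poly_Mapping.keys f" for k
    using that f by (auto simp: S_space_iff)
  show "mat_action (Sym n) n (mono_mat n w c) f = permute_poly w f" if "admissible m q n 1 c"
  proof -
    have "mat_action (Sym n) n (mono_mat n w c) (lext grp f) = permute_poly w f"
      unfolding mat_action_lext permute_poly_def using that bal mon
      by (intro lext_cong) (simp add: Sym_action_single[OF w] balanced_def)
    then show ?thesis
      using f_lext by simp
  qed
  show "mat_action (Skew n) n (mono_mat n w c) f = permute_poly w f"
    if "even m" "n > 0" "admissible m q n (of_int (sign w)) c"
  proof -
    have "mat_action (Skew n) n (mono_mat n w c) (lext grp f) = permute_poly w f"
      unfolding mat_action_lext permute_poly_def
      by (intro lext_cong) (simp add: Skew_action_single[OF w mon] balanced_Skew_coefficient[OF bal that(1,2) w that(3)])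
    then show ?thesis
      using f_lext by simp
  qed
qed

text \<open>
  This description of the invariants also holds for \<open>W\<close> acting on \<open>S\<^sub>-\<^sub>1(V)\<close>. Every permutation must
  fix \<open>f\<close> because the permutation matrices belong to \<open>G\<close>.
\<close>

lemma pos_invariants_Sym_iff:
  assumes m: "m > 0"
  shows "f \<in> pos_invariants (Sym n) n (G_group m p n) \<longleftrightarrow>
    f \<in> S_space n \<and> (\<exists>d>0. homogeneous d f) \<and> (\<forall>k\<in>Poly_Mapping.keys f. balanced m (m div p) n k) \<and>
    (\<forall>w. w permutes {..<n} \<longrightarrow> permute_poly w f = f)" (is "_ \<longleftrightarrow> ?rhs")
proof
  assume "f \<in> pos_invariants (Sym n) n (G_group m p n)"
  then have f: "f \<in> S_space n" "\<exists>d>0. homogeneous d f"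
    and inv: "\<And>g. g \<in> carrier (G_group m p n) \<Longrightarrow> mat_action (Sym n) n g f = f"
    by (simp_all add: pos_invariants_def Sym_def)
  have bal: "balanced m (m div p) n k" if "k \<in> Poly_Mapping.keys f" for k
    using inv mono_mat_in_G[OF m permutes_id]
    by (intro diagonal_invariant_imp_balanced[OF f(1) _ that]) (simp add: diagonal_action(1)[OF f(1), symmetric])
  have "permute_poly w f = f" if w: "w permutes {..<n}" for w
  proof -
    have "admissible m (m div p) n 1 (\<lambda>_. 1)"
      by (simp add: admissible_def)
    then show ?thesis
      using balanced_action(1)[OF f(1) bal w] inv mono_mat_in_G[OF m w] by metis
  qed
  then show ?rhs
    using f bal by blast
next
  assume R: ?rhs
  have "mat_action (Sym n) n g f = f" if g: "g \<in> carrier (G_group m p n)" for g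
  proof -
    obtain w c where wc: "w permutes {..<n}" "admissible m (m div p) n 1 c" "g = mono_mat n w c"
      using m g by (rule G_groupE)
    then show ?thesis
      using R balanced_action(1)[of f n m "m div p" w c] by metis
  qed
  with R show "f \<in> pos_invariants (Sym n) n (G_group m p n)"
    by (simp add: pos_invariants_def Sym_def)
qed

text \<open>
  A permutation matrix need not have an admissible determinant, but it does after its column \<open>0\<close> has
  been multiplied by the sign of the permutation.
\<close>

lemma pos_invariants_Skew_iff:
  assumes m: "m > 0" "even m" and n: "n > 0"
  shows "f \<in> pos_invariants (Skew n) n (W_group m p n) \<longleftrightarrow>
    f \<in> S_space n \<and> (\<exists>d>0. homogeneous d f) \<and> (\<forall>k\<in>Poly_Mapping.keys f. balanced m (m div p) n k) \<and>
    (\<forall>w. w permutes {..<n} \<longrightarrow> permute_poly w f = f)" (is "_ \<longleftrightarrow> ?rhs")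
proof
  assume "f \<in> pos_invariants (Skew n) n (W_group m p n)"
  then have f: "f \<in> S_space n" "\<exists>d>0. homogeneous d f"
    and inv: "\<And>g. g \<in> carrier (W_group m p n) \<Longrightarrow> mat_action (Skew n) n g f = f"
    by (simp_all add: pos_invariants_def Skew_def Sym_def)
  have bal: "balanced m (m div p) n k" if "k \<in> Poly_Mapping.keys f" for k
    using inv mono_mat_in_W[OF m(1) permutes_id]
    by (intro diagonal_invariant_imp_balanced[OF f(1) _ that]) (simp add: diagonal_action(2)[OF f(1), symmetric] sign_id)
  have "permute_poly w f = f" if w: "w permutes {..<n}" for w
  proof -
    define c :: "nat \<Rightarrow> complex" where "c j = (if j = 0 then of_int (sign w) else 1)" for j
    have "(\<Prod>j<n. c j) = of_int (sign w)"
      using n by (simp add: c_def)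
    then have "admissible m (m div p) n (of_int (sign w)) c"
      using m by (simp add: admissible_def c_def sign_even_power sign_squared)
    then show ?thesis
      using balanced_action(2)[OF f(1) bal w m(2) n] inv mono_mat_in_W[OF m(1) w] by metis
  qed
  then show ?rhs
    using f bal by blast
next
  assume R: ?rhs
  have "mat_action (Skew n) n g f = f" if g: "g \<in> carrier (W_group m p n)" for g
  proof -
    obtain w c where wc: "w permutes {..<n}" "admissible m (m div p) n (of_int (sign w)) c" "g = mono_mat n w c"
      using m(1) g by (rule W_groupE)
    then show ?thesis
      using R m(2) n balanced_action(2)[of f n m "m div p" w c] by metis
  qed
  with R show "f \<in> pos_invariants (Skew n) n (W_group m p n)"
    by (simp add: pos_invariants_def Skew_def Sym_def)
qed

text \<open>
  If \<open>f\<close> is invariant, then \<open>g t f = t (t g t) f = t f\<close>, since \<open>t\<close> is an involution normalising \<open>G\<close>.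
\<close>

lemma T_stable_pos_invariants:
  assumes m: "m > 0" "even m"
  shows "T_stable n (pos_invariants (Sym n) n (G_group m p n))"
  unfolding T_stable_def
proof (intro ballI)
  fix t f assume t: "t \<in> carrier (T_group n)" and "f \<in> pos_invariants (Sym n) n (G_group m p n)"
  then have f: "f \<in> S_space n" "\<exists>d>0. homogeneous d f"
    and inv: "\<And>g. g \<in> carrier (G_group m p n) \<Longrightarrow> mat_action (Sym n) n g f = f"
    by (simp_all add: pos_invariants_def Sym_def)
  obtain e where e: "signs e" "t = mono_mat n id e"
    using t by (rule T_groupE)
  have "mat_action (Sym n) n g (mat_action (Sym n) n t f) = mat_action (Sym n) n t f"
    if g: "g \<in> carrier (G_group m p n)" for g
  proof -
    obtain w c where wc: "w permutes {..<n}" "g = mono_mat n w c"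
      using m(1) g by (rule G_groupE)
    have carr: "t \<in> carrier_mat n n" "g \<in> carrier_mat n n"
      by (simp_all add: e wc)
    have "t * (t * g * t) = (t * t) * (g * t)"
      using carr by (simp add: assoc_mult_mat[of _ n n _ n _ n])
    also have "\<dots> = g * t"
      using carr sign_mat_square[OF e(1)] by (simp add: e(2))
    finally have gt: "g * t = t * (t * g * t)" ..
    have "mat_action (Sym n) n (g * t) f = mat_action (Sym n) n t (mat_action (Sym n) n (t * g * t) f)"
      by (subst gt, simp only: e(2) wc(2) sign_conj_mono_mat[OF wc(1)])
        (rule Sym_action_mult[OF wc(1) permutes_id f(1)])
    also have "\<dots> = mat_action (Sym n) n t f"
      using inv[OF T_conj_in_G[OF m t g]] by simp
    finally show ?thesis
      unfolding e(2) wc(2) Sym_action_mult[OF permutes_id wc(1) f(1)] .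
  qed
  moreover have "\<exists>d>0. homogeneous d (mat_action (Sym n) n t f)"
    using f(2) T_action_keys[OF t f(1)] unfolding homogeneous_def by blast
  ultimately show "mat_action (Sym n) n t f \<in> pos_invariants (Sym n) n (G_group m p n)"
    using T_action_closed[OF t f(1)] by (simp add: pos_invariants_def Sym_def)
qed

lemma pos_invariants_subset: "pos_invariants (Sym n) n H \<subseteq> S_space n"
  by (auto simp: pos_invariants_def Sym_def)

theorem I_G_eq_I_W:
  assumes "m > 0" "even m" "n > 0"
  shows "I_G m p n = I_W m p n"
proof -
  have "pos_invariants (Skew n) n (W_group m p n) = pos_invariants (Sym n) n (G_group m p n)"
    unfolding set_eq_iff pos_invariants_Sym_iff[OF assms(1)] pos_invariants_Skew_iff[OF assms] by simp
  then show ?thesis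
    unfolding I_G_def I_W_def coinvariant_ideal_def
    using genideal_Skew_eq_Sym[OF pos_invariants_subset T_stable_pos_invariants] assms by simp
qed

section \<open>Quotient algebras\<close>

definition coset :: "polynomial set \<Rightarrow> polynomial \<Rightarrow> polynomial set" where
  "coset J f = (\<lambda>j. j + f) ` J"

lemma a_r_coset_twisted_poly: "J +>\<^bsub>twisted_poly \<beta> n\<^esub> f = coset J f"
  by (auto simp: a_r_coset_def' coset_def)

lemma quotient_algebra_simps:
  "carrier (quotient_algebra A J) = a_rcosets\<^bsub>A\<^esub> J"
  "X \<otimes>\<^bsub>quotient_algebra A J\<^esub> Y = rcoset_mult A J X Y"
  "\<one>\<^bsub>quotient_algebra A J\<^esub> = J +>\<^bsub>A\<^esub> \<one>\<^bsub>A\<^esub>"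
  "\<zero>\<^bsub>quotient_algebra A J\<^esub> = J"
  "X \<oplus>\<^bsub>quotient_algebra A J\<^esub> Y = X <+>\<^bsub>A\<^esub> Y"
  "c \<odot>\<^bsub>quotient_algebra A J\<^esub> X = (\<Union>x\<in>X. J +>\<^bsub>A\<^esub> (c \<odot>\<^bsub>A\<^esub> x))"
  by (simp_all add: quotient_algebra_def FactRing_def ring.defs module.defs)

context bicharacter
begin

context
  fixes n :: nat and J :: "polynomial set"
  assumes J: "ideal J (twisted_poly \<beta> n)"
begin

abbreviation Q where "Q \<equiv> quotient_algebra (twisted_poly \<beta> n) J"

lemma coset_eqI:
  assumes fh: "f - h \<in> J"
  shows "coset J f = coset J h"
proof -
  have add: "x + y \<in> J" if "x \<in> J" "y \<in> J" for x y
    using J that by (simp add: ideal_iff)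
  have sub: "coset J f \<subseteq> coset J h" if "f - h \<in> J" for f h
  proof
    fix x assume "x \<in> coset J f"
    then obtain j where "j \<in> J" "x = j + f"
      unfolding coset_def by blast
    then have "x = (j + (f - h)) + h" "j + (f - h) \<in> J"
      using add that by simp_all
    then show "x \<in> coset J h"
      unfolding coset_def by blast
  qed
  have "h - f \<in> J"
    using ideal_scale[OF J fh, of "-1"] by simp
  then show ?thesis
    using sub fh by blast
qed

lemma carrier_Q: "carrier Q = coset J ` S_space n"
  by (auto simp: quotient_algebra_simps A_RCOSETS_def' a_r_coset_twisted_poly)

lemma one_Q: "\<one>\<^bsub>Q\<^esub> = coset J 1"
  by (simp add: quotient_algebra_simps a_r_coset_twisted_poly)

lemma zero_Q: "\<zero>\<^bsub>Q\<^esub> = coset J 0"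
  by (simp add: quotient_algebra_simps coset_def)

lemma add_Q:
  assumes "f \<in> S_space n" "h \<in> S_space n"
  shows "coset J f \<oplus>\<^bsub>Q\<^esub> coset J h = coset J (f + h)"
proof -
  interpret ideal J "twisted_poly \<beta> n" by (rule J)
  show ?thesis
    using a_rcos_sum[of f h] assms by (simp add: quotient_algebra_simps a_r_coset_twisted_poly)
qed

lemma mult_Q:
  assumes "f \<in> S_space n" "h \<in> S_space n"
  shows "coset J f \<otimes>\<^bsub>Q\<^esub> coset J h = coset J (tmult f h)"
proof -
  interpret ideal J "twisted_poly \<beta> n" by (rule J)
  show ?thesis
    using rcoset_mult_add[of f h] assms by (simp add: quotient_algebra_simps a_r_coset_twisted_poly)
qed

lemma smult_Q:
  assumes "f \<in> S_space n"
  shows "c \<odot>\<^bsub>Q\<^esub> coset J f = coset J (scale c f)"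
proof -
  have "coset J (scale c x) = coset J (scale c f)" if x: "x \<in> coset J f" for x
  proof -
    obtain j where "j \<in> J" "x = j + f"
      using x unfolding coset_def by blast
    then show ?thesis
      using ideal_scale[OF J, of j c] by (intro coset_eqI) (simp add: pm.scale_right_distrib)
  qed
  then have "(\<Union>x\<in>coset J f. coset J (scale c x)) = (\<Union>x\<in>coset J f. coset J (scale c f))"
    by (intro SUP_cong refl)
  moreover have "coset J f \<noteq> {}"
    using J by (auto simp: coset_def ideal_iff)
  ultimately show ?thesis
    by (simp add: quotient_algebra_simps a_r_coset_twisted_poly)
qed

lemma abelian_monoid_Q: "abelian_monoid Q"
  by (rule abelian_monoidI) (auto simp: carrier_Q add_Q S_space_add add_ac zero_Q)

lemma finsum_Q:
  assumes "\<And>x. x \<in> A \<Longrightarrow> X x = coset J (F x)" "\<And>x. x \<in> A \<Longrightarrow> F x \<in> S_space n"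
  shows "finsum Q X A = coset J (sum F A)"
proof -
  interpret abelian_monoid Q by (rule abelian_monoid_Q)
  have "(\<forall>x\<in>A. X x = coset J (F x) \<and> F x \<in> S_space n) \<Longrightarrow> finsum Q X A = coset J (sum F A)"
  proof (induction A rule: infinite_finite_induct)
    case (insert x A)
    then have "X x \<in> carrier Q" "X \<in> A \<rightarrow> carrier Q"
      by (auto simp: carrier_Q)
    then have "finsum Q X (insert x A) = X x \<oplus>\<^bsub>Q\<^esub> finsum Q X A"
      using insert.hyps by simp
    then show ?case
      using insert by (simp add: add_Q S_space_sum)
  qed (simp_all add: zero_Q)
  then show ?thesis
    using assms by blast
qed

lemma linear_combination_Q:
  assumes "\<And>x. x \<in> Poly_Mapping.keys a \<Longrightarrow> X x = coset J (F x)"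
    and "\<And>x. x \<in> Poly_Mapping.keys a \<Longrightarrow> F x \<in> S_space n"
  shows "(\<Oplus>\<^bsub>Q\<^esub>x\<in>Poly_Mapping.keys a. Poly_Mapping.lookup a x \<odot>\<^bsub>Q\<^esub> X x) = coset J (lext F a)"
  unfolding lext_def by (rule finsum_Q) (simp_all add: assms smult_Q S_space_scale)

end

end

text \<open>
  The hypothesis is an equality because \<open>coset_action\<close> takes the image of a coset as a set: if \<open>J\<close> were
  mapped onto a proper subspace, the image would not be a coset.
\<close>

lemma mat_action_coset:
  assumes surj: "mat_action A n g ` J = J"
  shows "coset_action A n g (coset J f) = coset J (mat_action A n g f)"
proof -
  have "coset_action A n g (coset J f) = (\<lambda>j. j + mat_action A n g f) ` (mat_action A n g ` J)"
    by (simp add: coset_action_def coset_def mat_action_add image_image)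
  then show ?thesis
    by (simp add: surj coset_def)
qed

section \<open>The quotient by the coinvariant ideal\<close>

locale reflection_pair =
  fixes m p n :: nat
  assumes m: "m > 0" "even m" and n: "n > 0"
begin

abbreviation "G \<equiv> G_group m p n"
abbreviation "W \<equiv> W_group m p n"
abbreviation "I \<equiv> I_G m p n"

lemma ideal_Sym: "ideal I (twisted_poly (\<lambda>_ _. 1) n)"
proof -
  interpret ring "Sym n"
    unfolding Sym_eq_twisted_poly by (rule trivial.twisted_poly_ring)
  have "ideal I (Sym n)"
    unfolding I_G_def coinvariant_ideal_def
    using pos_invariants_subset by (intro genideal_ideal) (simp add: Sym_eq_twisted_poly)
  then show ?thesis
    by (simp add: Sym_eq_twisted_poly)
qed

lemma T_stable_I: "T_stable n I"
  unfolding I_G_def coinvariant_ideal_def Sym_eq_twisted_poly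
  by (intro trivial.T_stable_genideal)
    (simp_all add: pos_invariants_subset T_stable_pos_invariants[OF m] flip: Sym_eq_twisted_poly)

lemma ideal_Skew: "ideal I (twisted_poly skew_sign n)"
  using ideal_Sym T_stable_I by (rule sym_to_skew.T_stable_ideal_twisted)

lemma I_subset: "I \<subseteq> S_space n"
  using ideal_Sym by (simp add: trivial.ideal_iff)

lemma S_G_eq: "S_G m p n = quotient_algebra (twisted_poly (\<lambda>_ _. 1) n) I"
  by (simp add: S_G_def Sym_eq_twisted_poly)

lemma S_W_eq: "S_W m p n = quotient_algebra (twisted_poly skew_sign n) I"
  using I_G_eq_I_W[OF m n] by (simp add: S_W_def Skew_eq_twisted_poly)

lemma Sym_action_tmult:
  assumes w: "w permutes {..<n}" and f: "f \<in> S_space n" and h: "h \<in> S_space n"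
  shows "mat_action (Sym n) n (mono_mat n w c) (trivial.tmult f h) =
    trivial.tmult (mat_action (Sym n) n (mono_mat n w c) f) (mat_action (Sym n) n (mono_mat n w c) h)"
  using f
proof (induction rule: S_space_linear_induct)
  case (single k a)
  show ?case using h
  proof (induction rule: S_space_linear_induct)
    case (single l b)
    then show ?case
      using \<open>k \<in> monomials n\<close>
      by (simp add: Sym_action_single[OF w] add_in_monomials mon_val_add map_key_plus inj_inv_permutes[OF w] ac_simps)
  qed (simp_all add: bil_add_right mat_action_add)
qed (simp_all add: bil_add_left mat_action_add)

text \<open>
  Elements of \<open>G\<close> act by automorphisms of \<open>S(V)\<close> and fix the generators of \<open>I\<close>.
\<close>

lemma G_action_I:
  assumes g: "g \<in> carrier G" and f: "f \<in> I"
  shows "mat_action (Sym n) n g f \<in> I"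
proof -
  interpret ring "twisted_poly (\<lambda>_ _. 1) n" by (rule trivial.twisted_poly_ring)
  obtain w c where wc: "w permutes {..<n}" "g = mono_mat n w c"
    using m(1) g by (rule G_groupE)
  define J where "J = {f \<in> S_space n. mat_action (Sym n) n g f \<in> I}"
  have "ideal J (twisted_poly (\<lambda>_ _. 1) n)"
    using ideal_Sym Sym_action_closed[OF wc(1)]
    by (auto simp: trivial.ideal_iff J_def wc(2) S_space_add trivial.tmult_closed mat_action_add Sym_action_tmult[OF wc(1)])
  moreover have "pos_invariants (Sym n) n G \<subseteq> J"
  proof
    fix h assume h: "h \<in> pos_invariants (Sym n) n G"
    then have "h \<in> S_space n" "mat_action (Sym n) n g h = h"
      using g by (simp_all add: pos_invariants_def Sym_def)
    moreover have "h \<in> I"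
      using h genideal_self[of "pos_invariants (Sym n) n G"] pos_invariants_subset
      by (auto simp: I_G_def coinvariant_ideal_def Sym_eq_twisted_poly)
    ultimately show "h \<in> J"
      by (simp add: J_def)
  qed
  ultimately have "I \<subseteq> J"
    unfolding I_G_def coinvariant_ideal_def Sym_eq_twisted_poly by (rule genideal_minimal)
  then show ?thesis
    using f by (auto simp: J_def)
qed

lemma T_action_coset:
  assumes t: "t \<in> carrier (T_group n)"
  shows "coset_action (Sym n) n t (coset I f) = coset I (mat_action (Sym n) n t f)"
proof (rule mat_action_coset, rule)
  obtain e where e: "signs e" "t = mono_mat n id e"
    using t by (rule T_groupE)
  show sub: "mat_action (Sym n) n t ` I \<subseteq> I"
    using T_stable_I t by (auto simp: T_stable_def)
  show "I \<subseteq> mat_action (Sym n) n t ` I"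
  proof
    fix f assume f: "f \<in> I"
    then have "f \<in> S_space n"
      using I_subset by auto
    then have "mat_action (Sym n) n t (mat_action (Sym n) n t f) = f"
      using Sym_action_mult[OF permutes_id permutes_id, of f n e e] T_action_one[of f n]
      by (simp only: e(2) sign_mat_square[OF e(1)])
    moreover have "mat_action (Sym n) n t f \<in> I"
      using sub f by auto
    ultimately show "f \<in> mat_action (Sym n) n t ` I"
      by (metis imageI)
  qed
qed

lemma same_algebra_S_W_S_G_twisted: "same_algebra (S_W m p n) (S_G_twisted m p n)"
proof -
  have mult: "coset I f \<otimes>\<^bsub>S_W m p n\<^esub> coset I h = coset I f \<otimes>\<^bsub>S_G_twisted m p n\<^esub> coset I h"
    if f: "f \<in> S_space n" and h: "h \<in> S_space n" for f h
  proof -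
    have "coset_action (Sym n) n (fst st) (coset I f) \<otimes>\<^bsub>S_G m p n\<^esub> coset_action (Sym n) n (snd st) (coset I h) =
        coset I (trivial.tmult (mat_action (Sym n) n (fst st) f) (mat_action (Sym n) n (snd st) h))"
      if "st \<in> Poly_Mapping.keys (twist n)" for st
      unfolding T_action_coset[OF twist_keysD(1)[OF that]] T_action_coset[OF twist_keysD(2)[OF that]] S_G_eq
      by (intro trivial.mult_Q[OF ideal_Sym] T_action_closed twist_keysD[OF that] f h)
    then have "coset I f \<otimes>\<^bsub>S_G_twisted m p n\<^esub> coset I h =
        coset I (lext (\<lambda>st. trivial.tmult (mat_action (Sym n) n (fst st) f) (mat_action (Sym n) n (snd st) h)) (twist n))"
      unfolding S_G_twisted_def cocycle_twist_def tensor_apply_def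
      using trivial.linear_combination_Q[OF ideal_Sym, of "twist n",
          OF _ trivial.tmult_closed[OF T_action_closed[OF twist_keysD(1) f] T_action_closed[OF twist_keysD(2) h]]]
      by (simp add: S_G_eq)
    also have "\<dots> = coset I f \<otimes>\<^bsub>S_W m p n\<^esub> coset I h"
      unfolding S_W_eq skew.mult_Q[OF ideal_Skew f h] sym_to_skew.tmult_twisted[OF f h] ..
    finally show ?thesis ..
  qed
  have "carrier (S_G_twisted m p n) = coset I ` S_space n" "carrier (S_W m p n) = coset I ` S_space n"
    by (simp_all add: S_G_twisted_def cocycle_twist_def S_G_eq S_W_eq trivial.carrier_Q[OF ideal_Sym] skew.carrier_Q[OF ideal_Skew])
  then show ?thesis
    unfolding same_algebra_def
    by (auto simp: mult)
      (auto simp: S_G_twisted_def cocycle_twist_def S_G_eq S_W_eq trivial.one_Q[OF ideal_Sym] skew.one_Q[OF ideal_Skew]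
        trivial.zero_Q[OF ideal_Sym] skew.zero_Q[OF ideal_Skew] trivial.add_Q[OF ideal_Sym] skew.add_Q[OF ideal_Skew]
        trivial.smult_Q[OF ideal_Sym] skew.smult_Q[OF ideal_Skew])
qed

end

section \<open>The twisted group algebra acts on polynomials\<close>

lemma conj_action_eq:
  assumes "t \<in> carrier (T_group n)"
  shows "conj_action n t = lext (\<lambda>g. grp (t * g * t))"
proof -
  obtain e where e: "signs e" "t = mono_mat n id e"
    using assms by (rule T_groupE)
  have "inv\<^bsub>GL n\<^esub> t = t"
    unfolding e(2) by (rule sign_mat_inv[OF e(1)])
  then show ?thesis
    by (simp add: conj_action_def lext_def fun_eq_iff)
qed

definition group_action :: "nat \<Rightarrow> (complex mat \<Rightarrow>\<^sub>0 complex) \<Rightarrow> polynomial \<Rightarrow> polynomial" where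
  "group_action n a f = lext (\<lambda>g. mat_action (Sym n) n g f) a"

text \<open>
  The Giaquinto-Zhang twist on the level of polynomials, before passing to \<open>S/I\<close>. The conjugation action
  on the group algebra is written \<open>t g t\<close>, elements of \<open>T\<close> being involutions.
\<close>

definition twisted_action :: "nat \<Rightarrow> (complex mat \<Rightarrow>\<^sub>0 complex) \<Rightarrow> polynomial \<Rightarrow> polynomial" where
  "twisted_action n a f = lext (\<lambda>st.
     group_action n (lext (\<lambda>g. grp (fst st * g * fst st)) a) (mat_action (Sym n) n (snd st) f)) (twist n)"

definition twisted_mult ::
  "nat \<Rightarrow> (complex mat \<Rightarrow>\<^sub>0 complex) \<Rightarrow> (complex mat \<Rightarrow>\<^sub>0 complex) \<Rightarrow> (complex mat \<Rightarrow>\<^sub>0 complex)" where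
  "twisted_mult n a b = lext (\<lambda>st. bil (\<lambda>g h. grp (g * h))
     (lext (\<lambda>g. grp (fst st * g * fst st)) a) (lext (\<lambda>g. grp (snd st * g * snd st)) b)) (twist n)"

lemma lext_fun_zero [simp]: "lext (\<lambda>_. 0) a = 0"
  by (simp add: lext_def)

lemma twisted_action_linear:
  "twisted_action n 0 f = 0" "twisted_action n a 0 = 0"
  "twisted_action n (a + b) f = twisted_action n a f + twisted_action n b f"
  "twisted_action n a (f + h) = twisted_action n a f + twisted_action n a h"
  "twisted_action n (scale c a) f = scale c (twisted_action n a f)"
  "twisted_action n a (scale c f) = scale c (twisted_action n a f)"
  by (simp_all add: twisted_action_def group_action_def lext_add lext_scale lext_fun_add lext_fun_scale
      mat_action_add mat_action_scale)

lemma twisted_action_lext: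
  fixes a :: "'x \<Rightarrow>\<^sub>0 complex"
  shows "twisted_action n (lext F a) f = lext (\<lambda>x. twisted_action n (F x) f) a"
proof -
  have "twisted_action n (sum H A) f = (\<Sum>x\<in>A. twisted_action n (H x) f)" for H and A :: "'x set"
    by (induction A rule: infinite_finite_induct) (simp_all add: twisted_action_linear)
  then show ?thesis
    by (simp add: lext_def twisted_action_linear)
qed

lemma twisted_mult_linear:
  "twisted_mult n 0 b = 0" "twisted_mult n a 0 = 0"
  "twisted_mult n (a + a') b = twisted_mult n a b + twisted_mult n a' b"
  "twisted_mult n a (b + b') = twisted_mult n a b + twisted_mult n a b'"
  by (simp_all add: twisted_mult_def lext_add bil_add_left bil_add_right lext_fun_add)

text \<open>
  On \<open>x\<^sup>k\<close> the matrix \<open>s g s\<close> differs from \<open>g\<close> by the values of \<open>s\<close> at \<open>k\<close> and at \<open>wk\<close>, hence by its value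
  at \<open>k + wk\<close>; the second tensor factor contributes its value at \<open>k\<close>.
\<close>

lemma twisted_action_single:
  assumes w: "w permutes {..<n}" and k: "k \<in> monomials n"
  shows "twisted_action n (Poly_Mapping.single (mono_mat n w d) x) (Poly_Mapping.single k c) =
    Poly_Mapping.single (permute_mon w k) (skew_sign (k + permute_mon w k) k * (x * c * mon_val n d k))"
proof -
  have wk: "permute_mon w k \<in> monomials n"
    by (rule permute_mon_in_monomials[OF w k])
  have "twisted_action n (Poly_Mapping.single (mono_mat n w d) x) (Poly_Mapping.single k c) =
    lext (\<lambda>st. Poly_Mapping.single (permute_mon w k)
      (diag_val n (fst st) (k + permute_mon w k) * diag_val n (snd st) k * (x * c * mon_val n d k))) (twist n)"
    unfolding twisted_action_def
  proof (rule lext_cong)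
    fix st assume "st \<in> Poly_Mapping.keys (twist n)"
    then have T: "fst st \<in> carrier (T_group n)" "snd st \<in> carrier (T_group n)"
      by (rule twist_keysD)+
    obtain e where e: "fst st = mono_mat n id e"
      using T(1) by (rule T_groupE)
    have "mon_val n (\<lambda>j. e (w j) * d j * e j) k = diag_val n (fst st) (k + permute_mon w k) * mon_val n d k"
      by (simp only: e diag_val_mono_mat mon_val_add mon_val_mult mon_val_permute[OF w] ac_simps)
    then show "group_action n (lext (\<lambda>g. grp (fst st * g * fst st)) (Poly_Mapping.single (mono_mat n w d) x))
        (mat_action (Sym n) n (snd st) (Poly_Mapping.single k c)) =
      Poly_Mapping.single (permute_mon w k)
        (diag_val n (fst st) (k + permute_mon w k) * diag_val n (snd st) k * (x * c * mon_val n d k))"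
      by (simp add: group_action_def T_action_single[OF T(2) k] e sign_conj_mono_mat[OF w] Sym_action_single[OF w k]
          ac_simps)
  qed
  then show ?thesis
    using lext_twist[OF add_in_monomials[OF k wk] k] by simp
qed

text \<open>
  Let \<open>g\<close> and \<open>h\<close> have permutations \<open>w\<close> and \<open>v\<close>. Applied to \<open>x\<^sup>k\<close>, the left-hand side has the sign
  \<open>\<epsilon>(k + wvk, k) \<epsilon>(vk + wvk, vk + k)\<close> and the right-hand side \<open>\<epsilon>(k + vk, k) \<epsilon>(vk + wvk, vk)\<close>. By
  bimultiplicativity they differ by the factor \<open>\<epsilon>(wvk, k)\<^sup>2 = 1\<close>.
\<close>

lemma twisted_action_mult:
  assumes a: "Poly_Mapping.keys a \<subseteq> {g. monomial_mat n g}" and b: "Poly_Mapping.keys b \<subseteq> {g. monomial_mat n g}"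
    and f: "f \<in> S_space n"
  shows "twisted_action n (twisted_mult n a b) f = twisted_action n a (twisted_action n b f)"
  using a
proof (induction rule: poly_mapping_linear_induct)
  case (single g x)
  obtain w d where w: "w permutes {..<n}" and g: "g = mono_mat n w d"
    using single monomial_matE by blast
  show ?case using b
  proof (induction rule: poly_mapping_linear_induct)
    case (single h y)
    obtain v d' where v: "v permutes {..<n}" and h: "h = mono_mat n v d'"
      using single monomial_matE by blast
    define u where "u = w \<circ> v"
    have u: "u permutes {..<n}" "permute_mon u k = permute_mon w (permute_mon v k)" for k
      unfolding u_def by (rule permutes_compose[OF v w], rule permute_mon_comp[OF v w])
    show ?case using f
    proof (induction rule: S_space_linear_induct)
      case (single k c)
      define vk where "vk = permute_mon v k"
      define wvk where "wvk = permute_mon w vk"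
      have k: "k \<in> monomials n" "vk \<in> monomials n" "wvk \<in> monomials n"
        using single permute_mon_in_monomials v w by (auto simp: vk_def wvk_def)
      have uk: "permute_mon u k = wvk"
        by (simp add: u(2) vk_def wvk_def)
      define z where "z = x * y * c * mon_val n d vk * mon_val n d' k"
      have "twisted_action n (twisted_mult n (Poly_Mapping.single g x) (Poly_Mapping.single h y)) (Poly_Mapping.single k c) =
        lext (\<lambda>st. Poly_Mapping.single wvk
          (diag_val n (fst st) (vk + wvk) * diag_val n (snd st) (vk + k) * (skew_sign (k + wvk) k * z))) (twist n)"
        unfolding twisted_mult_def twisted_action_lext
      proof (rule lext_cong)
        fix st assume "st \<in> Poly_Mapping.keys (twist n)"
        then have T: "fst st \<in> carrier (T_group n)" "snd st \<in> carrier (T_group n)"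
          by (rule twist_keysD)+
        obtain e where e: "fst st = mono_mat n id e"
          using T(1) by (rule T_groupE)
        obtain e' where e': "snd st = mono_mat n id e'"
          using T(2) by (rule T_groupE)
        define D where "D j = (e (w (v j)) * d (v j) * e (v j)) * (e' (v j) * d' j * e' j)" for j
        have "fst st * g * fst st * (snd st * h * snd st) = mono_mat n u D"
          by (simp only: e e' g h sign_conj_mono_mat[OF w] sign_conj_mono_mat[OF v],
              simp only: mono_mat_mult[OF v] D_def[abs_def] u_def)
        then have "bil (\<lambda>g h. grp (g * h)) (lext (\<lambda>g. grp (fst st * g * fst st)) (Poly_Mapping.single g x))
            (lext (\<lambda>g. grp (snd st * g * snd st)) (Poly_Mapping.single h y)) =
          Poly_Mapping.single (mono_mat n u D) (x * y)"
          by simp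
        moreover have "mon_val n D k = diag_val n (fst st) (vk + wvk) * diag_val n (snd st) (vk + k) *
            (mon_val n d vk * mon_val n d' k)"
          by (simp only: D_def[abs_def] e e' diag_val_mono_mat mon_val_add mon_val_mult wvk_def vk_def mon_val_permute[OF w]
              mon_val_permute[OF v] ac_simps)
        ultimately show "twisted_action n (bil (\<lambda>g h. grp (g * h))
            (lext (\<lambda>g. grp (fst st * g * fst st)) (Poly_Mapping.single g x))
            (lext (\<lambda>g. grp (snd st * g * snd st)) (Poly_Mapping.single h y))) (Poly_Mapping.single k c) =
          Poly_Mapping.single wvk
            (diag_val n (fst st) (vk + wvk) * diag_val n (snd st) (vk + k) * (skew_sign (k + wvk) k * z))"
          by (simp add: twisted_action_single[OF u(1) k(1)] uk z_def ac_simps)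
      qed
      also have "\<dots> = Poly_Mapping.single wvk (skew_sign (vk + wvk) (vk + k) * (skew_sign (k + wvk) k * z))"
        by (intro lext_twist add_in_monomials k)
      also have "skew_sign (vk + wvk) (vk + k) * (skew_sign (k + wvk) k * z) =
          skew_sign (vk + wvk) vk * (skew_sign (k + vk) k * z) * (skew_sign wvk k * skew_sign wvk k)"
        by (simp only: skew.add_left skew.add_right ac_simps)
      also have "\<dots> = skew_sign (vk + wvk) vk * (skew_sign (k + vk) k * z)"
        by (simp only: skew_sign_square mult_1_right)
      also have "Poly_Mapping.single wvk \<dots> = twisted_action n (Poly_Mapping.single g x)
          (twisted_action n (Poly_Mapping.single h y) (Poly_Mapping.single k c))"
        unfolding g h twisted_action_single[OF v k(1)] vk_def[symmetric] twisted_action_single[OF w k(2)]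
          wvk_def[symmetric]
        by (simp add: z_def ac_simps)
      finally show ?case .
    qed (simp_all add: twisted_action_linear)
  qed (simp_all add: twisted_action_linear twisted_mult_linear)
qed (simp_all add: twisted_action_linear twisted_mult_linear)

section \<open>Comparison on the generators\<close>

lemma sigma_mat_eq:
  "Suc i < n \<Longrightarrow> sigma_mat n i = mono_mat n (transpose i (Suc i)) (\<lambda>j. if j = Suc i then -1 else 1)"
  by (intro eq_matI) (auto simp: sigma_mat_def transpose_def)

lemma sbar_mat_eq:
  "Suc i < n \<Longrightarrow> sbar_mat n i = mono_mat n (transpose i (Suc i)) (\<lambda>j. if j = i \<or> j = Suc i then -1 else 1)"
  by (intro eq_matI) (auto simp: sbar_mat_def transpose_def)

lemma lessThan_split_pair:
  assumes "Suc i < n"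
  shows "{..<n} = insert i (insert (Suc i) ({..<n} - {i, Suc i}))"
  using assms by auto

text \<open>
  Modulo \<open>2\<close> the vector \<open>k + sk\<close>, where \<open>s\<close> interchanges \<open>i\<close> and \<open>i + 1\<close>, vanishes outside these two
  positions and equals \<open>k\<^sub>i + k\<^bsub>i+1\<^esub>\<close> at both. The exponents below \<open>i\<close> are therefore counted twice, and
  only \<open>k\<^sub>i\<close>, which lies below \<open>i + 1\<close> but not below \<open>i\<close>, remains.
\<close>

lemma skew_sign_adjacent:
  assumes i: "Suc i < n" and k: "k \<in> monomials n"
  shows "skew_sign (k + permute_mon (transpose i (Suc i)) k) k =
    (-1) ^ ((Poly_Mapping.lookup k i + Poly_Mapping.lookup k (Suc i)) * Poly_Mapping.lookup k i)"
proof -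
  let ?t = "transpose i (Suc i)"
  let ?l = "Poly_Mapping.lookup k"
  have t: "?t permutes {..<n}"
    by (rule adjacent_permutes[OF i])
  define tk where "tk = permute_mon ?t k"
  have tk: "tk \<in> monomials n"
    unfolding tk_def by (rule permute_mon_in_monomials[OF t k])
  have lookup_t: "Poly_Mapping.lookup tk a = ?l (?t a)" for a
    unfolding tk_def by (subst lookup_permute_mon[OF t]) simp
  define S where "S a = (\<Sum>b\<in>{b \<in> {..<n}. b < a}. ?l b)" for a
  have S_Suc: "S (Suc i) = S i + ?l i"
  proof -
    have "{b \<in> {..<n}. b < Suc i} = insert i {b \<in> {..<n}. b < i}"
      using i by auto
    then show ?thesis
      by (simp add: S_def)
  qed
  have "skew_sign (k + tk) k = (-1) ^ (\<Sum>a<n. (?l a + ?l (?t a)) * S a)"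
    using add_in_monomials[OF k tk] k
    by (subst skew_sign_eq[of "{..<n}"]) (auto simp: monomials_def S_def lookup_add lookup_t sum_distrib_left)
  also have "(\<Sum>a<n. (?l a + ?l (?t a)) * S a) =
      (?l i + ?l (Suc i)) * ?l i + 2 * ((?l i + ?l (Suc i)) * S i + (\<Sum>a\<in>{..<n} - {i, Suc i}. ?l a * S a))"
  proof -
    have "(\<Sum>a<n. (?l a + ?l (?t a)) * S a) =
        (?l i + ?l (Suc i)) * S i + (?l (Suc i) + ?l i) * S (Suc i) +
        (\<Sum>a\<in>{..<n} - {i, Suc i}. (?l a + ?l (?t a)) * S a)"
      by (subst lessThan_split_pair[OF i]) simp
    moreover have "(\<Sum>a\<in>{..<n} - {i, Suc i}. (?l a + ?l (?t a)) * S a) = 2 * (\<Sum>a\<in>{..<n} - {i, Suc i}. ?l a * S a)"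
      unfolding sum_distrib_left by (intro sum.cong) (auto simp: transpose_def)
    ultimately show ?thesis
      by (simp add: S_Suc algebra_simps)
  qed
  finally show ?thesis
    unfolding tk_def by (simp add: power_add power_mult)
qed

lemma mon_val_pair:
  assumes i: "Suc i < n"
  shows "mon_val n (\<lambda>j. if j = i \<or> j = Suc i then -1 else 1) k = (-1) ^ (Poly_Mapping.lookup k i + Poly_Mapping.lookup k (Suc i))"
    and "mon_val n (\<lambda>j. if j = Suc i then -1 else 1) k = (-1) ^ Poly_Mapping.lookup k (Suc i)"
  unfolding mon_val_def using i
  by (subst lessThan_split_pair[OF i], simp add: power_add prod.neutral)+

text \<open>
  With \<open>a\<close> and \<open>b\<close> the exponents of \<open>x\<^sub>i\<close> and \<open>x\<^bsub>i+1\<^esub>\<close>, the matrix \<open>\<sigma>\<^sub>i\<close> produces the sign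
  \<open>(-1)\<close> to the power \<open>b + ab\<close>, namely \<open>b\<close> from its entry \<open>-1\<close> and \<open>ab\<close> from sorting, whereas the twisted
  action produces \<open>(a + b)a\<close> from the cocycle and \<open>a + b\<close> from the entries of the matrix with bar
  \<open>s\<^sub>i\<close>. The two exponents have the same parity.
\<close>

lemma sigma_action:
  assumes i: "Suc i < n" and f: "f \<in> S_space n"
  shows "mat_action (Skew n) n (sigma_mat n i) f = twisted_action n (grp (sbar_mat n i)) f"
  using f
proof (induction rule: S_space_linear_induct)
  case (single k c)
  let ?a = "Poly_Mapping.lookup k i" and ?b = "Poly_Mapping.lookup k (Suc i)"
  have t: "transpose i (Suc i) permutes {..<n}"
    by (rule adjacent_permutes[OF i])
  have "even ((?a + ?b) * ?a + (?a + ?b) + (?b + ?a * ?b))"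
    by (cases "even ?a"; cases "even ?b") simp_all
  then have eq: "(-1 :: complex) ^ ((?a + ?b) * ?a) * (-1) ^ (?a + ?b) = (-1) ^ ?b * (-1) ^ (?a * ?b)"
    unfolding power_add[symmetric] by (rule minus_one_power_even_sum)
  have "(-1) ^ ((?a + ?b) * ?a) * (1 * c * (-1) ^ (?a + ?b)) = c * ((-1) ^ ((?a + ?b) * ?a) * (-1) ^ (?a + ?b))"
    by (simp only: ac_simps mult_1)
  then show ?case
    unfolding sigma_mat_eq[OF i] sbar_mat_eq[OF i] Skew_action_single[OF t single] twisted_action_single[OF t single]
      skew_sign_adjacent[OF i single] mon_val_pair[OF i] inversion_sum_adjacent[OF i] by (simp only: eq)
qed (simp_all add: mat_action_add twisted_action_linear)

lemma diagonal_twisted_action: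
  assumes f: "f \<in> S_space n"
  shows "mat_action (Skew n) n (mono_mat n id c) f = twisted_action n (grp (mono_mat n id c)) f"
  using f
proof (induction rule: S_space_linear_induct)
  case (single k x)
  show ?case
    unfolding diagonal_action_single(2)[OF single] twisted_action_single[OF permutes_id single]
    by (simp add: skew.add_left skew_sign_square)
qed (simp_all add: mat_action_add twisted_action_linear)

section \<open>The intertwining property\<close>

lemma G_group_mult [simp]: "g \<otimes>\<^bsub>G_group m p n\<^esub> h = g * h"
  by (simp add: G_group_def)

lemma W_group_mult [simp]: "g \<otimes>\<^bsub>W_group m p n\<^esub> h = g * h"
  by (simp add: W_group_def)

text \<open>
  An element of \<open>G\<close> or \<open>W\<close> that maps \<open>I\<close> into itself maps it onto itself, because its inverse, which is
  again in the group, also maps \<open>I\<close> into itself.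
\<close>

lemma mono_mat_inverse:
  assumes w: "w permutes {..<n}" and c: "admissible m q n z c" and m: "m > 0" and z: "z * z = 1"
  obtains d where "admissible m q n z d" "mono_mat n w c * mono_mat n (Hilbert_Choice.inv w) d = 1\<^sub>m n"
proof
  define d where "d i = 1 / c (Hilbert_Choice.inv w i)" for i
  have w': "Hilbert_Choice.inv w permutes {..<n}"
    by (rule permutes_inv[OF w])
  have "(\<Prod>j<n. d j) = 1 / (\<Prod>j<n. c j)"
    using prod.permute[OF w', of "\<lambda>j. 1 / c j"] by (simp add: d_def comp_def prod_dividef)
  moreover have "z = 1 / z"
    using z by (metis divide_eq_eq mult_eq_0_iff zero_neq_one)
  ultimately have "z * (\<Prod>j<n. d j) = 1 / (z * (\<Prod>j<n. c j))"
    by (metis divide_divide_eq_left times_divide_eq_right mult.right_neutral)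
  then show "admissible m q n z d"
    using c perm_lt[OF w'] by (simp add: admissible_def power_one_over d_def)
  show "mono_mat n w c * mono_mat n (Hilbert_Choice.inv w) d = 1\<^sub>m n"
    unfolding mono_mat_mult[OF w'] one_mat_eq_mono_mat permutes_inv_o[OF w]
    using admissible_nonzero[OF c m] perm_lt[OF w'] by (intro mono_mat_cong) (simp add: d_def)
qed

context reflection_pair
begin

lemma G_action_image:
  assumes g: "g \<in> carrier G"
  shows "mat_action (Sym n) n g ` I = I"
proof
  show "mat_action (Sym n) n g ` I \<subseteq> I"
    using G_action_I[OF g] by blast
  obtain w c where wc: "w permutes {..<n}" "admissible m (m div p) n 1 c" "g = mono_mat n w c"
    using m(1) g by (rule G_groupE)
  obtain d where d: "admissible m (m div p) n 1 d" "mono_mat n w c * mono_mat n (Hilbert_Choice.inv w) d = 1\<^sub>m n"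
    using mono_mat_inverse[OF wc(1,2) m(1)] by auto
  have "f = mat_action (Sym n) n g (mat_action (Sym n) n (mono_mat n (Hilbert_Choice.inv w) d) f)" if "f \<in> S_space n" for f
    using Sym_action_mult[OF permutes_inv[OF wc(1)] wc(1) that, of c d] T_action_one[OF that]
    unfolding d(2) wc(3) by simp
  then show "I \<subseteq> mat_action (Sym n) n g ` I"
    using I_subset G_action_I[OF mono_mat_in_G[OF m(1) permutes_inv[OF wc(1)] d(1)]] by blast
qed

lemma Skew_action_one: "f \<in> S_space n \<Longrightarrow> mat_action (Skew n) n (1\<^sub>m n) f = f"
  unfolding one_mat_eq_mono_mat by (simp add: diagonal_action(2) lext_id)

lemma T_conj_carrier:
  assumes t: "t \<in> carrier (T_group n)" and a: "Poly_Mapping.keys a \<subseteq> carrier G"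
  shows "Poly_Mapping.keys (lext (\<lambda>g. grp (t * g * t)) a) \<subseteq> carrier G"
  by (rule keys_lext_subset) (use a T_conj_in_G[OF m t] in auto)

lemma G_monomial: "carrier G \<subseteq> {g. monomial_mat n g}"
  by (auto simp: G_group_def)

lemma CG_twisted_simps:
  "carrier (CG_twisted m p n) = {a. Poly_Mapping.keys a \<subseteq> carrier G}"
  "a \<oplus>\<^bsub>CG_twisted m p n\<^esub> b = a + b"
  "c \<odot>\<^bsub>CG_twisted m p n\<^esub> a = scale c a"
  by (simp_all add: CG_twisted_def cocycle_twist_def)

lemma CG_twisted_mult:
  assumes a: "Poly_Mapping.keys a \<subseteq> carrier G" and b: "Poly_Mapping.keys b \<subseteq> carrier G"
  shows "a \<otimes>\<^bsub>CG_twisted m p n\<^esub> b = twisted_mult n a b"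
proof -
  define F where "F st = bil (\<lambda>g h. grp (g * h))
     (lext (\<lambda>g. grp (fst st * g * fst st)) a) (lext (\<lambda>g. grp (snd st * g * snd st)) b)" for st
  have G_closed: "g * h \<in> carrier G" if gh: "g \<in> carrier G" "h \<in> carrier G" for g h
  proof -
    obtain w c where wc: "w permutes {..<n}" "admissible m (m div p) n 1 c" "g = mono_mat n w c"
      using m(1) gh(1) by (rule G_groupE)
    obtain v d where vd: "v permutes {..<n}" "admissible m (m div p) n 1 d" "h = mono_mat n v d"
      using m(1) gh(2) by (rule G_groupE)
    have "(\<Prod>j<n. c (v j)) = (\<Prod>j<n. c j)"
      using prod.permute[OF vd(1), of c] by (simp add: comp_def)
    then have "admissible m (m div p) n 1 (\<lambda>j. c (v j) * d j)"
      using wc(2) vd(2) perm_lt[OF vd(1)] by (simp add: admissible_def power_mult_distrib prod.distrib)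
    then show ?thesis
      unfolding wc(3) vd(3) mono_mat_mult[OF vd(1)]
      by (intro mono_mat_in_G m(1) permutes_compose[OF vd(1) wc(1)])
  qed
  have F_eq: "conj_action n (fst st) a \<otimes>\<^bsub>group_algebra G\<^esub> conj_action n (snd st) b = F st"
    and F_keys: "Poly_Mapping.keys (F st) \<subseteq> carrier G" if "st \<in> Poly_Mapping.keys (twist n)" for st
  proof -
    note T = twist_keysD[OF that]
    show "conj_action n (fst st) a \<otimes>\<^bsub>group_algebra G\<^esub> conj_action n (snd st) b = F st"
      unfolding conj_action_eq[OF T(1)] conj_action_eq[OF T(2)] F_def by simp
    show "Poly_Mapping.keys (F st) \<subseteq> carrier G"
      unfolding F_def using T_conj_carrier[OF T(1) a] T_conj_carrier[OF T(2) b]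
      by (intro keys_bil_subset) (auto intro!: G_closed)
  qed
  have "a \<otimes>\<^bsub>CG_twisted m p n\<^esub> b =
      finsum (group_algebra G) (\<lambda>st. scale (Poly_Mapping.lookup (twist n) st)
        (conj_action n (fst st) a \<otimes>\<^bsub>group_algebra G\<^esub> conj_action n (snd st) b)) (Poly_Mapping.keys (twist n))"
    by (simp add: CG_twisted_def cocycle_twist_def tensor_apply_def)
  also have "\<dots> = (\<Sum>st\<in>Poly_Mapping.keys (twist n). scale (Poly_Mapping.lookup (twist n) st)
        (conj_action n (fst st) a \<otimes>\<^bsub>group_algebra G\<^esub> conj_action n (snd st) b))"
    by (rule finsum_group_algebra) (use F_eq F_keys keys_scale_subset in \<open>fastforce simp del: group_algebra_simps\<close>)
  also have "\<dots> = lext F (twist n)"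
    unfolding lext_def by (intro sum.cong refl) (simp only: F_eq)
  finally show ?thesis
    by (simp add: twisted_mult_def F_def[abs_def])
qed

text \<open>
  The matrices \<open>\<sigma>\<^sub>i\<close> belong to \<open>W\<close> and realise the adjacent transpositions, so that splitting them off one
  by one leaves a diagonal matrix, which then lies in \<open>G\<close> too.
\<close>

lemma W_generated:
  assumes diagonal: "\<And>t. t \<in> carrier G \<Longrightarrow> diagonal_mat t \<Longrightarrow> P t"
    and sigma: "\<And>i. Suc i < n \<Longrightarrow> P (sigma_mat n i)"
    and mult: "\<And>g h. g \<in> carrier W \<Longrightarrow> h \<in> carrier W \<Longrightarrow> P g \<Longrightarrow> P h \<Longrightarrow> P (g * h)"
    and g: "g \<in> carrier W"
  shows "P g"
proof -
  obtain w c where "w permutes {..<n}" "admissible m (m div p) n (of_int (sign w)) c" "g = mono_mat n w c"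
    using m(1) g by (rule W_groupE)
  moreover have "\<forall>c. admissible m (m div p) n (of_int (sign w)) c \<longrightarrow> P (mono_mat n w c)"
    if "w permutes {..<n}" for w
    using that
  proof (induction rule: adjacent_induct)
    case id
    show ?case
    proof (intro allI impI)
      fix c assume "admissible m (m div p) n (of_int (sign (id :: nat \<Rightarrow> nat))) c"
      then have "mono_mat n id c \<in> carrier G"
        by (intro mono_mat_in_G m(1) permutes_id) (simp only: sign_id of_int_1)
      moreover have "diagonal_mat (mono_mat n id c)"
        by (simp add: diagonal_mat_def)
      ultimately show "P (mono_mat n id c)"
        by (rule diagonal)
    qed
  next
    case (step v i)
    define t where "t = transpose i (Suc i)"
    define d :: "nat \<Rightarrow> complex" where "d j = (if j = Suc i then -1 else 1)" for j
    have t: "t permutes {..<n}" "t (t j) = j" for j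
      using adjacent_permutes[OF step.hyps(2)] by (simp_all add: t_def)
    have d: "d j * d j = 1" "d j ^ m = 1" for j
      using m by (simp_all add: d_def)
    have prod_d: "(\<Prod>j<n. d j) = -1"
      using step.hyps(2) by (simp add: d_def)
    have sign_t: "sign t = -1"
      by (simp add: t_def sign_swap_id)
    have sign_vt: "sign (v \<circ> t) = - sign v"
      using sign_t by (simp add: sign_compose permutes_lessThan_permutation[OF step.hyps(1)] permutes_lessThan_permutation[OF t(1)])
    have "P (mono_mat n (v \<circ> t) c)" if c: "admissible m (m div p) n (of_int (sign (v \<circ> t))) c" for c
    proof -
      \<comment> \<open>The entries that are left after the matrix \<open>\<sigma>\<^sub>i\<close> has been split off on the right.\<close>
      define b where "b j = c (t j) * d (t j)" for j
      have "(\<Prod>j<n. b j) = (\<Prod>j<n. c j * d j)"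
        using prod.permute[OF t(1), of "\<lambda>j. c j * d j"] by (simp add: b_def comp_def)
      then have "(\<Prod>j<n. b j) = - (\<Prod>j<n. c j)"
        using prod_d by (simp add: prod.distrib)
      then have b: "admissible m (m div p) n (of_int (sign v)) b"
        using c perm_lt[OF t(1)] by (simp add: admissible_def sign_vt b_def power_mult_distrib d)
      have "admissible m (m div p) n (of_int (sign t)) d"
        by (simp add: admissible_def d sign_t prod_d)
      then have "mono_mat n t d \<in> carrier W"
        by (intro mono_mat_in_W m(1) t(1))
      moreover have "P (mono_mat n t d)"
        using sigma[OF step.hyps(2)] sigma_mat_eq[OF step.hyps(2)] by (simp add: t_def d_def[abs_def])
      moreover have "mono_mat n v b \<in> carrier W" "P (mono_mat n v b)"
        using mono_mat_in_W[OF m(1) step.hyps(1) b] step.IH b by auto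
      ultimately have "P (mono_mat n v b * mono_mat n t d)"
        using mult by blast
      also have "mono_mat n v b * mono_mat n t d = mono_mat n (v \<circ> t) c"
        unfolding mono_mat_mult[OF t(1)] by (intro mono_mat_cong) (simp add: b_def t(2) mult.assoc d(1))
      finally show ?thesis .
    qed
    then show ?case
      unfolding t_def by blast
  qed
  ultimately show ?thesis
    by blast
qed

context
  fixes \<phi>
  assumes phi: "is_phi m p n \<phi>"
begin

lemma phi_simps:
  assumes "Poly_Mapping.keys u \<subseteq> carrier W"
  shows "Poly_Mapping.keys (\<phi> u) \<subseteq> carrier G"
    and "\<phi> (scale c u) = scale c (\<phi> u)"
    and "Poly_Mapping.keys v \<subseteq> carrier W \<Longrightarrow> \<phi> (u + v) = \<phi> u + \<phi> v"
    and "Poly_Mapping.keys v \<subseteq> carrier W \<Longrightarrow>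
      \<phi> (bil (\<lambda>g h. grp (g * h)) u v) = twisted_mult n (\<phi> u) (\<phi> v)"
proof -
  have hom: "\<phi> \<in> ring_hom (group_algebra W) (CG_twisted m p n)"
    and smult: "\<And>c x. x \<in> carrier (group_algebra W) \<Longrightarrow>
      \<phi> (c \<odot>\<^bsub>group_algebra W\<^esub> x) = c \<odot>\<^bsub>CG_twisted m p n\<^esub> \<phi> x"
    using phi by (auto simp: is_phi_def algebra_iso_def ring_iso_def)
  have closed: "Poly_Mapping.keys (\<phi> v) \<subseteq> carrier G" if "Poly_Mapping.keys v \<subseteq> carrier W" for v
    using ring_hom_closed[OF hom, of v] that by (simp add: CG_twisted_simps)
  show "Poly_Mapping.keys (\<phi> u) \<subseteq> carrier G"
    by (rule closed[OF assms])
  show "\<phi> (scale c u) = scale c (\<phi> u)"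
    using smult[of u c] assms by (simp add: CG_twisted_simps)
  show "\<phi> (u + v) = \<phi> u + \<phi> v" if "Poly_Mapping.keys v \<subseteq> carrier W"
    using ring_hom_add[OF hom, of u v] that assms by (simp add: CG_twisted_simps)
  show "\<phi> (bil (\<lambda>g h. grp (g * h)) u v) = twisted_mult n (\<phi> u) (\<phi> v)" if "Poly_Mapping.keys v \<subseteq> carrier W"
    using ring_hom_mult[OF hom, of u v] that assms CG_twisted_mult[OF closed closed, of u v] by simp
qed

text \<open>
  The elements of \<open>W\<close> with this property are closed under multiplication, since \<open>\<phi>\<close> is multiplicative and
  both sides are actions.
\<close>

lemma group_element_intertwined:
  assumes g: "g \<in> carrier W" and f: "f \<in> S_space n"
  shows "mat_action (Skew n) n g f = twisted_action n (\<phi> (grp g)) f"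
proof -
  have "\<forall>f\<in>S_space n. mat_action (Skew n) n g f = twisted_action n (\<phi> (grp g)) f"
    using _ _ _ g
  proof (rule W_generated)
    fix t assume t: "t \<in> carrier G" "diagonal_mat t"
    then have "t \<in> carrier_mat n n"
      using G_monomial by (auto simp: monomial_mat_def)
    then have "t = mono_mat n id (\<lambda>j. t $$ (j,j))"
      using t(2) by (intro eq_matI) (auto simp: diagonal_mat_def)
    then show "\<forall>f\<in>S_space n. mat_action (Skew n) n t f = twisted_action n (\<phi> (grp t)) f"
      using phi t diagonal_twisted_action by (metis is_phi_def)
  next
    fix i assume "Suc i < n"
    then show "\<forall>f\<in>S_space n. mat_action (Skew n) n (sigma_mat n i) f = twisted_action n (\<phi> (grp (sigma_mat n i))) f"
      using phi sigma_action by (simp add: is_phi_def)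
  next
    fix g h assume gh: "g \<in> carrier W" "h \<in> carrier W"
      and IH: "\<forall>f\<in>S_space n. mat_action (Skew n) n g f = twisted_action n (\<phi> (grp g)) f"
        "\<forall>f\<in>S_space n. mat_action (Skew n) n h f = twisted_action n (\<phi> (grp h)) f"
    obtain w c where wc: "w permutes {..<n}" "g = mono_mat n w c"
      using m(1) gh(1) by (rule W_groupE)
    obtain v d where vd: "v permutes {..<n}" "h = mono_mat n v d"
      using m(1) gh(2) by (rule W_groupE)
    have keys: "Poly_Mapping.keys (grp g) \<subseteq> carrier W" "Poly_Mapping.keys (grp h) \<subseteq> carrier W"
      using gh by simp_all
    have phi_gh: "\<phi> (grp (g * h)) = twisted_mult n (\<phi> (grp g)) (\<phi> (grp h))"
      using phi_simps(4)[OF keys] by simp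
    show "\<forall>f\<in>S_space n. mat_action (Skew n) n (g * h) f = twisted_action n (\<phi> (grp (g * h))) f"
    proof
      fix f assume f: "f \<in> S_space n"
      have hf: "mat_action (Skew n) n h f \<in> S_space n"
        unfolding vd(2) by (rule Skew_action_closed[OF vd(1) f])
      have "mat_action (Skew n) n (g * h) f = mat_action (Skew n) n g (mat_action (Skew n) n h f)"
        unfolding wc(2) vd(2) by (rule Skew_action_mult[OF vd(1) wc(1) f])
      also have "\<dots> = twisted_action n (\<phi> (grp g)) (twisted_action n (\<phi> (grp h)) f)"
        using IH f hf by metis
      also have "\<dots> = twisted_action n (\<phi> (grp (g * h))) f"
        unfolding phi_gh using phi_simps(1)[OF keys(1)] phi_simps(1)[OF keys(2)] G_monomial f
        by (intro twisted_action_mult[symmetric]) auto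
      finally show "mat_action (Skew n) n (g * h) f = twisted_action n (\<phi> (grp (g * h))) f" .
    qed
  qed
  then show ?thesis
    using f by blast
qed

lemma intertwined:
  assumes u: "Poly_Mapping.keys u \<subseteq> carrier W" and f: "f \<in> S_space n"
  shows "lext (\<lambda>g. mat_action (Skew n) n g f) u = twisted_action n (\<phi> u) f"
  using u
proof (induction rule: poly_mapping_linear_induct)
  case zero
  show ?case
    using phi_simps(2)[of 0 0] by (simp add: twisted_action_linear)
next
  case (single g c)
  then have "\<phi> (Poly_Mapping.single g c) = scale c (\<phi> (grp g))"
    using phi_simps(2)[of "grp g" c] by simp
  then show ?case
    using single f by (simp add: group_element_intertwined twisted_action_linear)
qed (simp add: lext_add phi_simps(3) twisted_action_linear)

lemma group_action_I:
  assumes "Poly_Mapping.keys a \<subseteq> carrier G" "f \<in> I"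
  shows "group_action n a f \<in> I"
  unfolding group_action_def using assms by (intro trivial.ideal_lext[OF ideal_Sym] G_action_I) auto

text \<open>
  The ideal is stable under \<open>G\<close> and \<open>T\<close>, so it is stable under the twisted action and thereby under \<open>W\<close>.
\<close>

lemma W_action_I:
  assumes g: "g \<in> carrier W" and f: "f \<in> I"
  shows "mat_action (Skew n) n g f \<in> I"
proof -
  have "Poly_Mapping.keys (\<phi> (grp g)) \<subseteq> carrier G"
    using phi_simps(1)[of "grp g"] g by simp
  then have "twisted_action n (\<phi> (grp g)) f \<in> I"
    unfolding twisted_action_def using T_stable_I f
    by (intro trivial.ideal_lext[OF ideal_Sym] group_action_I T_conj_carrier)
      (auto intro: twist_keysD simp: T_stable_def simp del: split_paired_All)
  then show ?thesis
    using group_element_intertwined[OF g] f I_subset by auto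
qed

lemma W_action_image:
  assumes g: "g \<in> carrier W"
  shows "mat_action (Skew n) n g ` I = I"
proof
  show "mat_action (Skew n) n g ` I \<subseteq> I"
    using W_action_I[OF g] by blast
  obtain w c where wc: "w permutes {..<n}" "admissible m (m div p) n (of_int (sign w)) c" "g = mono_mat n w c"
    using m(1) g by (rule W_groupE)
  obtain d where d: "admissible m (m div p) n (of_int (sign w)) d"
      "mono_mat n w c * mono_mat n (Hilbert_Choice.inv w) d = 1\<^sub>m n"
    using mono_mat_inverse[OF wc(1,2) m(1) sign_squared] by blast
  have "sign (Hilbert_Choice.inv w) = sign w"
    by (rule sign_inverse[OF permutes_lessThan_permutation[OF wc(1)]])
  then have d_W: "mono_mat n (Hilbert_Choice.inv w) d \<in> carrier W"
    using d(1) by (intro mono_mat_in_W m(1) permutes_inv[OF wc(1)]) simp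
  have "f = mat_action (Skew n) n g (mat_action (Skew n) n (mono_mat n (Hilbert_Choice.inv w) d) f)" if "f \<in> S_space n" for f
    using Skew_action_mult[OF permutes_inv[OF wc(1)] wc(1) that, of c d] Skew_action_one[OF that]
    unfolding d(2) wc(3) by simp
  then show "I \<subseteq> mat_action (Skew n) n g ` I"
    using I_subset W_action_I[OF d_W] by blast
qed

lemma W_action_coset:
  assumes u: "Poly_Mapping.keys u \<subseteq> carrier W" and f: "f \<in> S_space n"
  shows "W_action m p n u (coset I f) = coset I (lext (\<lambda>g. mat_action (Skew n) n g f) u)"
  unfolding W_action_def linear_action_def S_W_eq
proof (rule skew.linear_combination_Q[OF ideal_Skew])
  fix g assume "g \<in> Poly_Mapping.keys u"
  then have g: "g \<in> carrier W" using u by auto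
  show "coset_action (Skew n) n g (coset I f) = coset I (mat_action (Skew n) n g f)"
    by (rule mat_action_coset[OF W_action_image[OF g]])
  show "mat_action (Skew n) n g f \<in> S_space n"
    using m(1) g by (rule W_groupE) (simp add: Skew_action_closed f)
qed

lemma group_action_closed:
  assumes a: "Poly_Mapping.keys a \<subseteq> carrier G" and f: "f \<in> S_space n"
  shows "group_action n a f \<in> S_space n"
  unfolding group_action_def
proof (rule S_space_lext)
  fix g assume "g \<in> Poly_Mapping.keys a"
  then have g: "g \<in> carrier G" using a by auto
  show "mat_action (Sym n) n g f \<in> S_space n"
    using m(1) g by (rule G_groupE) (simp add: Sym_action_closed f)
qed

lemma G_action_coset:
  assumes a: "Poly_Mapping.keys a \<subseteq> carrier G" and f: "f \<in> S_space n"
  shows "G_action m p n a (coset I f) = coset I (group_action n a f)"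
  unfolding G_action_def linear_action_def S_G_eq group_action_def
proof (rule trivial.linear_combination_Q[OF ideal_Sym])
  fix g assume "g \<in> Poly_Mapping.keys a"
  then have g: "g \<in> carrier G" using a by auto
  show "coset_action (Sym n) n g (coset I f) = coset I (mat_action (Sym n) n g f)"
    by (rule mat_action_coset[OF G_action_image[OF g]])
  show "mat_action (Sym n) n g f \<in> S_space n"
    using m(1) g by (rule G_groupE) (simp add: Sym_action_closed f)
qed

lemma G_action_twisted_coset:
  assumes a: "Poly_Mapping.keys a \<subseteq> carrier G" and f: "f \<in> S_space n"
  shows "G_action_twisted m p n a (coset I f) = coset I (twisted_action n a f)"
  unfolding G_action_twisted_def GZ_twist_def tensor_apply_def S_G_eq twisted_action_def
proof (rule trivial.linear_combination_Q[OF ideal_Sym])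
  fix st assume "st \<in> Poly_Mapping.keys (twist n)"
  then have T: "fst st \<in> carrier (T_group n)" "snd st \<in> carrier (T_group n)"
    by (rule twist_keysD)+
  show "G_action m p n (conj_action n (fst st) a) (coset_action (Sym n) n (snd st) (coset I f)) =
    coset I (group_action n (lext (\<lambda>g. grp (fst st * g * fst st)) a) (mat_action (Sym n) n (snd st) f))"
    unfolding conj_action_eq[OF T(1)] T_action_coset[OF T(2)]
    by (rule G_action_coset[OF T_conj_carrier[OF T(1) a] T_action_closed[OF T(2) f]])
  show "group_action n (lext (\<lambda>g. grp (fst st * g * fst st)) a) (mat_action (Sym n) n (snd st) f) \<in> S_space n"
    by (rule group_action_closed[OF T_conj_carrier[OF T(1) a] T_action_closed[OF T(2) f]])
qed

theorem W_action_eq_G_action_twisted: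
  assumes u: "u \<in> carrier (group_algebra W)" and X: "X \<in> carrier (S_W m p n)"
  shows "W_action m p n u X = G_action_twisted m p n (\<phi> u) X"
proof -
  obtain f where f: "f \<in> S_space n" "X = coset I f"
    using X by (auto simp: S_W_eq skew.carrier_Q[OF ideal_Skew])
  have u: "Poly_Mapping.keys u \<subseteq> carrier W"
    using u by simp
  show ?thesis
    unfolding f(2) W_action_coset[OF u f(1)] G_action_twisted_coset[OF phi_simps(1)[OF u] f(1)]
      intertwined[OF u f(1)] ..
qed

end

end

theorem corollary5p7:
  fixes m p n :: nat
  assumes "m > 0" and "p > 0" and "n > 0" and "p dvd m" and "even m"
  shows "I_G m p n = I_W m p n \<and>
         same_algebra (S_W m p n) (S_G_twisted m p n) \<and>
         (\<forall>\<phi>. is_phi m p n \<phi> \<longrightarrow>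
            (\<forall>u\<in>carrier (group_algebra (W_group m p n)). \<forall>f\<in>carrier (S_W m p n).
               W_action m p n u f = G_action_twisted m p n (\<phi> u) f))"
proof -
  interpret reflection_pair m p n
    using assms by unfold_locales
  show ?thesis
    using I_G_eq_I_W[OF m n] same_algebra_S_W_S_G_twisted W_action_eq_G_action_twisted by blast
qed

end
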